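(* Let $G=\mathbb{Z}$ or $G=\mathbb{Z}/m\mathbb{Z}$ for some integer $m\ge 2$, let $N\ge 1$, let $1<p<\infty$ and let $p^{*}=\max\{p,\tfrac{p}{p-1}\}$. For every $\alpha=(\alpha_1,\dots,\alpha_N)\in\mathbb{C}^N$ with $|\alpha_i|\le 1$ for all $i$, the operator $R_\alpha^2=\sum_{i=1}^N\alpha_i R_i^2$ is bounded from $L^p(G^N,\mathbb{C})$ to $L^p(G^N,\mathbb{C})$ with operator norm $$\|R_\alpha^2\|\le p^{*}-1 .$$ Moreover, when $G=\mathbb{Z}$ and $N\ge 2$ the estimate is sharp: $\sup\{\|R^2_\alpha\|_{L^p(\mathbb{Z}^N,\mathbb{C})\to L^p(\mathbb{Z}^N,\mathbb{C})}:\ \alpha\in\mathbb{C}^N,\ |\alpha_i|\le 1\ \forall i\}=p^{*}-1$.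
   Context: $L^p(G^N,\mathbb{C})$ is taken with respect to counting measure. Let $e$ be the generator $1$ of $G$ and $e_i$ the element of $G^N$ with $e$ in the $i$-th coordinate and $0$ elsewhere. Discrete derivatives: $\partial_+^i f(n)=f(n+e_i)-f(n)$, $\partial_-^i f(n)=f(n)-f(n-e_i)$. Discrete Laplacian: $\Delta=\sum_{i=1}^N\partial_+^i\partial_-^i$, i.e. $\Delta f(n)=\sum_i\big(f(n+e_i)-2f(n)+f(n-e_i)\big)$. The discrete Riesz transforms are defined by $R_\pm^i\circ\sqrt{-\Delta}=\partial_\pm^i$, and they map constants to $0$. The second order Riesz transforms are $R_i^2:=R_+^iR_-^i$. Equivalently, $R_j^2$ is the Fourier multiplier operator with symbol $$\frac{-4\sin^2(\pi\xi_j)}{4\sum_i\sin^2(\pi\xi_i)},\quad \xi\in[-\tfrac12,\tfrac12]^N\quad(G=\mathbb{Z}),\qquad \frac{-4\sin^2(\frac{\pi}{m}\xi_j)}{4\sum_i\sin^2(\frac{\pi}{m}\xi_i)},\quad \xi\in(\mathbb{Z}/m\mathbb{Z})^N\quad(G=\mathbb{Z}/m\mathbb{Z}),$$ with value $0$ at $\xi=0$, where $\hat f(\xi)=\sum_{n}f(n)e^{-2\pi i n\cdot\xi}$, respectively $\hat f(\xi)=\sum_n f(n)e^{-\frac{2\pi i}{m}n\cdot\xi}$. For $G=\mathbb{Z}$ the operator is defined on finitely supported functions and extended to $L^p$ by density and continuity. *)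

theory Defs
  imports "HOL-Analysis.Analysis" "Berlekamp_Zassenhaus.Finite_Field"
begin

section \<open>The spaces \<open>L\<^sup>p\<close> over a set with counting measure\<close>

definition lp_space :: "real \<Rightarrow> ('a \<Rightarrow> complex) set" where
  "lp_space p = {f. integrable (count_space UNIV) (\<lambda>n. cmod (f n) powr p)}"

definition lp_norm :: "real \<Rightarrow> ('a \<Rightarrow> complex) \<Rightarrow> real" where
  "lp_norm p f = (LINT n|count_space UNIV. cmod (f n) powr p) powr (1 / p)"

definition lp_bounded :: "real \<Rightarrow> (('a \<Rightarrow> complex) \<Rightarrow> ('a \<Rightarrow> complex)) \<Rightarrow> bool" where
  "lp_bounded p T \<longleftrightarrow>
     (\<forall>f\<in>lp_space p. T f \<in> lp_space p) \<and>
     (\<forall>f\<in>lp_space p. \<forall>g\<in>lp_space p. T (\<lambda>n. f n + g n) = (\<lambda>n. T f n + T g n)) \<and>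
     (\<forall>c. \<forall>f\<in>lp_space p. T (\<lambda>n. c * f n) = (\<lambda>n. c * T f n)) \<and>
     (\<exists>C. \<forall>f\<in>lp_space p. lp_norm p (T f) \<le> C * lp_norm p f)"

text \<open>This is a supremum of real numbers, hence meaningful only for operators that satisfy
  \<^const>\<open>lp_bounded\<close>.\<close>

definition lp_onorm :: "real \<Rightarrow> (('a \<Rightarrow> complex) \<Rightarrow> ('a \<Rightarrow> complex)) \<Rightarrow> real" where
  "lp_onorm p T = (SUP f\<in>{f \<in> lp_space p. lp_norm p f \<le> 1}. lp_norm p (T f))"

definition lp_tendsto ::
  "real \<Rightarrow> (nat \<Rightarrow> 'a \<Rightarrow> complex) \<Rightarrow> ('a \<Rightarrow> complex) \<Rightarrow> bool" where
  "lp_tendsto p F f \<longleftrightarrow>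
     (\<forall>k. (\<lambda>n. F k n - f n) \<in> lp_space p) \<and>
     (\<lambda>k. lp_norm p (\<lambda>n. F k n - f n)) \<longlonglongrightarrow> 0"

definition finsupp :: "('a \<Rightarrow> 'b::zero) \<Rightarrow> bool" where
  "finsupp f \<longleftrightarrow> finite {n. f n \<noteq> 0}"

text \<open>The extension by density and continuity of an operator given on finitely supported
  functions: the value at \<open>f\<close> is the common limit of \<open>T (F k)\<close> over all sequences of finitely
  supported functions \<open>F k\<close> that converge to \<open>f\<close>.\<close>

definition lp_extend ::
  "real \<Rightarrow> (('a \<Rightarrow> complex) \<Rightarrow> ('a \<Rightarrow> complex)) \<Rightarrow> ('a \<Rightarrow> complex) \<Rightarrow> ('a \<Rightarrow> complex)" where
  "lp_extend p T f =
     (THE g. g \<in> lp_space p \<and>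
        (\<forall>F. (\<forall>k. finsupp (F k)) \<longrightarrow> lp_tendsto p F f \<longrightarrow> lp_tendsto p (\<lambda>k. T (F k)) g))"

section \<open>Discrete derivatives\<close>

text \<open>The group \<open>G\<close> is the additive group of \<^typ>\<open>'g\<close>, with generator \<open>1\<close>. It is used for
  \<^typ>\<open>int\<close> and for \<^typ>\<open>'m mod_ring\<close> with \<open>'m\<close> of class \<^class>\<open>nontriv\<close>, which is
  \<open>\<int>/m\<int>\<close> for \<open>m = CARD('m) \<ge> 2\<close>.\<close>

definition deriv_plus ::
  "'n::finite \<Rightarrow> (('g::comm_ring_1)^'n \<Rightarrow> complex) \<Rightarrow> ('g^'n \<Rightarrow> complex)" where
  "deriv_plus i f n = f (n + axis i 1) - f n"

definition deriv_minus ::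
  "'n::finite \<Rightarrow> (('g::comm_ring_1)^'n \<Rightarrow> complex) \<Rightarrow> ('g^'n \<Rightarrow> complex)" where
  "deriv_minus i f n = f n - f (n - axis i 1)"

definition laplacian ::
  "(('g::comm_ring_1)^'n::finite \<Rightarrow> complex) \<Rightarrow> ('g^'n \<Rightarrow> complex)" where
  "laplacian f n = (\<Sum>i\<in>UNIV. deriv_plus i (deriv_minus i f) n)"

section \<open>Fourier multipliers\<close>

text \<open>Symbols are functions of \<open>x \<in> \<real>\<^sup>N\<close>, where \<open>x = \<xi>\<close> for \<open>G = \<int>\<close> and \<open>x = \<xi>/m\<close> for
  \<open>G = \<int>/m\<int>\<close>.\<close>

definition character :: "int^'n::finite \<Rightarrow> real^'n \<Rightarrow> complex" where
  "character n x = cis (2 * pi * (\<Sum>i\<in>UNIV. of_int (n $ i) * x $ i))"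

definition fourier_int :: "(int^'n::finite \<Rightarrow> complex) \<Rightarrow> real^'n \<Rightarrow> complex" where
  "fourier_int f \<xi> = (\<Sum>n | f n \<noteq> 0. f n * cnj (character n \<xi>))"

definition unit_cube :: "(real^'n::finite) set" where
  "unit_cube = cbox (\<chi> i. - 1 / 2) (\<chi> i. 1 / 2)"

definition multiplier_int ::
  "(real^'n::finite \<Rightarrow> complex) \<Rightarrow> (int^'n \<Rightarrow> complex) \<Rightarrow> (int^'n \<Rightarrow> complex)" where
  "multiplier_int \<sigma> f n =
     (LINT \<xi>:unit_cube|lborel. \<sigma> \<xi> * fourier_int f \<xi> * character n \<xi>)"

definition cyc_rep :: "('m::finite mod_ring)^'n::finite \<Rightarrow> int^'n" where
  "cyc_rep n = (\<chi> i. to_int_mod_ring (n $ i))"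

definition cyc_freq :: "('m::finite mod_ring)^'n::finite \<Rightarrow> real^'n" where
  "cyc_freq \<xi> = (\<chi> i. of_int (to_int_mod_ring (\<xi> $ i)) / real CARD('m))"

definition fourier_cyc ::
  "(('m::finite mod_ring)^'n::finite \<Rightarrow> complex) \<Rightarrow> ('m mod_ring)^'n \<Rightarrow> complex" where
  "fourier_cyc f \<xi> = (\<Sum>n\<in>UNIV. f n * cnj (character (cyc_rep n) (cyc_freq \<xi>)))"

definition multiplier_cyc ::
  "(real^'n::finite \<Rightarrow> complex) \<Rightarrow> (('m::finite mod_ring)^'n \<Rightarrow> complex) \<Rightarrow>
   (('m mod_ring)^'n \<Rightarrow> complex)" where
  "multiplier_cyc \<sigma> f n =
     (\<Sum>\<xi>\<in>UNIV. \<sigma> (cyc_freq \<xi>) * fourier_cyc f \<xi> * character (cyc_rep n) (cyc_freq \<xi>))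
       / of_nat (CARD('m) ^ CARD('n))"

section \<open>Second order Riesz transforms\<close>

text \<open>On the frequencies in question the denominator vanishes only at \<open>\<xi> = 0\<close>, and there the
  value is \<open>0\<close> because of \<open>x / 0 = 0\<close>.\<close>

definition riesz2_symbol :: "'n::finite \<Rightarrow> real^'n \<Rightarrow> complex" where
  "riesz2_symbol j x =
     of_real (- 4 * (sin (pi * x $ j))\<^sup>2 / (4 * (\<Sum>i\<in>UNIV. (sin (pi * x $ i))\<^sup>2)))"

definition riesz2_int ::
  "real \<Rightarrow> 'n::finite \<Rightarrow> (int^'n \<Rightarrow> complex) \<Rightarrow> (int^'n \<Rightarrow> complex)" where
  "riesz2_int p j = lp_extend p (multiplier_int (riesz2_symbol j))"

definition riesz2_cyc ::
  "'n::finite \<Rightarrow> (('m::nontriv mod_ring)^'n \<Rightarrow> complex) \<Rightarrow> (('m mod_ring)^'n \<Rightarrow> complex)" where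
  "riesz2_cyc j = multiplier_cyc (riesz2_symbol j)"

definition riesz2_alpha_int ::
  "real \<Rightarrow> complex^'n::finite \<Rightarrow> (int^'n \<Rightarrow> complex) \<Rightarrow> (int^'n \<Rightarrow> complex)" where
  "riesz2_alpha_int p \<alpha> f n = (\<Sum>i\<in>UNIV. \<alpha> $ i * riesz2_int p i f n)"

definition riesz2_alpha_cyc ::
  "complex^'n::finite \<Rightarrow> (('m::nontriv mod_ring)^'n \<Rightarrow> complex) \<Rightarrow>
   (('m mod_ring)^'n \<Rightarrow> complex)" where
  "riesz2_alpha_cyc \<alpha> f n = (\<Sum>i\<in>UNIV. \<alpha> $ i * riesz2_cyc i f n)"

definition conj_max :: "real \<Rightarrow> real" where
  "conj_max p = max p (p / (p - 1))"

section \<open>Relation to the first order Riesz transforms\<close>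

text \<open>The first order transforms are characterised by \<open>R\<^sub>\<plusminus>\<^sup>i \<circ> \<surd>(-\<Delta>) = \<partial>\<^sub>\<plusminus>\<^sup>i\<close> and by annihilating
  constants, and \<open>R\<^sub>i\<^sup>2 = R\<^sub>+\<^sup>i R\<^sub>-\<^sup>i\<close>. The facts below confirm that the multiplier
  \<^const>\<open>riesz2_symbol\<close> agrees with this: its symbol is the product of the symbols of
  \<open>R\<^sub>+\<^sup>i\<close> and \<open>R\<^sub>-\<^sup>i\<close>, which are the symbols of \<open>\<partial>\<^sub>\<plusminus>\<^sup>i\<close> divided by the one of \<open>\<surd>(-\<Delta>)\<close>.\<close>

definition deriv_plus_symbol :: "'n::finite \<Rightarrow> real^'n \<Rightarrow> complex" where
  "deriv_plus_symbol i x = cis (2 * pi * x $ i) - 1"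

definition deriv_minus_symbol :: "'n::finite \<Rightarrow> real^'n \<Rightarrow> complex" where
  "deriv_minus_symbol i x = 1 - cis (- (2 * pi * x $ i))"

definition sqrt_laplacian_symbol :: "real^'n::finite \<Rightarrow> complex" where
  "sqrt_laplacian_symbol x = of_real (sqrt (4 * (\<Sum>i\<in>UNIV. (sin (pi * x $ i))\<^sup>2)))"

definition riesz_plus_symbol :: "'n::finite \<Rightarrow> real^'n \<Rightarrow> complex" where
  "riesz_plus_symbol i x = deriv_plus_symbol i x / sqrt_laplacian_symbol x"

definition riesz_minus_symbol :: "'n::finite \<Rightarrow> real^'n \<Rightarrow> complex" where
  "riesz_minus_symbol i x = deriv_minus_symbol i x / sqrt_laplacian_symbol x"

lemma deriv_plus_minus_symbol:
  "deriv_plus_symbol i x * deriv_minus_symbol i x = of_real (- 4 * (sin (pi * x $ i))\<^sup>2)"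
proof -
  have c: "cos (2 * (pi * x $ i)) = 1 - 2 * (sin (pi * x $ i))\<^sup>2"
    by (rule cos_double_sin)
  have "deriv_plus_symbol i x * deriv_minus_symbol i x
      = cis (2 * (pi * x $ i)) + cnj (cis (2 * (pi * x $ i))) - 1 - cis (2 * (pi * x $ i)) * cnj (cis (2 * (pi * x $ i)))"
    by (simp add: deriv_plus_symbol_def deriv_minus_symbol_def algebra_simps cis_cnj)
  also have "\<dots> = of_real (2 * cos (2 * (pi * x $ i))) - 2"
    by (simp add: cis_cnj cis_mult complex_eq_iff)
  finally show ?thesis by (simp add: c)
qed

lemma sqrt_laplacian_symbol_squared:
  "sqrt_laplacian_symbol x ^ 2 = - (\<Sum>i\<in>UNIV. deriv_plus_symbol i x * deriv_minus_symbol i x)"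
proof -
  have "sqrt_laplacian_symbol x ^ 2 = of_real (4 * (\<Sum>i\<in>UNIV. (sin (pi * x $ i))\<^sup>2))"
    unfolding sqrt_laplacian_symbol_def
    by (subst of_real_power[symmetric], subst real_sqrt_pow2) (auto intro!: sum_nonneg)
  then show ?thesis
    by (simp add: deriv_plus_minus_symbol sum_distrib_left sum_negf)
qed

lemma riesz2_symbol_eq: "riesz2_symbol j x = riesz_plus_symbol j x * riesz_minus_symbol j x"
proof -
  have "riesz_plus_symbol j x * riesz_minus_symbol j x
      = (deriv_plus_symbol j x * deriv_minus_symbol j x) / sqrt_laplacian_symbol x ^ 2"
    by (simp add: riesz_plus_symbol_def riesz_minus_symbol_def power2_eq_square)
  then show ?thesis
    by (simp add: deriv_plus_minus_symbol sqrt_laplacian_symbol_squared riesz2_symbol_def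
        sum_distrib_left sum_negf)
qed

lemma sqrt_laplacian_symbol_eq_0:
  assumes "sqrt_laplacian_symbol x = 0"
  shows "deriv_plus_symbol i x = 0" "deriv_minus_symbol i x = 0"
proof -
  have "(\<Sum>i\<in>UNIV. (sin (pi * x $ i))\<^sup>2) = 0"
    using assms by (simp add: sqrt_laplacian_symbol_def)
  then have "sin (pi * x $ i) = 0"
    by (subst (asm) sum_nonneg_eq_0_iff) auto
  then have s: "sin (2 * (pi * x $ i)) = 0" "cos (2 * (pi * x $ i)) = 1"
    by (simp_all only: sin_double cos_double_sin) simp_all
  then show "deriv_plus_symbol i x = 0" "deriv_minus_symbol i x = 0"
    by (simp_all add: deriv_plus_symbol_def deriv_minus_symbol_def complex_eq_iff mult.assoc)
qed

lemma riesz_symbol_sqrt_laplacian: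
  "riesz_plus_symbol i x * sqrt_laplacian_symbol x = deriv_plus_symbol i x"
  "riesz_minus_symbol i x * sqrt_laplacian_symbol x = deriv_minus_symbol i x"
  using sqrt_laplacian_symbol_eq_0[of x i]
  by (auto simp: riesz_plus_symbol_def riesz_minus_symbol_def)

lemma riesz_symbol_0: "riesz_plus_symbol i 0 = 0" "riesz_minus_symbol i 0 = 0"
  by (simp_all add: riesz_plus_symbol_def riesz_minus_symbol_def sqrt_laplacian_symbol_def)

lemma character_add: "character (n + k) x = character n x * character k x"
  by (simp add: character_def cis_mult algebra_simps sum.distrib)

lemma character_diff: "character (n - k) x = character n x * cnj (character k x)"
  by (simp add: character_def cis_mult cis_cnj algebra_simps sum_subtractf)

lemma character_axis: "character (axis i 1) x = cis (2 * pi * x $ i)"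
  by (simp add: character_def axis_def if_distrib[of of_int] if_distrib[of "\<lambda>a. a * _"] cong: if_cong)

lemma norm_character [simp]: "cmod (character n x) = 1"
  by (simp add: character_def)

lemma character_cnj_mult [simp]: "character n x * cnj (character n x) = 1"
  by (simp add: complex_norm_square[symmetric])

lemma finsupp_diff:
  assumes "finsupp f" "finsupp g" shows "finsupp (\<lambda>n. f n - g n :: complex)"
  using assms unfolding finsupp_def
  by (rule finite_subset[rotated, OF finite_UnI]) auto

lemma finsupp_shift:
  fixes f :: "'a::group_add \<Rightarrow> complex"
  assumes "finsupp f" shows "finsupp (\<lambda>n. f (n + k))"
proof -
  have "{n. f (n + k) \<noteq> 0} = (\<lambda>n. n - k) ` {n. f n \<noteq> 0}"
    by (auto simp: image_iff) (metis add_diff_cancel)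
  then show ?thesis using assms by (simp add: finsupp_def)
qed

lemma fourier_int_superset:
  assumes "finite A" "{n. f n \<noteq> 0} \<subseteq> A"
  shows "fourier_int f \<xi> = (\<Sum>n\<in>A. f n * cnj (character n \<xi>))"
  unfolding fourier_int_def by (rule sum.mono_neutral_left) (use assms in auto)

lemma fourier_int_diff:
  assumes "finsupp f" "finsupp g"
  shows "fourier_int (\<lambda>n. f n - g n) \<xi> = fourier_int f \<xi> - fourier_int g \<xi>"
proof -
  let ?A = "{n. f n \<noteq> 0} \<union> {n. g n \<noteq> 0}"
  have A: "finite ?A" using assms by (simp add: finsupp_def)
  have "fourier_int (\<lambda>n. f n - g n) \<xi> = (\<Sum>n\<in>?A. (f n - g n) * cnj (character n \<xi>))"
    by (rule fourier_int_superset[OF A]) auto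
  moreover have "fourier_int f \<xi> = (\<Sum>n\<in>?A. f n * cnj (character n \<xi>))"
    by (rule fourier_int_superset[OF A]) auto
  moreover have "fourier_int g \<xi> = (\<Sum>n\<in>?A. g n * cnj (character n \<xi>))"
    by (rule fourier_int_superset[OF A]) auto
  ultimately show ?thesis by (simp add: left_diff_distrib sum_subtractf)
qed

lemma fourier_int_shift:
  "fourier_int (\<lambda>n. f (n + k)) \<xi> = character k \<xi> * fourier_int f \<xi>"
proof -
  have "fourier_int f \<xi> = (\<Sum>n | f (n + k) \<noteq> 0. f (n + k) * cnj (character (n + k) \<xi>))"
    unfolding fourier_int_def
    by (rule sum.reindex_bij_witness[of _ "\<lambda>n. n + k" "\<lambda>n. n - k"]) auto
  moreover have "f (n + k) * cnj (character n \<xi>)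
      = character k \<xi> * (f (n + k) * cnj (character (n + k) \<xi>))" for n
    using character_cnj_mult[of k \<xi>] by (simp add: character_add) (algebra)
  ultimately show ?thesis
    unfolding fourier_int_def[of "\<lambda>n. f (n + k)"] by (simp only: sum_distrib_left)
qed

lemma finsupp_deriv:
  assumes "finsupp f"
  shows "finsupp (deriv_plus i f)" "finsupp (deriv_minus i f)"
  unfolding deriv_plus_def[abs_def] deriv_minus_def[abs_def]
  using finsupp_diff[OF finsupp_shift[OF assms] assms, of "axis i 1"]
    finsupp_diff[OF assms finsupp_shift[OF assms], of "- axis i 1"] by simp_all

lemma fourier_int_deriv_plus:
  assumes "finsupp f"
  shows "fourier_int (deriv_plus i f) \<xi> = deriv_plus_symbol i \<xi> * fourier_int f \<xi>"
  unfolding deriv_plus_def[abs_def] deriv_plus_symbol_def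
  by (simp add: fourier_int_diff finsupp_shift assms fourier_int_shift character_axis algebra_simps)

lemma fourier_int_deriv_minus:
  assumes "finsupp f"
  shows "fourier_int (deriv_minus i f) \<xi> = deriv_minus_symbol i \<xi> * fourier_int f \<xi>"
proof -
  have "character (- axis i 1) \<xi> = cis (- (2 * pi * \<xi> $ i))"
    using character_diff[of 0 "axis i 1" \<xi>]
    by (simp add: character_axis cis_cnj) (simp add: character_def)
  then show ?thesis
    unfolding deriv_minus_def[abs_def] deriv_minus_symbol_def
    using fourier_int_diff[OF assms finsupp_shift[OF assms], of "- axis i 1"]
     fourier_int_shift[of f "- axis i 1"] by (simp add: left_diff_distrib)
qed

lemma integral_cis_unit_interval:
  "(LINT x|lborel. indicator {- 1 / 2..1 / 2} x *\<^sub>R cis (2 * pi * (of_int k * x)))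
     = (if k = 0 then 1 else 0)"
proof (cases "k = 0")
  case True
  then show ?thesis by (simp add: cis_zero)
next
  case False
  let ?c = "2 * pi * of_int k :: real"
  have c: "?c \<noteq> 0" using False by simp
  let ?F = "\<lambda>x. cis (?c * x) / (\<i> * of_real ?c)"
  have "(?F has_vector_derivative cis (2 * pi * (of_int k * x))) (at x within {-1/2..1/2})" for x
  proof -
    have "((\<lambda>x. cis (?c * x)) has_vector_derivative ?c *\<^sub>R (\<i> * cis (?c * x))) (at x within {-1/2..1/2})"
      unfolding has_vector_derivative_def
      by (rule derivative_eq_intros refl | rule ext)+ (simp add: scaleR_conv_of_real mult_ac)
    from has_vector_derivative_divide[OF this, of "\<i> * of_real ?c"]
    show ?thesis using c by (simp add: scaleR_conv_of_real mult_ac)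
  qed
  then have "((\<lambda>x. cis (2 * pi * (of_int k * x))) has_integral (?F (1/2) - ?F (-1/2))) {-1/2..1/2}"
    by (intro fundamental_theorem_of_calculus) auto
  moreover have "set_integrable lborel {-1/2..1/2::real} (\<lambda>x. cis (2 * pi * (of_int k * x)))"
    by (intro borel_integrable_atLeastAtMost') (auto intro!: continuous_intros)
  ultimately have "(LINT x:{-1/2..1/2}|lborel. cis (2 * pi * (of_int k * x))) = ?F (1/2) - ?F (-1/2)"
    by (metis set_borel_integral_eq_integral(2) integral_unique)
  also have "\<dots> = 0"
  proof -
    have "cis (?c * (1/2)) = cis (?c * (-1/2))"
      by (simp add: complex_eq_iff)
    then show ?thesis by simp
  qed
  finally show ?thesis using False by (simp add: set_lebesgue_integral_def)
qed

lemma integral_character_unit_cube: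
  fixes n :: "int^'n::finite"
  shows "(LINT \<xi>:unit_cube|lborel. character n \<xi>) = (if n = 0 then 1 else 0)"
proof -
  let ?g = "\<lambda>k x::real. indicator {- 1 / 2..1 / 2} x *\<^sub>R cis (2 * pi * (of_int k * x))"
  interpret product_sigma_finite "\<lambda>_::real^'n. lborel :: real measure" ..
  have int: "integrable lborel (?g k)" for k
    unfolding set_integrable_def[symmetric]
    by (intro borel_integrable_atLeastAtMost') (auto intro!: continuous_intros)
  have meas: "(\<lambda>x. ?g k x) \<in> borel_measurable borel" for k
    using borel_measurable_integrable[OF int] by simp
  have meas': "(\<lambda>\<xi>. ?g k (\<xi> \<bullet> b)) \<in> borel_measurable borel" for k and b :: "real^'n"
    by (rule measurable_compose[OF _ meas]) simp
  have eq: "indicator unit_cube \<xi> *\<^sub>R character n \<xi> = (\<Prod>b\<in>Basis. ?g (n $ axis_index b) (\<xi> \<bullet> b))"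
    for \<xi> :: "real^'n"
  proof -
    have "(\<Prod>b\<in>Basis. ?g (n $ axis_index b) (\<xi> \<bullet> b)) = (\<Prod>i\<in>UNIV. ?g (n $ i) (\<xi> $ i))"
      by (rule prod.reindex_bij_witness[of _ "\<lambda>i. axis i 1" axis_index])
         (auto simp: axis_index_axis axis_inverse Basis_vec_def inner_axis)
    also have "\<dots> = indicator unit_cube \<xi> *\<^sub>R (\<Prod>i\<in>UNIV. cis (2 * pi * (of_int (n $ i) * \<xi> $ i)))"
      by (auto simp: unit_cube_def indicator_def mem_box_cart scaleR_conv_of_real)
    also have "(\<Prod>i\<in>UNIV. cis (2 * pi * (of_int (n $ i) * \<xi> $ i))) = character n \<xi>"
      by (simp add: character_def cis_conv_exp exp_sum[symmetric] sum_distrib_left)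
    finally show ?thesis by simp
  qed
  have "(LINT \<xi>:unit_cube|lborel. character n \<xi>) = (LINT \<xi>::real^'n|lborel. (\<Prod>b\<in>Basis. ?g (n $ axis_index b) (\<xi> \<bullet> b)))"
    unfolding set_lebesgue_integral_def eq by (rule refl)
  also have "\<dots> = (LINT x|(\<Pi>\<^sub>M b\<in>Basis. lborel). (\<Prod>b\<in>Basis. ?g (n $ axis_index b) ((\<Sum>c\<in>Basis. x c *\<^sub>R c) \<bullet> (b::real^'n))))"
    unfolding lborel_eq[where 'a="real^'n"]
    by (intro integral_distr borel_measurable_prod meas') simp
  also have "\<dots> = (LINT x|(\<Pi>\<^sub>M b\<in>Basis. lborel). (\<Prod>b\<in>(Basis::(real^'n) set). ?g (n $ axis_index b) (x b)))"
    by (intro Bochner_Integration.integral_cong prod.cong refl) simp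
  also have "\<dots> = (\<Prod>b\<in>(Basis::(real^'n) set). LINT x|lborel. ?g (n $ axis_index b) x)"
    using int by (intro product_integral_prod finite_Basis) blast
  also have "\<dots> = (\<Prod>b\<in>(Basis::(real^'n) set). if n $ axis_index b = 0 then 1 else 0)"
    by (simp only: integral_cis_unit_interval)
  also have "\<dots> = (\<Prod>i\<in>UNIV. if n $ i = 0 then 1 else 0)"
    by (rule prod.reindex_bij_witness[of _ "\<lambda>i. axis i 1" axis_index])
       (auto simp: axis_index_axis axis_inverse Basis_vec_def)
  also have "\<dots> = (if n = 0 then 1 else 0)"
    by (auto simp: vec_eq_iff)
  finally show ?thesis .
qed

lemma set_integrable_character:
  fixes n :: "int^'n::finite"
  shows "set_integrable lborel unit_cube (character n)"
proof -
  have "set_integrable lborel (cbox a b) (character n)" for a b :: "real^'n"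
    unfolding character_def[abs_def] set_integrable_def
    by (intro borel_integrable_compact) (auto intro!: continuous_intros)
  then show ?thesis by (simp add: unit_cube_def)
qed

lemma multiplier_int_one:
  assumes "finsupp f"
  shows "multiplier_int (\<lambda>_. 1) f = f"
proof
  fix n
  have eq: "fourier_int f \<xi> * character n \<xi> = (\<Sum>k | f k \<noteq> 0. f k * character (n - k) \<xi>)" for \<xi>
    unfolding fourier_int_def character_diff sum_distrib_right by (simp add: mult_ac)
  have int: "integrable lborel (\<lambda>\<xi>. indicator unit_cube \<xi> *\<^sub>R (f k * character (n - k) \<xi>))" for k
    using set_integrable_mult_right[of "f k", OF set_integrable_character[of "n - k"]]
    by (simp add: set_integrable_def)
  have "multiplier_int (\<lambda>_. 1) f n = (\<Sum>k | f k \<noteq> 0. LINT \<xi>:unit_cube|lborel. f k * character (n - k) \<xi>)"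
    unfolding multiplier_int_def mult_1_left eq set_lebesgue_integral_def scaleR_sum_right
    by (rule Bochner_Integration.integral_sum) (rule int)
  also have "\<dots> = (\<Sum>k | f k \<noteq> 0. f k * (if k = n then 1 else 0))"
    by (intro sum.cong refl) (auto simp: integral_character_unit_cube)
  also have "\<dots> = (\<Sum>k | f k \<noteq> 0. if k = n then f k else 0)"
    by (intro sum.cong refl) simp
  also have "\<dots> = f n"
    using assms by (simp add: finsupp_def)
  finally show "multiplier_int (\<lambda>_. 1) f n = f n" .
qed

lemma multiplier_int_deriv:
  assumes "finsupp f"
  shows "multiplier_int (deriv_plus_symbol i) f = deriv_plus i f"
    and "multiplier_int (deriv_minus_symbol i) f = deriv_minus i f"
  using multiplier_int_one[OF finsupp_deriv(1)[OF assms, of i]]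
    multiplier_int_one[OF finsupp_deriv(2)[OF assms, of i]]
  by (simp_all add: multiplier_int_def fun_eq_iff fourier_int_deriv_plus fourier_int_deriv_minus assms)

lemma fourier_int_sum:
  assumes "\<And>i. i \<in> I \<Longrightarrow> finsupp (g i)" "finite I"
  shows "fourier_int (\<lambda>n. \<Sum>i\<in>I. g i n) \<xi> = (\<Sum>i\<in>I. fourier_int (g i) \<xi>)"
proof -
  let ?A = "\<Union>i\<in>I. {n. g i n \<noteq> 0}"
  have A: "finite ?A" using assms by (auto simp: finsupp_def)
  have "fourier_int (\<lambda>n. \<Sum>i\<in>I. g i n) \<xi> = (\<Sum>n\<in>?A. (\<Sum>i\<in>I. g i n) * cnj (character n \<xi>))"
    by (rule fourier_int_superset[OF A]) (auto dest: sum.not_neutral_contains_not_neutral)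
  also have "\<dots> = (\<Sum>i\<in>I. \<Sum>n\<in>?A. g i n * cnj (character n \<xi>))"
    by (simp add: sum_distrib_right sum.swap[of _ I])
  also have "\<dots> = (\<Sum>i\<in>I. fourier_int (g i) \<xi>)"
    by (intro sum.cong refl fourier_int_superset[OF A, symmetric]) auto
  finally show ?thesis .
qed

lemma fourier_int_laplacian:
  assumes "finsupp f"
  shows "fourier_int (laplacian f) \<xi> = - (sqrt_laplacian_symbol \<xi>)\<^sup>2 * fourier_int f \<xi>"
  unfolding laplacian_def[abs_def] sqrt_laplacian_symbol_squared
  by (simp add: fourier_int_sum finsupp_deriv assms fourier_int_deriv_plus fourier_int_deriv_minus
      sum_distrib_right mult.assoc)

lemma multiplier_riesz2_int_laplacian:
  assumes "finsupp f"
  shows "multiplier_int (riesz2_symbol j) (laplacian f) = (\<lambda>n. - deriv_plus j (deriv_minus j f) n)"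
proof -
  have "riesz2_symbol j \<xi> * (- (sqrt_laplacian_symbol \<xi>)\<^sup>2 * fourier_int f \<xi>)
      = - fourier_int (deriv_plus j (deriv_minus j f)) \<xi>" for \<xi>
    using riesz_symbol_sqrt_laplacian[of j \<xi>]
    by (simp add: riesz2_symbol_eq fourier_int_deriv_plus fourier_int_deriv_minus finsupp_deriv assms
        power2_eq_square) (metis (no_types) mult.assoc mult.commute)
  then have "multiplier_int (riesz2_symbol j) (laplacian f) n
      = - multiplier_int (\<lambda>_. 1) (deriv_plus j (deriv_minus j f)) n" for n
    by (simp add: multiplier_int_def fourier_int_laplacian assms set_lebesgue_integral_def)
  then show ?thesis
    by (simp add: multiplier_int_one finsupp_deriv assms fun_eq_iff)
qed

lemma character_cyc_axis:
  fixes k \<xi> :: "('m::nontriv mod_ring)^'n::finite"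
  shows "character (cyc_rep (axis i 1 :: ('m mod_ring)^'n)) x = cis (2 * pi * x $ i)"
proof -
  have "cyc_rep (axis i 1 :: ('m mod_ring)^'n) = axis i 1"
    by (simp add: cyc_rep_def axis_def vec_eq_iff)
  then show ?thesis by (simp add: character_axis)
qed

lemma cis_2pi_of_int: "cis (2 * pi * of_int k) = 1"
  by (rule cis_multiple_2pi) simp

lemma character_cong:
  fixes \<xi> :: "('m::nontriv mod_ring)^'n::finite"
  assumes "\<And>i. int CARD('m) dvd a $ i - b $ i"
  shows "character a (cyc_freq \<xi>) = character b (cyc_freq \<xi>)"
proof -
  from assms obtain q where q: "a $ i - b $ i = int CARD('m) * q i" for i
    unfolding dvd_def by metis
  have "character (a - b) (cyc_freq \<xi>) = cis (2 * pi * of_int (\<Sum>i\<in>UNIV. q i * to_int_mod_ring (\<xi> $ i)))"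
    by (simp add: character_def cyc_freq_def q)
  then have "character (a - b) (cyc_freq \<xi>) = 1" by (simp only: cis_2pi_of_int)
  then show ?thesis using character_add[of "a - b" b] by simp
qed

lemma character_cyc_add:
  fixes n k \<xi> :: "('m::nontriv mod_ring)^'n::finite"
  shows "character (cyc_rep (n + k)) (cyc_freq \<xi>)
     = character (cyc_rep n) (cyc_freq \<xi>) * character (cyc_rep k) (cyc_freq \<xi>)"
proof -
  have "to_int_mod_ring (a + b) = (to_int_mod_ring a + to_int_mod_ring b) mod int CARD('m)" for a b :: "'m mod_ring"
    by transfer simp
  then have "character (cyc_rep (n + k)) (cyc_freq \<xi>) = character (cyc_rep n + cyc_rep k) (cyc_freq \<xi>)"
    by (intro character_cong) (simp add: cyc_rep_def mod_eq_dvd_iff[symmetric])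
  then show ?thesis by (simp add: character_add)
qed

abbreviation cchar :: "('m::nontriv mod_ring)^'n::finite \<Rightarrow> ('m mod_ring)^'n \<Rightarrow> complex" where
  "cchar n \<xi> \<equiv> character (cyc_rep n) (cyc_freq \<xi>)"

lemma cchar_sym:
  fixes n k \<xi> :: "('m::nontriv mod_ring)^'n::finite"
  shows "cchar n \<xi> = cchar \<xi> n"
  by (simp add: character_def cyc_rep_def cyc_freq_def mult.commute)

lemma cchar_diff:
  fixes n k \<xi> :: "('m::nontriv mod_ring)^'n::finite"
  shows "cchar (n - k) \<xi> = cchar n \<xi> * cnj (cchar k \<xi>)"
  using character_cyc_add[of "n - k" k \<xi>] by (simp add: mult.assoc)

lemma cchar_0: "cchar 0 \<xi> = 1"
  by (simp add: character_def cyc_rep_def)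

lemma sum_cchar:
  fixes n :: "('m::nontriv mod_ring)^'n::finite"
  shows "(\<Sum>\<xi>\<in>UNIV. cchar n \<xi>) = (if n = 0 then of_nat (CARD('m) ^ CARD('n)) else 0)"
proof (cases "n = 0")
  case True
  show ?thesis unfolding True cchar_0 by simp
next
  case False
  then obtain i where i: "n $ i \<noteq> 0" by (auto simp: vec_eq_iff)
  let ?e = "axis i 1 :: ('m mod_ring)^'n"
  let ?t = "to_int_mod_ring (n $ i)"
  have "?t \<in> {0..<int CARD('m)}"
    unfolding range_to_int_mod_ring[symmetric] by (rule rangeI)
  moreover have "?t \<noteq> 0"
    using i by simp
  ultimately have t: "0 < ?t" "?t < int CARD('m)"
    unfolding atLeastLessThan_iff by linarith+
  have "(\<Sum>\<xi>\<in>UNIV. cchar n \<xi>) = (\<Sum>\<xi>\<in>UNIV. cchar n (\<xi> + ?e))"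
    by (rule sum.reindex_bij_witness[of _ "\<lambda>x. x + ?e" "\<lambda>x. x - ?e"]) auto
  also have "\<dots> = (\<Sum>\<xi>\<in>UNIV. cchar n \<xi>) * cchar ?e n"
    unfolding cchar_sym[of n] character_cyc_add sum_distrib_right ..
  finally have "(\<Sum>\<xi>\<in>UNIV. cchar n \<xi>) = 0 \<or> cchar ?e n = 1" by simp
  moreover have "cchar ?e n \<noteq> 1"
  proof
    assume "cchar ?e n = 1"
    then have "cos (2 * pi * (?t / real CARD('m))) = 1"
      by (simp add: character_cyc_axis cyc_freq_def complex_eq_iff)
    then obtain k :: int where "2 * pi * (?t / real CARD('m)) = of_int k * (2 * pi)"
      unfolding cos_one_2pi_int by auto
    then have "real_of_int ?t = of_int (k * int CARD('m))" by (simp add: field_simps)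
    then have "?t = k * int CARD('m)" by (simp only: of_int_eq_iff)
    then have "int CARD('m) dvd ?t" by simp
    then show False using t zdvd_not_zless by blast
  qed
  ultimately show ?thesis using False by simp
qed

lemma multiplier_cyc_one:
  fixes f :: "('m::nontriv mod_ring)^'n::finite \<Rightarrow> complex"
  shows "multiplier_cyc (\<lambda>_. 1) f = f"
proof
  fix n :: "('m mod_ring)^'n"
  have "(\<Sum>\<xi>\<in>UNIV. fourier_cyc f \<xi> * cchar n \<xi>) = (\<Sum>\<xi>\<in>UNIV. \<Sum>k\<in>UNIV. f k * cchar (n - k) \<xi>)"
    unfolding fourier_cyc_def cchar_diff sum_distrib_right by (simp add: mult_ac)
  also have "\<dots> = (\<Sum>k\<in>UNIV. f k * (\<Sum>\<xi>\<in>UNIV. cchar (n - k) \<xi>))"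
    by (subst sum.swap) (simp add: sum_distrib_left)
  also have "\<dots> = (\<Sum>k\<in>UNIV. if k = n then f k * of_nat (CARD('m) ^ CARD('n)) else 0)"
    by (intro sum.cong refl) (simp add: sum_cchar)
  finally show "multiplier_cyc (\<lambda>_. 1) f n = f n"
    by (simp add: multiplier_cyc_def)
qed

lemma fourier_multiplier_cyc:
  fixes f :: "('m::nontriv mod_ring)^'n::finite \<Rightarrow> complex"
  shows "fourier_cyc (multiplier_cyc \<sigma> f) \<eta> = \<sigma> (cyc_freq \<eta>) * fourier_cyc f \<eta>"
proof -
  let ?M = "of_nat (CARD('m) ^ CARD('n)) :: complex"
  let ?a = "\<lambda>\<xi>. \<sigma> (cyc_freq \<xi>) * fourier_cyc f \<xi> / ?M"
  have "fourier_cyc (multiplier_cyc \<sigma> f) \<eta> = (\<Sum>n\<in>UNIV. \<Sum>\<xi>\<in>UNIV. ?a \<xi> * cchar (\<xi> - \<eta>) n)"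
    unfolding fourier_cyc_def[of "multiplier_cyc \<sigma> f"] multiplier_cyc_def
      sum_divide_distrib sum_distrib_right
  proof (intro sum.cong refl)
    fix n \<xi> :: "('m mod_ring)^'n"
    show "\<sigma> (cyc_freq \<xi>) * fourier_cyc f \<xi> * cchar n \<xi> / ?M * cnj (cchar n \<eta>)
        = ?a \<xi> * cchar (\<xi> - \<eta>) n"
      unfolding cchar_diff cchar_sym[of \<xi> n] cchar_sym[of \<eta> n] by simp
  qed
  also have "\<dots> = (\<Sum>\<xi>\<in>UNIV. ?a \<xi> * (\<Sum>n\<in>UNIV. cchar (\<xi> - \<eta>) n))"
    by (subst sum.swap) (simp add: sum_distrib_left)
  also have "\<dots> = (\<Sum>\<xi>\<in>UNIV. if \<xi> = \<eta> then ?a \<xi> * ?M else 0)"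
    by (intro sum.cong refl) (simp add: sum_cchar)
  finally show ?thesis by simp
qed

lemma multiplier_cyc_compose:
  fixes f :: "('m::nontriv mod_ring)^'n::finite \<Rightarrow> complex"
  shows "multiplier_cyc \<sigma> (multiplier_cyc \<tau> f) = multiplier_cyc (\<lambda>x. \<sigma> x * \<tau> x) f"
  unfolding multiplier_cyc_def[of \<sigma>] fourier_multiplier_cyc
  by (simp add: multiplier_cyc_def fun_eq_iff mult.assoc)

lemma fourier_cyc_shift:
  fixes f :: "('m::nontriv mod_ring)^'n::finite \<Rightarrow> complex"
  shows "fourier_cyc (\<lambda>n. f (n + k)) \<xi> = cchar k \<xi> * fourier_cyc f \<xi>"
proof -
  have "fourier_cyc f \<xi> = (\<Sum>n\<in>UNIV. f (n + k) * cnj (cchar (n + k) \<xi>))"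
    unfolding fourier_cyc_def
    by (rule sum.reindex_bij_witness[of _ "\<lambda>n. n + k" "\<lambda>n. n - k"]) auto
  moreover have "f (n + k) * cnj (cchar n \<xi>) = cchar k \<xi> * (f (n + k) * cnj (cchar (n + k) \<xi>))" for n
    using character_cnj_mult[of "cyc_rep k" "cyc_freq \<xi>"] by (simp add: character_cyc_add) (algebra)
  ultimately show ?thesis
    unfolding fourier_cyc_def[of "\<lambda>n. f (n + k)"] by (simp only: sum_distrib_left)
qed

lemma fourier_cyc_diff:
  "fourier_cyc (\<lambda>n. f n - g n) \<xi> = fourier_cyc f \<xi> - fourier_cyc g \<xi>"
  by (simp add: fourier_cyc_def left_diff_distrib sum_subtractf)

lemma multiplier_cyc_deriv:
  fixes f :: "('m::nontriv mod_ring)^'n::finite \<Rightarrow> complex"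
  shows "multiplier_cyc (deriv_plus_symbol i) f = deriv_plus i f"
    and "multiplier_cyc (deriv_minus_symbol i) f = deriv_minus i f"
proof -
  have "fourier_cyc (deriv_plus i f) \<xi> = deriv_plus_symbol i (cyc_freq \<xi>) * fourier_cyc f \<xi>" for \<xi>
    unfolding deriv_plus_def[abs_def] deriv_plus_symbol_def
    by (simp add: fourier_cyc_diff fourier_cyc_shift character_cyc_axis left_diff_distrib)
  then have "multiplier_cyc (deriv_plus_symbol i) f = multiplier_cyc (\<lambda>_. 1) (deriv_plus i f)"
    by (simp add: multiplier_cyc_def fun_eq_iff)
  then show "multiplier_cyc (deriv_plus_symbol i) f = deriv_plus i f"
    by (simp add: multiplier_cyc_one)
  have "cchar (- axis i 1) \<xi> = cis (- (2 * pi * cyc_freq \<xi> $ i))" for \<xi> :: "('m mod_ring)^'n"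
    using cchar_diff[of 0 "axis i 1" \<xi>]
    by (simp add: character_cyc_axis cis_cnj cchar_0)
  then have "fourier_cyc (deriv_minus i f) \<xi> = deriv_minus_symbol i (cyc_freq \<xi>) * fourier_cyc f \<xi>" for \<xi>
    using fourier_cyc_shift[of f "- axis i 1" \<xi>]
    unfolding deriv_minus_def[abs_def] deriv_minus_symbol_def
    by (simp add: fourier_cyc_diff left_diff_distrib)
  then have "multiplier_cyc (deriv_minus_symbol i) f = multiplier_cyc (\<lambda>_. 1) (deriv_minus i f)"
    by (simp add: multiplier_cyc_def fun_eq_iff)
  then show "multiplier_cyc (deriv_minus_symbol i) f = deriv_minus i f"
    by (simp add: multiplier_cyc_one)
qed

lemma riesz_cyc_sqrt_laplacian:
  fixes f :: "('m::nontriv mod_ring)^'n::finite \<Rightarrow> complex"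
  shows "multiplier_cyc (riesz_plus_symbol i) (multiplier_cyc sqrt_laplacian_symbol f) = deriv_plus i f"
    and "multiplier_cyc (riesz_minus_symbol i) (multiplier_cyc sqrt_laplacian_symbol f) = deriv_minus i f"
  by (simp_all add: multiplier_cyc_compose riesz_symbol_sqrt_laplacian multiplier_cyc_deriv)

lemma riesz2_cyc_eq:
  fixes f :: "('m::nontriv mod_ring)^'n::finite \<Rightarrow> complex"
  shows "riesz2_cyc i f = multiplier_cyc (riesz_plus_symbol i) (multiplier_cyc (riesz_minus_symbol i) f)"
  by (simp add: multiplier_cyc_compose riesz2_symbol_eq[abs_def] riesz2_cyc_def)

end

theory Submission
  imports Defs
begin

text \<open>The laziness carries the sharp constant. A step is treated as a uniform choice of
  neighbour, which needs only joint concavity of \<open>bellman\<close>, combined with a two-point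
  split of weights \<epsilon> and 1 - \<epsilon>, which yields the gain \<epsilon>(1 -
  \<epsilon>)|d||e|. The summed gains give the desired symbol times the factor
  \<open>damping\<close>, which depends on the frequency for fixed \<epsilon> and becomes 1 only in
  the limit. The gain already contains absolute values, so the coefficients enter only through their
  moduli and complex ones cost nothing extra. The second derivative of Burkholder's function along
  the relevant lines has the right sign for p \<ge> 2; for p < 2 the functions f and g exchange
  roles.

  In the lower bound the obstacle is that second differences of a lattice function cannot be
  prescribed freely. Means over a period hardly notice the edges of long strips, so test functions
  can be spliced. The majorant is finite because the assumed bound controls it at (0, 0), and
  splicing with constants carries this control to every (a, b).\<close>

text \<open>Upper bound. A lazy random walk step replaces \<open>f\<close> by an average of \<open>(1 - \<epsilon>)f + \<epsilon>f(\<sqdot> \<plusminus> e\<^sub>i)\<close>.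
  Let \<open>b(x, y)\<close> be the Legendre transform of Burkholder's function. The sum over the group of
  \<open>b(f, g)\<close> increases in each step by at least a multiple of the sum of
  \<open>\<bar>f(n \<plusminus> e\<^sub>i) - f(n)\<bar>\<bar>g(n \<plusminus> e\<^sub>i) - g(n)\<bar>\<close>, it is never positive, and it starts above
  \<open>- (p - 1)\<^sup>p\<parallel>f\<parallel>\<^sub>p\<^sup>p/p - \<parallel>g\<parallel>\<^sub>q\<^sup>q/q\<close> when \<open>p \<ge> 2\<close>. Hence the total gain along the walk is at most
  \<open>(p\<^sup>* - 1)\<parallel>f\<parallel>\<^sub>p\<parallel>g\<parallel>\<^sub>q\<close>. It dominates the pairing of \<open>g\<close> with an operator whose symbol tends to that
  of \<open>- R\<^sub>\<alpha>\<^sup>2\<close> as \<open>\<epsilon> \<rightarrow> 0\<close>.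

  Sharpness. Take \<open>\<alpha> = (1, -1, 0, \<dots>)\<close>. Applied to Laplacians, a bound with constant \<open>C\<close> says that
  \<open>\<bar>a - b\<bar>\<^sup>p - C\<^sup>p\<bar>a + b\<bar>\<^sup>p\<close> has nonpositive mean over the second differences \<open>(a, b)\<close> of every periodic
  function on the square lattice. The supremum of these means with \<open>(a, b)\<close> translated is then a
  finite \<open>p\<close>-homogeneous function that is concave in each variable, and such a majorant exists only
  if \<open>C \<ge> p\<^sup>* - 1\<close>.\<close>

section \<open>Sequence spaces\<close>

lemma lp_space_iff: "f \<in> lp_space p \<longleftrightarrow> (\<lambda>n. cmod (f n) powr p) summable_on UNIV"
proof -
  have "f \<in> lp_space p \<longleftrightarrow> Infinite_Sum.abs_summable_on (\<lambda>n. cmod (f n) powr p) UNIV"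
    unfolding abs_summable_equivalent abs_summable_on_def lp_space_def by simp
  also have "\<dots> \<longleftrightarrow> (\<lambda>n. cmod (f n) powr p) summable_on UNIV" by simp
  finally show ?thesis .
qed

lemma lp_norm_eq:
  assumes "f \<in> lp_space p"
  shows "lp_norm p f = (\<Sum>\<^sub>\<infinity>n. cmod (f n) powr p) powr (1 / p)"
proof -
  have "Infinite_Set_Sum.abs_summable_on (\<lambda>n. cmod (f n) powr p) UNIV"
    using assms by (simp add: abs_summable_on_def lp_space_def)
  from infsetsum_infsum[OF this] show ?thesis
    by (simp add: lp_norm_def infsetsum_def)
qed

lemma lp_norm_nonneg [simp]: "0 \<le> lp_norm p f"
  by (simp add: lp_norm_def)

lemma lp_norm_powr:
  assumes "0 < p" "f \<in> lp_space p"
  shows "lp_norm p f powr p = (\<Sum>\<^sub>\<infinity>n. cmod (f n) powr p)"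
  using assms by (simp add: lp_norm_eq powr_powr infsum_nonneg)

lemma lp_sum_le:
  assumes "0 < p" "f \<in> lp_space p" "finite S"
  shows "(\<Sum>n\<in>S. cmod (f n) powr p) \<le> lp_norm p f powr p"
  unfolding lp_norm_powr[OF assms(1,2)]
  by (rule finite_sum_le_infsum) (use assms in \<open>auto simp: lp_space_iff\<close>)

text \<open>All terms are nonnegative, so a uniform bound on finite partial sums gives summability
  and the norm bound at once. Limit arguments below are therefore carried out in finite sums and
  closed by this lemma.\<close>

lemma lp_memI:
  assumes "0 < p" "0 \<le> C" "\<And>S. finite S \<Longrightarrow> (\<Sum>n\<in>S. cmod (f n) powr p) \<le> C powr p"
  shows "f \<in> lp_space p" "lp_norm p f \<le> C"
proof -
  show f: "f \<in> lp_space p"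
    unfolding lp_space_iff
    by (rule nonneg_bdd_above_summable_on) (use assms(3) in \<open>auto simp: bdd_above_def\<close>)
  have "(\<Sum>\<^sub>\<infinity>n. cmod (f n) powr p) \<le> C powr p"
    by (rule infsum_le_finite_sums) (use f assms(3) in \<open>auto simp: lp_space_iff\<close>)
  then have "lp_norm p f \<le> (C powr p) powr (1 / p)"
    unfolding lp_norm_eq[OF f] using assms(1) by (intro powr_mono2) (auto intro!: infsum_nonneg)
  then show "lp_norm p f \<le> C"
    using assms by (simp add: powr_powr)
qed

lemma powr_convex_combination:
  fixes a b t :: real
  assumes "1 \<le> p" "0 \<le> a" "0 \<le> b" "0 \<le> t" "t \<le> 1"
  shows "((1 - t) * a + t * b) powr p \<le> (1 - t) * a powr p + t * b powr p"
proof -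
  \<comment> \<open>Convexity of the power is applied at positive arguments; if a or b is 0, the
    bound \<open>u powr p \<le> u\<close> for u in [0, 1] takes its place.\<close>
  have mono: "u * (x powr p) \<ge> (u * x) powr p" if "0 \<le> u" "u \<le> 1" "0 \<le> x" for u x :: real
  proof (cases "u = 0")
    case False
    then have "u powr p \<le> u powr 1" using that assms by (intro powr_mono') auto
    then show ?thesis using that False by (simp add: powr_mult mult_right_mono)
  qed simp
  show ?thesis
  proof (cases "a = 0 \<or> b = 0")
    case True
    then show ?thesis using mono[of "1-t" a] mono[of t b] assms by auto
  next
    case False
    then show ?thesis
      using convex_onD[OF powr_convex[OF assms(1)], of t a b] assms by simp
  qed
qed

text \<open>Minkowski's inequality from convexity of the power: |f| + |g| is (a + b) times a convex
  combination of |f|/a and |g|/b, with weights a/(a + b) and b/(a + b), and the p-th power sums of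
  these quotients are at most 1.\<close>

lemma lp_norm_add:
  assumes "1 \<le> p" and f: "f \<in> lp_space p" and g: "g \<in> lp_space p"
  shows "(\<lambda>n. f n + g n) \<in> lp_space p" (is ?A)
    and "lp_norm p (\<lambda>n. f n + g n) \<le> lp_norm p f + lp_norm p g" (is ?B)
proof -
  define F where "F = lp_norm p f"
  define G where "G = lp_norm p g"
  have p: "0 < p" using assms by simp
  \<comment> \<open>The slack e keeps the normalizing constants a and b positive even when a norm is
    0; \<open>main'\<close> lets it tend to 0.\<close>
  have main: "(\<Sum>n\<in>S. cmod (f n + g n) powr p) \<le> ((F + e) + (G + e)) powr p"
    if "finite S" "0 < e" for S e
  proof -
    define a where "a = F + e"
    define b where "b = G + e"
    have ab: "0 < a" "0 < b" "F \<le> a" "G \<le> b" using that by (auto simp: a_def b_def F_def G_def add_nonneg_pos)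
    define t where "t = b / (a + b)"
    have t: "0 \<le> t" "t \<le> 1" "1 - t = a / (a + b)" using ab by (auto simp: t_def field_simps)
    have "cmod (f n + g n) powr p \<le> (a + b) powr p * ((1 - t) * (cmod (f n) / a) powr p + t * (cmod (g n) / b) powr p)" for n
    proof -
      have "cmod (f n + g n) powr p \<le> (cmod (f n) + cmod (g n)) powr p"
        using p by (intro powr_mono2 norm_triangle_ineq) auto
      also have "cmod (f n) + cmod (g n) = (a + b) * ((1 - t) * (cmod (f n) / a) + t * (cmod (g n) / b))"
      proof -
        have "(a + b) * ((1 - t) * (cmod (f n) / a)) = cmod (f n)" "(a + b) * (t * (cmod (g n) / b)) = cmod (g n)"
          unfolding t(3) using ab by (simp_all add: t_def)
        then show ?thesis by (simp add: distrib_left)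
      qed
      also have "\<dots> powr p = (a + b) powr p * ((1 - t) * (cmod (f n) / a) + t * (cmod (g n) / b)) powr p"
        by (rule powr_mult)
      also have "\<dots> \<le> (a + b) powr p * ((1 - t) * (cmod (f n) / a) powr p + t * (cmod (g n) / b) powr p)"
        using ab t assms(1) by (intro mult_left_mono powr_convex_combination) auto
      finally show ?thesis .
    qed
    then have "(\<Sum>n\<in>S. cmod (f n + g n) powr p)
        \<le> (\<Sum>n\<in>S. (a + b) powr p * ((1 - t) * (cmod (f n) / a) powr p + t * (cmod (g n) / b) powr p))"
      by (intro sum_mono)
    also have "\<dots> = (a + b) powr p * ((1 - t) * (\<Sum>n\<in>S. cmod (f n) powr p) / a powr p
        + t * (\<Sum>n\<in>S. cmod (g n) powr p) / b powr p)"
      using ab by (simp add: powr_divide sum_distrib_left sum.distrib sum_divide_distrib distrib_left mult.assoc)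
    also have "\<dots> \<le> (a + b) powr p * ((1 - t) * 1 + t * 1)"
    proof -
      have "(\<Sum>n\<in>S. cmod (f n) powr p) / a powr p \<le> 1"
        using order_trans[OF lp_sum_le[OF p f \<open>finite S\<close>] powr_mono2[of p "lp_norm p f" a]] ab p
        by (simp add: F_def)
      moreover have "(\<Sum>n\<in>S. cmod (g n) powr p) / b powr p \<le> 1"
        using order_trans[OF lp_sum_le[OF p g \<open>finite S\<close>] powr_mono2[of p "lp_norm p g" b]] ab p
        by (simp add: G_def)
      ultimately show ?thesis using t(1,2) 
        unfolding times_divide_eq_right[symmetric]
        by (intro mult_left_mono add_mono) auto
    qed
    finally show ?thesis by (simp add: a_def b_def)
  qed
  have main': "(\<Sum>n\<in>S. cmod (f n + g n) powr p) \<le> (F + G) powr p" if "finite S" for S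
  proof (rule tendsto_lowerbound)
    show "((\<lambda>e. ((F + e) + (G + e)) powr p) \<longlongrightarrow> (F + G) powr p) (at_right 0)"
      using p by (auto intro!: tendsto_eq_intros tendsto_powr' simp: F_def G_def add_nonneg_nonneg
        eventually_at_right_less intro!: eventually_mono[OF eventually_at_right_less[of 0]])
    show "\<forall>\<^sub>F e in at_right 0. (\<Sum>n\<in>S. cmod (f n + g n) powr p) \<le> ((F + e) + (G + e)) powr p"
      using main[OF that] by (auto intro: eventually_mono[OF eventually_at_right_less[of 0]])
  qed simp
  show ?A by (rule lp_memI(1)[OF p _ main']) (simp add: F_def G_def)
  show ?B using lp_memI(2)[OF p _ main'] by (simp add: F_def G_def)
qed

lemma lp_norm_scale:
  assumes "0 < p" "f \<in> lp_space p"
  shows "(\<lambda>n. c * f n) \<in> lp_space p" "lp_norm p (\<lambda>n. c * f n) = cmod c * lp_norm p f"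
proof -
  have eq: "(\<lambda>n. cmod (c * f n) powr p) = (\<lambda>n. cmod c powr p * cmod (f n) powr p)"
    by (simp add: norm_mult powr_mult)
  show mem: "(\<lambda>n. c * f n) \<in> lp_space p"
    using assms unfolding lp_space_iff eq by (intro summable_on_cmult_right)
  show "lp_norm p (\<lambda>n. c * f n) = cmod c * lp_norm p f"
    unfolding lp_norm_eq[OF mem] eq infsum_cmult_right' lp_norm_eq[OF assms(2)]
    using assms by (simp add: powr_mult powr_powr infsum_nonneg)
qed

lemma lp_norm_diff:
  assumes "1 \<le> p" and f: "f \<in> lp_space p" and g: "g \<in> lp_space p"
  shows "(\<lambda>n. f n - g n) \<in> lp_space p"
    and "lp_norm p (\<lambda>n. f n - g n) \<le> lp_norm p f + lp_norm p g"
  using lp_norm_add[OF assms(1) f lp_norm_scale(1)[of p g "-1", OF _ g]]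
    lp_norm_scale[of p g "-1", OF _ g] assms(1) by auto

lemma lp_norm_minus_commute: "lp_norm p (\<lambda>n. f n - g n) = lp_norm p (\<lambda>n. g n - f n)"
  by (simp add: lp_norm_def norm_minus_commute)

lemma finsupp_lp:
  assumes "finsupp f" shows "f \<in> lp_space p"
  unfolding lp_space_iff
  by (rule finite_nonzero_values_imp_summable_on) (use assms in \<open>simp add: finsupp_def\<close>)

lemma finsupp_lp_norm_powr:
  assumes "0 < p" "finite S" "{n. f n \<noteq> 0} \<subseteq> S"
  shows "lp_norm p f powr p = (\<Sum>n\<in>S. cmod (f n) powr p)"
proof -
  have "finsupp f" using assms finite_subset by (auto simp: finsupp_def)
  moreover have "(\<Sum>\<^sub>\<infinity>n. cmod (f n) powr p) = (\<Sum>\<^sub>\<infinity>n\<in>S. cmod (f n) powr p)"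
    using assms(3) by (intro infsum_cong_neutral) auto
  ultimately show ?thesis using assms(2) by (simp add: lp_norm_powr[OF assms(1) finsupp_lp])
qed

lemma cmod_le_lp_norm:
  assumes "0 < p" "f \<in> lp_space p"
  shows "cmod (f n) \<le> lp_norm p f"
proof (rule ccontr)
  assume "\<not> ?thesis"
  then have "lp_norm p f powr p < cmod (f n) powr p"
    using assms(1) by (intro powr_less_mono2) auto
  then show False using lp_sum_le[OF assms, of "{n}"] by simp
qed


section \<open>Convergence in the p-norm and extension by density\<close>

lemma lp_tendsto_unique:
  assumes "1 \<le> p" "lp_tendsto p F g" "lp_tendsto p F h"
  shows "g = h"
proof
  fix n
  have "cmod (h n - g n) \<le> lp_norm p (\<lambda>n. F k n - g n) + lp_norm p (\<lambda>n. F k n - h n)" for k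
    using lp_norm_diff[OF assms(1), of "\<lambda>n. F k n - g n" "\<lambda>n. F k n - h n"] assms
      cmod_le_lp_norm[of p "\<lambda>n. (F k n - g n) - (F k n - h n)" n]
    by (auto simp: lp_tendsto_def intro: order_trans)
  moreover have "(\<lambda>k. lp_norm p (\<lambda>n. F k n - g n) + lp_norm p (\<lambda>n. F k n - h n)) \<longlonglongrightarrow> 0 + 0"
    using assms by (intro tendsto_add) (auto simp: lp_tendsto_def)
  ultimately have "cmod (h n - g n) \<le> 0 + 0"
    by (intro tendsto_lowerbound[OF _ always_eventually]) auto
  then show "g n = h n" by simp
qed

lemma lp_tendstoI:
  assumes "\<And>k. (\<lambda>n. F k n - f n) \<in> lp_space p" "\<And>k. lp_norm p (\<lambda>n. F k n - f n) \<le> e k" "e \<longlonglongrightarrow> 0"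
  shows "lp_tendsto p F f"
proof -
  have "(\<lambda>k. lp_norm p (\<lambda>n. F k n - f n)) \<longlonglongrightarrow> 0"
    by (rule tendsto_sandwich[OF always_eventually always_eventually tendsto_const assms(3)])
       (simp_all add: assms(2))
  then show ?thesis using assms(1) by (simp add: lp_tendsto_def)
qed

lemma lp_tendsto_add:
  assumes "1 \<le> p" "lp_tendsto p F f" "lp_tendsto p G g"
  shows "lp_tendsto p (\<lambda>k n. F k n + G k n) (\<lambda>n. f n + g n)"
proof (rule lp_tendstoI)
  fix k
  have eq: "(\<lambda>n. F k n + G k n - (f n + g n)) = (\<lambda>n. (F k n - f n) + (G k n - g n))" by auto
  show "(\<lambda>n. F k n + G k n - (f n + g n)) \<in> lp_space p"
    "lp_norm p (\<lambda>n. F k n + G k n - (f n + g n)) \<le> lp_norm p (\<lambda>n. F k n - f n) + lp_norm p (\<lambda>n. G k n - g n)"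
    unfolding eq using assms lp_norm_add[OF assms(1), of "\<lambda>n. F k n - f n" "\<lambda>n. G k n - g n"] by (auto simp: lp_tendsto_def)
next
  show "(\<lambda>k. lp_norm p (\<lambda>n. F k n - f n) + lp_norm p (\<lambda>n. G k n - g n)) \<longlonglongrightarrow> 0"
    using assms by (intro tendsto_add_zero) (auto simp: lp_tendsto_def)
qed

lemma lp_tendsto_scale:
  assumes "0 < p" "lp_tendsto p F f"
  shows "lp_tendsto p (\<lambda>k n. c * F k n) (\<lambda>n. c * f n)"
proof (rule lp_tendstoI)
  fix k
  have eq: "(\<lambda>n. c * F k n - c * f n) = (\<lambda>n. c * (F k n - f n))" by (auto simp: algebra_simps)
  show "(\<lambda>n. c * F k n - c * f n) \<in> lp_space p"
    "lp_norm p (\<lambda>n. c * F k n - c * f n) \<le> cmod c * lp_norm p (\<lambda>n. F k n - f n)"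
    unfolding eq using assms lp_norm_scale[OF assms(1), of "\<lambda>n. F k n - f n" c] by (auto simp: lp_tendsto_def)
next
  show "(\<lambda>k. cmod c * lp_norm p (\<lambda>n. F k n - f n)) \<longlonglongrightarrow> 0"
    using assms by (intro tendsto_mult_right_zero) (auto simp: lp_tendsto_def)
qed

lemma lp_tendsto_const: 
  assumes "0 < p" shows "lp_tendsto p (\<lambda>_. f) f"
  using finsupp_lp[of "\<lambda>_. 0" p] assms
  by (auto simp: lp_tendsto_def finsupp_def lp_norm_def)

lemma lp_tendsto_sum:
  assumes "1 \<le> p" "finite I" "\<And>i. i \<in> I \<Longrightarrow> lp_tendsto p (F i) (f i)"
  shows "lp_tendsto p (\<lambda>k n. \<Sum>i\<in>I. F i k n) (\<lambda>n. \<Sum>i\<in>I. f i n)"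
  using assms(2,3)
proof (induction I)
  case empty
  then show ?case using lp_tendsto_const[of p "\<lambda>_. 0"] assms(1) by simp
next
  case (insert i I)
  then show ?case
    using lp_tendsto_add[OF assms(1), of "F i" "f i" "\<lambda>k n. \<Sum>i\<in>I. F i k n" "\<lambda>n. \<Sum>i\<in>I. f i n"] by simp
qed

lemma lp_norm_limit_le:
  assumes p: "1 \<le> p" and C: "0 \<le> C" and "lp_tendsto p F f" "lp_tendsto p G g"
    and "\<And>k. F k \<in> lp_space p" "\<And>k. G k \<in> lp_space p" "f \<in> lp_space p"
    and bound: "\<And>k. lp_norm p (G k) \<le> C * lp_norm p (F k)"
  shows "g \<in> lp_space p" "lp_norm p g \<le> C * lp_norm p f"
proof -
  let ?d = "\<lambda>k. lp_norm p (\<lambda>n. F k n - f n)" and ?e = "\<lambda>k. lp_norm p (\<lambda>n. G k n - g n)"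
  have g: "g \<in> lp_space p" and le: "lp_norm p g \<le> lp_norm p (G k) + ?e k" for k
    using lp_norm_diff[OF p, of "G k" "\<lambda>n. G k n - g n"] assms by (auto simp: lp_tendsto_def)
  show "g \<in> lp_space p" by (rule g)
  have "lp_norm p (F k) \<le> lp_norm p f + ?d k" for k
    using lp_norm_add[OF p, of f "\<lambda>n. F k n - f n"] assms by (auto simp: lp_tendsto_def)
  then have "lp_norm p g \<le> C * (lp_norm p f + ?d k) + ?e k" for k
    using le[of k] bound[of k] mult_left_mono[OF _ C, of "lp_norm p (F k)" "lp_norm p f + ?d k"]
    by (meson add_right_mono order_trans)
  moreover have "(\<lambda>k. C * (lp_norm p f + ?d k) + ?e k) \<longlonglongrightarrow> C * (lp_norm p f + 0) + 0"
    using assms by (intro tendsto_intros) (auto simp: lp_tendsto_def)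
  ultimately have "lp_norm p g \<le> C * (lp_norm p f + 0) + 0"
    by (intro tendsto_lowerbound[OF _ always_eventually]) auto
  then show "lp_norm p g \<le> C * lp_norm p f" by simp
qed

lemma finsupp_approx:
  assumes p: "0 < p" and f: "f \<in> lp_space p"
  obtains F where "\<And>k. finsupp (F k)" "lp_tendsto p F f"
proof -
  let ?h = "\<lambda>n. cmod (f n) powr p"
  define e where "e k = 1 / real (Suc k)" for k
  have e: "0 < e k" for k by (simp add: e_def)
  have "\<exists>S. finite S \<and> infsum ?h UNIV < sum ?h S + e k powr p" for k
  proof -
    have "(?h has_sum infsum ?h UNIV) UNIV" using f by (simp add: lp_space_iff)
    then have "(sum ?h \<longlongrightarrow> infsum ?h UNIV) (finite_subsets_at_top UNIV)"
      by (simp add: has_sum_def)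
    then have "\<forall>\<^sub>F S in finite_subsets_at_top UNIV. infsum ?h UNIV - e k powr p < sum ?h S"
      by (rule order_tendstoD) (use e[of k] in simp)
    then obtain S where "finite S" "infsum ?h UNIV - e k powr p < sum ?h S"
      by (auto simp: eventually_finite_subsets_at_top)
    then show ?thesis by (intro exI[of _ S]) auto
  qed
  then obtain S where S: "\<And>k. finite (S k)" "\<And>k. infsum ?h UNIV < sum ?h (S k) + e k powr p"
    by metis
  define F where "F k n = (if n \<in> S k then f n else 0)" for k n
  have "(\<Sum>n\<in>T. cmod (F k n - f n) powr p) \<le> e k powr p" if "finite T" for T k
  proof -
    have "(\<Sum>n\<in>T. cmod (F k n - f n) powr p) = (\<Sum>n\<in>T - S k. ?h n)"
      using that by (intro sum.mono_neutral_cong_right) (auto simp: F_def)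
    also have "\<dots> = sum ?h (T \<union> S k) - sum ?h (S k)"
      using that S(1)[of k] sum_diff[of "T \<union> S k" "S k" ?h] by (simp add: Un_Diff)
    also have "\<dots> \<le> infsum ?h UNIV - sum ?h (S k)"
      using lp_sum_le[OF p f, of "T \<union> S k"] that S(1)[of k] lp_norm_powr[OF p f] by simp
    finally show ?thesis using S(2)[of k] by linarith
  qed
  from lp_memI[OF p less_imp_le[OF e] this]
  have *: "(\<lambda>n. F k n - f n) \<in> lp_space p" "lp_norm p (\<lambda>n. F k n - f n) \<le> e k" for k by auto
  have "e \<longlonglongrightarrow> 0" unfolding e_def by (rule LIMSEQ_Suc[OF lim_1_over_n])
  then have "lp_tendsto p F f" by (rule lp_tendstoI[OF *])
  moreover have "finsupp (F k)" for k
    unfolding finsupp_def by (rule finite_subset[OF _ S(1)[of k]]) (auto simp: F_def)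
  ultimately show ?thesis by (rule that[rotated])
qed

text \<open>The images form a Cauchy sequence at every point. The pointwise limit g is also the
  limit in p-norm, since the Cauchy estimate on finite sets survives the limit in its second index
  (Fatou's argument). Another approximating sequence has images differing by a null sequence, so g
  meets the description in \<open>lp_extend\<close>, and uniqueness of limits makes it the only
  candidate.\<close>

lemma lp_extend_tendsto:
  assumes p: "1 \<le> p" and C: "0 \<le> C"
    and diff: "\<And>f g. finsupp f \<Longrightarrow> finsupp g \<Longrightarrow> T (\<lambda>n. f n - g n) = (\<lambda>n. T f n - T g n)"
    and mem: "\<And>f. finsupp f \<Longrightarrow> T f \<in> lp_space p"
    and bound: "\<And>f. finsupp f \<Longrightarrow> lp_norm p (T f) \<le> C * lp_norm p f"
    and f: "f \<in> lp_space p" and F: "\<And>k. finsupp (F k)" "lp_tendsto p F f"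
  shows "lp_tendsto p (\<lambda>k. T (F k)) (lp_extend p T f)"
proof -
  have p0: "0 < p" using p by simp
  let ?e = "\<lambda>F k. lp_norm p (\<lambda>n. F k n - f n)"
  have close: "(\<lambda>n. T (F k) n - T (G j) n) \<in> lp_space p"
    "lp_norm p (\<lambda>n. T (F k) n - T (G j) n) \<le> C * (?e F k + ?e G j)"
    if "\<And>k. finsupp (F k)" "\<And>k. finsupp (G k)" "lp_tendsto p F f" "lp_tendsto p G f" for F G k j
  proof -
    have fin: "finsupp (\<lambda>n. F k n - G j n)" using that by (intro finsupp_diff)
    have eq: "(\<lambda>n. T (F k) n - T (G j) n) = T (\<lambda>n. F k n - G j n)" using diff that by simp
    have "lp_norm p (\<lambda>n. F k n - G j n) \<le> ?e F k + ?e G j"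
      using lp_norm_diff[OF p, of "\<lambda>n. F k n - f n" "\<lambda>n. G j n - f n"] that by (simp add: lp_tendsto_def)
    then show "lp_norm p (\<lambda>n. T (F k) n - T (G j) n) \<le> C * (?e F k + ?e G j)"
      unfolding eq using bound[OF fin] C by (meson mult_left_mono order_trans)
    show "(\<lambda>n. T (F k) n - T (G j) n) \<in> lp_space p" unfolding eq using mem[OF fin] .
  qed
  have e0: "?e F \<longlonglongrightarrow> 0" using F by (simp add: lp_tendsto_def)
  have "Cauchy (\<lambda>k. T (F k) n)" for n
  proof (rule metric_CauchyI)
    fix r :: real assume "0 < r"
    then have "\<forall>\<^sub>F k in sequentially. ?e F k < r / (2 * (C + 1))"
      using C by (intro order_tendstoD(2)[OF e0]) simp
    then obtain K where K: "\<And>k. k \<ge> K \<Longrightarrow> ?e F k < r / (2 * (C + 1))"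
      by (auto simp: eventually_sequentially)
    show "\<exists>M. \<forall>m\<ge>M. \<forall>k\<ge>M. dist (T (F m) n) (T (F k) n) < r"
    proof (intro exI allI impI)
      fix m k assume mk: "m \<ge> K" "k \<ge> K"
      have "dist (T (F m) n) (T (F k) n) \<le> C * (?e F m + ?e F k)"
        using cmod_le_lp_norm[OF p0 close(1)[OF F(1) F(1) F(2) F(2), of m k], of n]
          close(2)[OF F(1) F(1) F(2) F(2), of m k] by (simp add: dist_norm)
      also have "\<dots> \<le> C * (r / (C + 1))"
        using K[OF mk(1)] K[OF mk(2)] C by (intro mult_left_mono) (auto simp: field_simps)
      also have "\<dots> < r" using C \<open>0 < r\<close> by (simp add: field_simps)
      finally show "dist (T (F m) n) (T (F k) n) < r" .
    qed
  qed
  then have "\<exists>l. (\<lambda>k. T (F k) n) \<longlonglongrightarrow> l" for n by (simp add: Cauchy_convergent_iff convergent_def)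
  then obtain g where g: "\<And>n. (\<lambda>k. T (F k) n) \<longlonglongrightarrow> g n" by metis
  have fin: "(\<Sum>n\<in>S. cmod (T (F k) n - g n) powr p) \<le> (C * ?e F k) powr p" if "finite S" for S k
  proof (rule LIMSEQ_le)
    show "(\<lambda>j. \<Sum>n\<in>S. cmod (T (F k) n - T (F j) n) powr p) \<longlonglongrightarrow> (\<Sum>n\<in>S. cmod (T (F k) n - g n) powr p)"
      using p0 by (intro tendsto_sum tendsto_powr' tendsto_intros g) auto
    have "(\<lambda>j. (C * (?e F k + ?e F j)) powr p) \<longlonglongrightarrow> (C * (?e F k + 0)) powr p"
      using p0 C by (intro tendsto_powr' tendsto_intros e0) (auto intro!: always_eventually)
    then show "(\<lambda>j. (C * (?e F k + ?e F j)) powr p) \<longlonglongrightarrow> (C * ?e F k) powr p" by simp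
    have "(\<Sum>n\<in>S. cmod (T (F k) n - T (F j) n) powr p) \<le> (C * (?e F k + ?e F j)) powr p" for j
      using lp_sum_le[OF p0 close(1)[OF F(1) F(1) F(2) F(2)] that, of k j]
        powr_mono2[OF _ _ close(2)[OF F(1) F(1) F(2) F(2), of k j], of p] p0
      by (smt (verit) lp_norm_nonneg)
    then show "\<exists>N. \<forall>j\<ge>N. (\<Sum>n\<in>S. cmod (T (F k) n - T (F j) n) powr p) \<le> (C * (?e F k + ?e F j)) powr p"
      by blast
  qed
  have lim: "lp_tendsto p (\<lambda>k. T (F k)) g"
    by (rule lp_tendstoI[of _ _ _ "\<lambda>k. C * ?e F k"])
       (use lp_memI[OF p0 _ fin] C in \<open>auto intro!: tendsto_mult_right_zero e0\<close>)
  have g_lp: "g \<in> lp_space p"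
    using lp_norm_diff(1)[OF p mem[OF F(1)[of 0]], of "\<lambda>n. T (F 0) n - g n"] lim by (simp add: lp_tendsto_def)
  have other: "lp_tendsto p (\<lambda>k. T (G k)) g" if G: "\<And>k. finsupp (G k)" "lp_tendsto p G f" for G
  proof -
    have "lp_tendsto p (\<lambda>k n. T (G k) n - T (F k) n) (\<lambda>_. 0)"
    proof (rule lp_tendstoI[of _ _ _ "\<lambda>k. C * (?e G k + ?e F k)"])
      have "(\<lambda>k. C * (?e G k + ?e F k)) \<longlonglongrightarrow> C * (0 + 0)"
        using G F by (intro tendsto_intros) (auto simp: lp_tendsto_def)
      then show "(\<lambda>k. C * (?e G k + ?e F k)) \<longlonglongrightarrow> 0" by simp
    qed (use close[OF G(1) F(1) G(2) F(2)] in auto)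
    from lp_tendsto_add[OF p this lim] show ?thesis by simp
  qed
  have "lp_extend p T f = g"
    unfolding lp_extend_def
  proof (rule the_equality)
    fix h assume "h \<in> lp_space p \<and> (\<forall>F. (\<forall>k. finsupp (F k)) \<longrightarrow> lp_tendsto p F f \<longrightarrow> lp_tendsto p (\<lambda>k. T (F k)) h)"
    then have "lp_tendsto p (\<lambda>k. T (F k)) h" using F by blast
    from lp_tendsto_unique[OF p this lim] show "h = g" .
  qed (use g_lp other in blast)
  then show ?thesis using lim by simp
qed

lemma lp_extend_finsupp:
  fixes T :: "('a \<Rightarrow> complex) \<Rightarrow> ('a \<Rightarrow> complex)"
  assumes p: "1 \<le> p" and C: "0 \<le> C"
    and diff: "\<And>f g. finsupp f \<Longrightarrow> finsupp g \<Longrightarrow> T (\<lambda>n. f n - g n) = (\<lambda>n. T f n - T g n)"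
    and mem: "\<And>f. finsupp f \<Longrightarrow> T f \<in> lp_space p"
    and bound: "\<And>f. finsupp f \<Longrightarrow> lp_norm p (T f) \<le> C * lp_norm p f"
    and f: "finsupp f"
  shows "lp_extend p T f = T f"
proof -
  have const: "lp_tendsto p (\<lambda>_::nat. g) g" for g :: "'a \<Rightarrow> complex" using p by (intro lp_tendsto_const) simp
  show ?thesis
    by (rule lp_tendsto_unique[OF p lp_extend_tendsto[OF p C diff mem bound finsupp_lp[OF f] f const] const])
qed

text \<open>\<open>bound1\<close> secures the existence of each single extension, while the norm of
  R comes from \<open>bound\<close>, the estimate for the combination on finitely supported
  functions. Linearity is read off from uniqueness of limits.\<close>

lemma lp_extend_combination_bounded:
  fixes T :: "'i::finite \<Rightarrow> ('a \<Rightarrow> complex) \<Rightarrow> ('a \<Rightarrow> complex)"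
  assumes p: "1 \<le> p" and C: "0 \<le> C"
    and add: "\<And>i f g. finsupp f \<Longrightarrow> finsupp g \<Longrightarrow> T i (\<lambda>n. f n + g n) = (\<lambda>n. T i f n + T i g n)"
    and scale: "\<And>i c f. finsupp f \<Longrightarrow> T i (\<lambda>n. c * f n) = (\<lambda>n. c * T i f n)"
    and mem: "\<And>i f. finsupp f \<Longrightarrow> T i f \<in> lp_space p"
    and bound1: "\<And>i f. finsupp f \<Longrightarrow> lp_norm p (T i f) \<le> C * lp_norm p f"
    and bound: "\<And>f. finsupp f \<Longrightarrow> lp_norm p (\<lambda>n. \<Sum>i\<in>UNIV. a i * T i f n) \<le> C * lp_norm p f"
  defines "R \<equiv> \<lambda>f n. \<Sum>i\<in>UNIV. a i * lp_extend p (T i) f n"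
  shows "lp_bounded p R" and "\<And>f. f \<in> lp_space p \<Longrightarrow> lp_norm p (R f) \<le> C * lp_norm p f"
proof -
  have p0: "0 < p" using p by simp
  have fin_scale: "finsupp (\<lambda>n. c * f n)" if "finsupp f" for f :: "'a \<Rightarrow> complex" and c
    using that unfolding finsupp_def by (rule finite_subset[rotated]) auto
  have fin_add: "finsupp (\<lambda>n. f n + g n)" if "finsupp f" "finsupp g" for f g :: "'a \<Rightarrow> complex"
    using finsupp_diff[OF that(1) fin_scale[OF that(2), of "-1"]] by simp
  have diff: "T i (\<lambda>n. f n - g n) = (\<lambda>n. T i f n - T i g n)" if "finsupp f" "finsupp g" for i f g
    using add[OF that(1) fin_scale[OF that(2), of "-1"]] scale[OF that(2), of i "-1"] by simp
  let ?R = "\<lambda>f n. \<Sum>i\<in>UNIV. a i * T i f n"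
  have lim: "lp_tendsto p (\<lambda>k. ?R (F k)) (R f)"
    if "f \<in> lp_space p" "\<And>k. finsupp (F k)" "lp_tendsto p F f" for f F
    unfolding R_def
    by (intro lp_tendsto_sum[OF p] lp_tendsto_scale[OF p0] finite lp_extend_tendsto[OF p C diff mem bound1 that])
  have memR: "?R f \<in> lp_space p" if "finsupp f" for f
  proof -
    have "(\<lambda>n. \<Sum>i\<in>I. a i * T i f n) \<in> lp_space p" if "finite I" for I
      using that
    proof (induction I)
      case empty
      show ?case using finsupp_lp[of "\<lambda>_. 0 :: complex" p] by (simp add: finsupp_def)
    next
      case (insert i I)
      then show ?case
        using lp_norm_add(1)[OF p lp_norm_scale(1)[OF p0 mem[OF \<open>finsupp f\<close>], of "a i" i] insert.IH] by simp
    qed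
    then show ?thesis by simp
  qed
  show norm: "lp_norm p (R f) \<le> C * lp_norm p f" if f: "f \<in> lp_space p" for f
  proof -
    obtain F where F: "\<And>k. finsupp (F k)" "lp_tendsto p F f" using finsupp_approx[OF p0 f] by blast
    from lp_norm_limit_le(2)[OF p C F(2) lim[OF f F] finsupp_lp[OF F(1)] memR[OF F(1)] f bound[OF F(1)]]
    show ?thesis .
  qed
  have memR': "R f \<in> lp_space p" if f: "f \<in> lp_space p" for f
  proof -
    obtain F where F: "\<And>k. finsupp (F k)" "lp_tendsto p F f" using finsupp_approx[OF p0 f] by blast
    from lp_norm_limit_le(1)[OF p C F(2) lim[OF f F] finsupp_lp[OF F(1)] memR[OF F(1)] f bound[OF F(1)]]
    show ?thesis .
  qed
  have "R (\<lambda>n. f n + g n) = (\<lambda>n. R f n + R g n)" if f: "f \<in> lp_space p" and g: "g \<in> lp_space p" for f g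
  proof -
    obtain F where F: "\<And>k. finsupp (F k)" "lp_tendsto p F f" using finsupp_approx[OF p0 f] by blast
    obtain G where G: "\<And>k. finsupp (G k)" "lp_tendsto p G g" using finsupp_approx[OF p0 g] by blast
    have "lp_tendsto p (\<lambda>k. ?R (\<lambda>n. F k n + G k n)) (R (\<lambda>n. f n + g n))"
      by (rule lim[OF lp_norm_add(1)[OF p f g] fin_add[OF F(1) G(1)] lp_tendsto_add[OF p F(2) G(2)]])
    moreover have "?R (\<lambda>n. F k n + G k n) = (\<lambda>n. ?R (F k) n + ?R (G k) n)" for k
      by (simp add: add[OF F(1) G(1)] distrib_left sum.distrib)
    moreover have "lp_tendsto p (\<lambda>k n. ?R (F k) n + ?R (G k) n) (\<lambda>n. R f n + R g n)"
      by (rule lp_tendsto_add[OF p lim[OF f F] lim[OF g G]])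
    ultimately show ?thesis using lp_tendsto_unique[OF p] by simp
  qed
  moreover have "R (\<lambda>n. c * f n) = (\<lambda>n. c * R f n)" if f: "f \<in> lp_space p" for c f
  proof -
    obtain F where F: "\<And>k. finsupp (F k)" "lp_tendsto p F f" using finsupp_approx[OF p0 f] by blast
    have "lp_tendsto p (\<lambda>k. ?R (\<lambda>n. c * F k n)) (R (\<lambda>n. c * f n))"
      by (rule lim[OF lp_norm_scale(1)[OF p0 f] fin_scale[OF F(1)] lp_tendsto_scale[OF p0 F(2)]])
    moreover have "?R (\<lambda>n. c * F k n) = (\<lambda>n. c * ?R (F k) n)" for k
      by (simp add: scale[OF F(1)] sum_distrib_left mult.left_commute)
    moreover have "lp_tendsto p (\<lambda>k n. c * ?R (F k) n) (\<lambda>n. c * R f n)"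
      by (rule lp_tendsto_scale[OF p0 lim[OF f F]])
    ultimately show ?thesis using lp_tendsto_unique[OF p] by simp
  qed
  ultimately show "lp_bounded p R"
    unfolding lp_bounded_def using memR' norm by blast
qed

section \<open>The operator norm\<close>

lemma lp_onorm_le:
  fixes T :: "('a \<Rightarrow> complex) \<Rightarrow> ('a \<Rightarrow> complex)"
  assumes "0 \<le> C" "\<And>f. f \<in> lp_space p \<Longrightarrow> lp_norm p (T f) \<le> C * lp_norm p f"
  shows "lp_onorm p T \<le> C"
  unfolding lp_onorm_def
proof (rule cSUP_least)
  have "(\<lambda>_. 0) \<in> {f \<in> lp_space p. lp_norm p f \<le> 1}"
    using finsupp_lp[of "\<lambda>_. 0" p] by (auto simp: finsupp_def lp_norm_def)
  then show "{f \<in> lp_space p. lp_norm p f \<le> 1} \<noteq> {}" by blast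
next
  fix f :: "'a \<Rightarrow> complex" assume "f \<in> {f \<in> lp_space p. lp_norm p f \<le> 1}"
  then show "lp_norm p (T f) \<le> C"
    using assms(2)[of f] mult_left_mono[OF _ assms(1), of "lp_norm p f" 1] by auto
qed

lemma lp_norm_eq_0: 
  assumes "0 < p" "f \<in> lp_space p" "lp_norm p f = 0" shows "f = (\<lambda>_. 0)"
  using cmod_le_lp_norm[OF assms(1,2)] assms(3) by (auto simp: fun_eq_iff)

text \<open>\<open>lp_bounded\<close> makes the real supremum over the unit ball bounded above; f is
  then rescaled to norm 1. If f has norm 0 there is no such scaling, and boundedness gives norm 0
  for the image directly.\<close>

lemma lp_norm_le_onorm:
  fixes T :: "('a \<Rightarrow> complex) \<Rightarrow> ('a \<Rightarrow> complex)"
  assumes p: "0 < p" and T: "lp_bounded p T" and f: "f \<in> lp_space p"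
  shows "lp_norm p (T f) \<le> lp_onorm p T * lp_norm p f"
proof (cases "lp_norm p f = 0")
  case True
  then obtain c where "lp_norm p (T f) \<le> c * 0" using T f unfolding lp_bounded_def by force
  then show ?thesis using True by simp
next
  case False
  then have pos: "0 < lp_norm p f" using lp_norm_nonneg[of p f] by linarith
  obtain C where C: "\<And>f. f \<in> lp_space p \<Longrightarrow> lp_norm p (T f) \<le> C * lp_norm p f"
    using T unfolding lp_bounded_def by blast
  let ?c = "of_real (1 / lp_norm p f) :: complex"
  have g: "(\<lambda>n. ?c * f n) \<in> {f \<in> lp_space p. lp_norm p f \<le> 1}"
    using lp_norm_scale[OF p f, of ?c] pos by (simp add: norm_divide)
  have "bdd_above ((\<lambda>f. lp_norm p (T f)) ` {f \<in> lp_space p. lp_norm p f \<le> 1})"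
  proof (rule bdd_aboveI2)
    fix f :: "'a \<Rightarrow> complex" assume f: "f \<in> {f \<in> lp_space p. lp_norm p f \<le> 1}"
    then have "lp_norm p (T f) \<le> C * lp_norm p f" using C by simp
    also have "\<dots> \<le> \<bar>C\<bar> * 1" using f by (intro mult_mono) auto
    finally show "lp_norm p (T f) \<le> \<bar>C\<bar> * 1" .
  qed
  then have "lp_norm p (T (\<lambda>n. ?c * f n)) \<le> lp_onorm p T"
    unfolding lp_onorm_def by (rule cSUP_upper[OF g])
  moreover have "T (\<lambda>n. ?c * f n) = (\<lambda>n. ?c * T f n)" "T f \<in> lp_space p"
    using T f unfolding lp_bounded_def by blast+
  ultimately show ?thesis
    using lp_norm_scale(2)[OF p, of "T f" ?c] pos by (simp add: norm_divide divide_le_eq)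
qed

section \<open>Burkholder's function\<close>

text \<open>Burkholder's extremal function for differentially subordinate martingales, in the
  variables r = |x| and s = |y| and for exponents p \<ge> 2. Its normalizing factor is kept apart as
  \<open>burkholder_const\<close>.\<close>

definition burkholder :: "real \<Rightarrow> real \<Rightarrow> real \<Rightarrow> real" where
  "burkholder p r s = (s - (p - 1) * r) * (r + s) powr (p - 1)"

lemma burkholder_scale:
  assumes "0 < k" "1 < p"
  shows "burkholder p (k * r) (k * s) = k powr p * burkholder p r s"
proof -
  have "k powr p = k * k powr (p - 1)" using assms by (simp add: powr_mult_base)
  moreover have "k * s - (p - 1) * (k * r) = k * (s - (p - 1) * r)" by (simp add: algebra_simps)
  moreover have "(k * r + k * s) powr (p - 1) = k powr (p - 1) * (r + s) powr (p - 1)"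
    by (simp only: distrib_left[symmetric] powr_mult)
  ultimately show ?thesis by (simp add: burkholder_def)
qed

text \<open>With r1, r2 and s1, s2 the derivatives of r and s, the hypotheses say that r^2 and s^2
  both have second derivative 2. The left side is the second derivative of
  \<open>burkholder p r s\<close> divided by (r + s)^(p - 3). The terms of indefinite sign are a
  multiple of the difference of the two hypotheses and cancel; for p \<ge> 2 and convex s the rest
  has a visible sign.\<close>

lemma second_derivative_identity:
  fixes p r s r1 s1 r2 s2 :: real
  assumes "r * r2 + r1\<^sup>2 = 1" "s * s2 + s1\<^sup>2 = 1"
  shows "(s2 - (p - 1) * r2) * (r + s)\<^sup>2 + 2 * (p - 1) * (s1 - (p - 1) * r1) * (r + s) * (r1 + s1)
      + (p - 1) * (s - (p - 1) * r) * ((p - 2) * (r1 + s1)\<^sup>2 + (r + s) * (r2 + s2))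
    = - p * (p - 2) * (s2 * (r + s)\<^sup>2 + r * (p - 1) * (r1 + s1)\<^sup>2)"
proof -
  have "(s2 - (p - 1) * r2) * (r + s)\<^sup>2 + 2 * (p - 1) * (s1 - (p - 1) * r1) * (r + s) * (r1 + s1)
      + (p - 1) * (s - (p - 1) * r) * ((p - 2) * (r1 + s1)\<^sup>2 + (r + s) * (r2 + s2))
    = - p * (p - 2) * (s2 * (r + s)\<^sup>2 + r * (p - 1) * (r1 + s1)\<^sup>2)
      + p * (p - 1) * (r + s) * ((s * s2 + s1\<^sup>2) - (r * r2 + r1\<^sup>2))"
    by (simp add: algebra_simps power2_eq_square)
  then show ?thesis using assms by simp
qed

text \<open>Positive \<beta> and \<delta> keep both square roots smooth and positive along the whole
  line, so the second derivative test applies.\<close>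

lemma burkholder_line_concave_pos:
  fixes a c \<beta> \<delta> :: real
  assumes p: "2 \<le> p" and pos: "0 < \<beta>" "0 < \<delta>"
  shows "concave_on UNIV (\<lambda>t. burkholder p (sqrt ((t + a)\<^sup>2 + \<beta>)) (sqrt ((t + c)\<^sup>2 + \<delta>)))"
proof -
  define r where "r t = sqrt ((t + a)\<^sup>2 + \<beta>)" for t
  define s where "s t = sqrt ((t + c)\<^sup>2 + \<delta>)" for t
  have rpos: "0 < r t" "0 < s t" for t
    using pos by (simp_all add: r_def s_def add_nonneg_pos)
  have sq: "(r t)\<^sup>2 = (t + a)\<^sup>2 + \<beta>" "(s t)\<^sup>2 = (t + c)\<^sup>2 + \<delta>" for t
    using pos by (simp_all add: r_def s_def add_nonneg_pos less_imp_le)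
  define r1 where "r1 t = (t + a) / r t" for t
  define s1 where "s1 t = (t + c) / s t" for t
  define r2 where "r2 t = \<beta> / r t ^ 3" for t
  define s2 where "s2 t = \<delta> / s t ^ 3" for t
  have r1: "(r has_real_derivative r1 t) (at t)" and s1: "(s has_real_derivative s1 t) (at t)" for t
  proof -
    have "((\<lambda>t. sqrt ((t + k)\<^sup>2 + e)) has_real_derivative (t + k) / sqrt ((t + k)\<^sup>2 + e)) (at t)"
      if "0 < e" for k e
    proof -
      have X: "0 < (t + k)\<^sup>2 + e" using that by (simp add: add_nonneg_pos)
      have "((\<lambda>t. (t + k)\<^sup>2 + e) has_real_derivative 2 * (t + k)) (at t)"
        by (auto intro!: derivative_eq_intros)
      with DERIV_real_sqrt[OF X]
      have "((\<lambda>t. sqrt ((t + k)\<^sup>2 + e)) has_real_derivative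
          inverse (sqrt ((t + k)\<^sup>2 + e)) / 2 * (2 * (t + k))) (at t)"
        by (rule DERIV_chain2)
      then show ?thesis by (rule DERIV_cong) (use X in \<open>simp add: divide_simps\<close>)
    qed
    then show "(r has_real_derivative r1 t) (at t)" "(s has_real_derivative s1 t) (at t)"
      using pos unfolding r_def[abs_def] s_def[abs_def] r1_def s1_def by blast+
  qed
  have r2: "(r1 has_real_derivative r2 t) (at t)" for t
  proof -
    have "(r1 has_real_derivative (1 * r t - (t + a) * r1 t) / (r t * r t)) (at t)"
      unfolding r1_def[abs_def] using rpos[of t] r1[of t, unfolded r1_def]
      by (intro DERIV_divide) (auto intro!: derivative_eq_intros)
    also have "(1 * r t - (t + a) * r1 t) / (r t * r t) = ((r t)\<^sup>2 - (t + a)\<^sup>2) / r t ^ 3"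
      using rpos[of t] by (simp add: r1_def field_simps power2_eq_square power3_eq_cube)
    finally show ?thesis by (simp add: sq r2_def)
  qed
  have s2: "(s1 has_real_derivative s2 t) (at t)" for t
  proof -
    have "(s1 has_real_derivative (1 * s t - (t + c) * s1 t) / (s t * s t)) (at t)"
      unfolding s1_def[abs_def] using rpos[of t] s1[of t, unfolded s1_def]
      by (intro DERIV_divide) (auto intro!: derivative_eq_intros)
    also have "(1 * s t - (t + c) * s1 t) / (s t * s t) = ((s t)\<^sup>2 - (t + c)\<^sup>2) / s t ^ 3"
      using rpos[of t] by (simp add: s1_def field_simps power2_eq_square power3_eq_cube)
    finally show ?thesis by (simp add: sq s2_def)
  qed
  have "r t * r2 t + (r1 t)\<^sup>2 = ((t + a)\<^sup>2 + \<beta>) / (r t)\<^sup>2" for t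
    using rpos[of t] by (simp add: r1_def r2_def field_simps power2_eq_square power3_eq_cube)
  then have rel1: "r t * r2 t + (r1 t)\<^sup>2 = 1" for t
    using rpos[of t] by (simp add: sq[symmetric])
  have "s t * s2 t + (s1 t)\<^sup>2 = ((t + c)\<^sup>2 + \<delta>) / (s t)\<^sup>2" for t
    using rpos[of t] by (simp add: s1_def s2_def field_simps power2_eq_square power3_eq_cube)
  then have rel2: "s t * s2 t + (s1 t)\<^sup>2 = 1" for t
    using rpos[of t] by (simp add: sq[symmetric])
  define f1 where "f1 t = (s1 t - (p - 1) * r1 t) * (r t + s t) powr (p - 1)
    + (s t - (p - 1) * r t) * ((p - 1) * (r t + s t) powr (p - 2) * (r1 t + s1 t))" for t
  define f2 where "f2 t = (s2 t - (p - 1) * r2 t) * (r t + s t) powr (p - 1)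
    + (s1 t - (p - 1) * r1 t) * ((p - 1) * (r t + s t) powr (p - 2) * (r1 t + s1 t))
    + ((s1 t - (p - 1) * r1 t) * ((p - 1) * (r t + s t) powr (p - 2) * (r1 t + s1 t))
    + (s t - (p - 1) * r t) * ((p - 1) * ((p - 2) * (r t + s t) powr (p - 3) * (r1 t + s1 t)) * (r1 t + s1 t)
      + (p - 1) * (r t + s t) powr (p - 2) * (r2 t + s2 t)))" for t
  have w: "((\<lambda>t. (r t + s t) powr k) has_real_derivative k * (r t + s t) powr (k - 1) * (r1 t + s1 t)) (at t)" for t k
    using DERIV_fun_powr[OF DERIV_add[OF r1[of t] s1[of t]], of k] rpos[of t]
    by (simp add: mult_ac add_pos_pos)
  have f1: "((\<lambda>t. burkholder p (r t) (s t)) has_real_derivative f1 t) (at t)" for t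
    unfolding burkholder_def f1_def
    using DERIV_mult[OF DERIV_diff[OF s1[of t] DERIV_cmult[OF r1[of t], of "p - 1"]] w[of "p - 1" t]]
    by (simp add: mult.commute)
  have f2: "(f1 has_real_derivative f2 t) (at t)" for t
    unfolding f1_def[abs_def] f2_def
  proof (rule DERIV_cong)
    show "((\<lambda>t. (s1 t - (p - 1) * r1 t) * (r t + s t) powr (p - 1)
        + (s t - (p - 1) * r t) * ((p - 1) * (r t + s t) powr (p - 2) * (r1 t + s1 t)))
      has_real_derivative
        ((s2 t - (p - 1) * r2 t) * (r t + s t) powr (p - 1)
          + ((p - 1) * (r t + s t) powr (p - 1 - 1) * (r1 t + s1 t)) * (s1 t - (p - 1) * r1 t))
        + ((s1 t - (p - 1) * r1 t) * ((p - 1) * (r t + s t) powr (p - 2) * (r1 t + s1 t))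
          + (((p - 1) * ((p - 2) * (r t + s t) powr (p - 2 - 1) * (r1 t + s1 t))) * (r1 t + s1 t)
            + (r2 t + s2 t) * ((p - 1) * (r t + s t) powr (p - 2))) * (s t - (p - 1) * r t))) (at t)"
      by (intro DERIV_add DERIV_mult DERIV_diff DERIV_cmult w r1 s1 r2 s2)
  qed (simp add: mult_ac)
  have "f2 t \<le> 0" for t
  proof -
    \<comment> \<open>All powers of r + s are written through the lowest one, so that
      \<open>f2\<close> becomes W times the left side of
      \<open>second_derivative_identity\<close>.\<close>
    define W where "W = (r t + s t) powr (p - 3)"
    have ws: "0 < r t + s t" using rpos[of t] by simp
    have W: "(r t + s t) powr (p - 2) = W * (r t + s t)" "(r t + s t) powr (p - 1) = W * (r t + s t)\<^sup>2"
      unfolding W_def using ws powr_mult_base[of "r t + s t" "p - 3"] powr_mult_base[of "r t + s t" "p - 2"]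
      by (simp_all add: power2_eq_square mult_ac)
    have "f2 t = W * ((s2 t - (p - 1) * r2 t) * (r t + s t)\<^sup>2
        + 2 * (p - 1) * (s1 t - (p - 1) * r1 t) * (r t + s t) * (r1 t + s1 t)
        + (p - 1) * (s t - (p - 1) * r t) * ((p - 2) * (r1 t + s1 t)\<^sup>2 + (r t + s t) * (r2 t + s2 t)))"
      unfolding f2_def W W_def[symmetric] by (simp add: algebra_simps power2_eq_square)
    also have "\<dots> = - (W * (p * (p - 2) * (s2 t * (r t + s t)\<^sup>2 + r t * (p - 1) * (r1 t + s1 t)\<^sup>2)))"
      unfolding second_derivative_identity[OF rel1 rel2] by simp
    also have "\<dots> \<le> 0"
      using p pos rpos[of t] by (auto simp: W_def s2_def intro!: mult_nonneg_nonneg add_nonneg_nonneg)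
    finally show ?thesis .
  qed
  then have "concave_on UNIV (\<lambda>t. burkholder p (r t) (s t))"
    using f1 f2 by (intro f''_le0_imp_concave) auto
  then show ?thesis by (simp add: r_def s_def)
qed

lemma tendsto_burkholder:
  assumes "1 < p" "(f \<longlongrightarrow> r) F" "(g \<longlongrightarrow> s) F" "\<forall>\<^sub>F x in F. 0 \<le> f x \<and> 0 \<le> g x"
  shows "((\<lambda>x. burkholder p (f x) (g x)) \<longlongrightarrow> burkholder p r s) F"
  unfolding burkholder_def
  using assms by (intro tendsto_intros tendsto_powr') (auto elim: eventually_mono)

text \<open>Differentiability is lost when \<beta> or \<delta> is 0, but the concavity inequality
  passes to the limit. The points 1 - w and - w with weights w and 1 - w have barycentre 0.\<close>

lemma burkholder_line_concave:
  fixes a c \<beta> \<delta> :: real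
  assumes p: "2 \<le> p" and nonneg: "0 \<le> \<beta>" "0 \<le> \<delta>" and w: "0 \<le> w" "w \<le> 1"
  defines "f \<equiv> \<lambda>t. burkholder p (sqrt ((t + a)\<^sup>2 + \<beta>)) (sqrt ((t + c)\<^sup>2 + \<delta>))"
  shows "w * f (1 - w) + (1 - w) * f (- w) \<le> f 0"
proof -
  define g where "g e t = burkholder p (sqrt ((t + a)\<^sup>2 + (\<beta> + e))) (sqrt ((t + c)\<^sup>2 + (\<delta> + e)))" for e t
  have lim: "((\<lambda>e. g e t) \<longlongrightarrow> f t) (at_right 0)" for t
    unfolding g_def f_def
  proof (rule tendsto_burkholder)
    show "((\<lambda>e. sqrt ((t + a)\<^sup>2 + (\<beta> + e))) \<longlongrightarrow> sqrt ((t + a)\<^sup>2 + \<beta>)) (at_right 0)"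
      by (auto intro!: tendsto_eq_intros)
    show "((\<lambda>e. sqrt ((t + c)\<^sup>2 + (\<delta> + e))) \<longlongrightarrow> sqrt ((t + c)\<^sup>2 + \<delta>)) (at_right 0)"
      by (auto intro!: tendsto_eq_intros)
    show "\<forall>\<^sub>F e in at_right 0. 0 \<le> sqrt ((t + a)\<^sup>2 + (\<beta> + e)) \<and> 0 \<le> sqrt ((t + c)\<^sup>2 + (\<delta> + e))"
      using nonneg by (auto intro!: eventually_mono[OF eventually_at_right_less[of "0::real"]] add_nonneg_nonneg)
  qed (use p in simp)
  have "w * g e (1 - w) + (1 - w) * g e (- w) \<le> g e 0" if "0 < e" for e
  proof -
    have "concave_on UNIV (g e)"
      unfolding g_def using that nonneg p by (intro burkholder_line_concave_pos) auto
    then have "w * g e (1 - w) + (1 - w) * g e (- w) \<le> g e (w *\<^sub>R (1 - w) + (1 - w) *\<^sub>R (- w))"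
      using w unfolding concave_on_iff by (metis UNIV_I add.commute diff_add_cancel diff_ge_0_iff_ge)
    then show ?thesis by (simp add: algebra_simps)
  qed
  then have ev: "\<forall>\<^sub>F e in at_right 0. w * g e (1 - w) + (1 - w) * g e (- w) \<le> g e 0"
    by (auto intro: eventually_mono[OF eventually_at_right_less[of "0::real"]])
  show ?thesis
    by (rule tendsto_le[OF _ lim tendsto_add[OF tendsto_mult[OF tendsto_const lim] tendsto_mult[OF tendsto_const lim]] ev]) simp
qed

text \<open>Division by d turns the line into a horizontal one at height Im (x / d).\<close>

lemma norm_line:
  fixes x d :: complex
  assumes "d \<noteq> 0"
  obtains a \<beta> where "0 \<le> \<beta>" "\<And>t::real. cmod (x + of_real t * d) = cmod d * sqrt ((t + a)\<^sup>2 + \<beta>)"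
proof
  have eq: "x + of_real t * d = d * (of_real t + x / d)" for t :: real
    using assms by (simp add: field_simps)
  show "0 \<le> (Im (x / d))\<^sup>2" by simp
  show "cmod (x + of_real t * d) = cmod d * sqrt ((t + Re (x / d))\<^sup>2 + (Im (x / d))\<^sup>2)" for t :: real
    unfolding eq norm_mult by (simp add: cmod_def)
qed

text \<open>Because |d| = |e|, homogeneity removes one common factor from both norms, leaving two
  lines traversed at unit speed; this is the equality of second derivatives on which the identity
  rests.\<close>

lemma burkholder_zigzag_concave:
  fixes x d y e :: complex
  assumes p: "2 \<le> p" and de: "cmod d = cmod e" and w: "0 \<le> w" "w \<le> 1"
  shows "w * burkholder p (cmod (x + of_real (1 - w) * d)) (cmod (y + of_real (1 - w) * e))
      + (1 - w) * burkholder p (cmod (x - of_real w * d)) (cmod (y - of_real w * e))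
    \<le> burkholder p (cmod x) (cmod y)"
proof (cases "d = 0")
  case True
  then show ?thesis using de by (simp add: algebra_simps)
next
  case False
  then have e: "e \<noteq> 0" using de by auto
  obtain a \<beta> where a: "0 \<le> \<beta>" "\<And>t::real. cmod (x + of_real t * d) = cmod d * sqrt ((t + a)\<^sup>2 + \<beta>)"
    using norm_line[OF False, of x] by metis
  obtain c \<delta> where c: "0 \<le> \<delta>" "\<And>t::real. cmod (y + of_real t * e) = cmod d * sqrt ((t + c)\<^sup>2 + \<delta>)"
    using norm_line[OF e, of y] de by metis
  define f where "f t = burkholder p (sqrt ((t + a)\<^sup>2 + \<beta>)) (sqrt ((t + c)\<^sup>2 + \<delta>))" for t
  have eq: "burkholder p (cmod (x + of_real t * d)) (cmod (y + of_real t * e)) = cmod d powr p * f t" for t :: real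
    unfolding f_def a c using False p by (intro burkholder_scale) auto
  have "cmod d powr p * (w * f (1 - w) + (1 - w) * f (- w)) \<le> cmod d powr p * f 0"
    unfolding f_def by (intro mult_left_mono burkholder_line_concave p a c w) auto
  then show ?thesis
    using eq[of "1 - w"] eq[of "- w"] eq[of 0] by (simp add: algebra_simps)
qed

section \<open>Burkholder's function as a majorant\<close>

lemma powr_ge_tangent_at_1:
  fixes a x :: real
  assumes "1 \<le> a" "0 \<le> x"
  shows "1 + a * (x - 1) \<le> x powr a"
proof (cases "x = 0")
  case False
  have "x = (x powr a) powr (1 / a) * 1 powr (1 - 1 / a)" using assms by (simp add: powr_powr)
  also have "\<dots> \<le> 1 / a * x powr a + (1 - 1 / a) * 1"
    using assms False by (intro Youngs_inequality_0) auto
  finally have "a * x \<le> a * (1 / a * x powr a + (1 - 1 / a) * 1)"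
    using assms by (intro mult_left_mono) auto
  also have "\<dots> = x powr a + (a - 1)" using assms by (simp add: distrib_left right_diff_distrib)
  finally show ?thesis by (simp add: algebra_simps)
qed (use assms in simp)

text \<open>This is the extreme case r = 0 of the majorization. It follows from the weighted
  inequality of arithmetic and geometric means for 1 + x and 1: with weights (x - 1)/x and 1/x the
  arithmetic mean is exactly x.\<close>

lemma powr_quotient_le:
  fixes p :: real
  assumes p: "2 \<le> p"
  shows "(p / (p - 1)) powr (p - 1) \<le> p"
proof -
  define x where "x = p - 1"
  have x: "1 \<le> x" "p = 1 + x" using p by (auto simp: x_def)
  have "(1 + x) powr ((x - 1) / x) = (1 + x) powr ((x - 1) / x) * 1 powr (1 / x)" by simp
  also have "\<dots> \<le> (x - 1) / x * (1 + x) + 1 / x * 1"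
    using x(1) by (intro Youngs_inequality_0) (auto simp: field_simps)
  also have "\<dots> = x" using x(1) by (simp add: field_simps)
  finally have "((1 + x) powr ((x - 1) / x)) powr x \<le> x powr x"
    using x(1) by (intro powr_mono2) auto
  then have *: "(1 + x) powr (x - 1) \<le> x powr x" using x(1) by (simp add: powr_powr)
  have "((1 + x) / x) powr x = (1 + x) * (1 + x) powr (x - 1) / x powr x"
    using x(1) by (simp add: powr_divide powr_mult_base)
  also have "\<dots> \<le> 1 + x" using mult_left_mono[OF *, of "1 + x"] x(1) by (simp add: divide_le_eq)
  finally show ?thesis by (simp add: x(2))
qed

text \<open>The right side is the tangent at 0 of the left side; let G be their difference. Left of
  0, tangent bounds for both powers give G' \<le> 0. Right of 0, G' is concave with G' 0 = 0, so it
  can change sign only from plus to minus, and G is at least the smaller of its values at 0 and at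
  the right endpoint.\<close>

lemma burkholder_one_variable:
  fixes p z :: real
  assumes p: "2 \<le> p" and z: "-1 \<le> z" "z \<le> 1 / (p - 1)"
  shows "(1 + z) powr p - (1 - (p - 1) * z) powr p \<le> p\<^sup>2 * z"
proof -
  define G where "G z = p\<^sup>2 * z - (1 + z) powr p + (1 - (p - 1) * z) powr p" for z
  define G' where "G' z = p * (p - (1 + z) powr (p - 1) - (p - 1) * (1 - (p - 1) * z) powr (p - 1))" for z
  let ?m = "1 / (p - 1)"
  have nonneg: "0 \<le> 1 + z" "0 \<le> 1 - (p - 1) * z" if "z \<in> {-1..?m}" for z
    using that p by (auto simp: field_simps)
  have pos: "0 < 1 + z" "0 < 1 - (p - 1) * z" if "z \<in> {-1<..<?m}" for z
    using that p by (auto simp: field_simps)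
  have deriv: "(G has_real_derivative G' z) (at z)" if "z \<in> {-1<..<?m}" for z
  proof -
    have 1: "((\<lambda>z. (1 + z) powr p) has_real_derivative p * (1 + z) powr (p - 1) * 1) (at z)"
      using DERIV_fun_powr[of "\<lambda>z. 1 + z" 1 z p] pos[OF that] by (auto intro!: derivative_eq_intros)
    have 2: "((\<lambda>z. (1 - (p - 1) * z) powr p) has_real_derivative p * (1 - (p - 1) * z) powr (p - 1) * (- (p - 1))) (at z)"
      using DERIV_fun_powr[of "\<lambda>z. 1 - (p - 1) * z" "- (p - 1)" z p] pos[OF that] by (auto intro!: derivative_eq_intros)
    have "(G has_real_derivative p\<^sup>2 * 1 - p * (1 + z) powr (p - 1) * 1 + p * (1 - (p - 1) * z) powr (p - 1) * (- (p - 1))) (at z)"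
      unfolding G_def[abs_def] by (intro DERIV_add DERIV_diff 1 2 DERIV_cmult DERIV_ident)
    then show ?thesis by (rule DERIV_cong) (simp add: G'_def algebra_simps power2_eq_square)
  qed
  have cont: "continuous_on {-1..?m} G"
    unfolding G_def[abs_def] using p nonneg
    by (intro continuous_intros continuous_on_powr') auto
  have G0: "G 0 = 0" by (simp add: G_def)
  have G'0: "G' 0 = 0" by (simp add: G'_def)
  have mvt: "\<exists>t. a < t \<and> t < b \<and> G b - G a = (b - a) * G' t" if "a < b" and sub: "{a..b} \<subseteq> {-1..?m}" for a b
  proof -
    have "continuous_on {a..b} G" using cont sub continuous_on_subset by blast
    moreover have "G differentiable (at t)" if "a < t" "t < b" for t
      using deriv[of t] that sub \<open>a < b\<close> by (force simp: real_differentiable_def)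
    ultimately obtain l t where t: "a < t" "t < b" "DERIV G t :> l" "G b - G a = (b - a) * l"
      using MVT[OF \<open>a < b\<close>] by blast
    moreover have "t \<in> {-1<..<?m}" using t sub \<open>a < b\<close> by force
    ultimately show ?thesis using DERIV_unique[OF t(3) deriv[of t]] by blast
  qed
  have mono: "G a \<le> G b" if ab: "a < b" "{a..b} \<subseteq> {-1..?m}" and G': "\<And>t. a < t \<Longrightarrow> t < b \<Longrightarrow> 0 \<le> G' t" for a b
  proof -
    obtain t where t: "a < t" "t < b" "G b - G a = (b - a) * G' t" using mvt ab by blast
    have "0 \<le> (b - a) * G' t" using ab(1) G'[OF t(1,2)] by (intro mult_nonneg_nonneg) auto
    then show ?thesis using t(3) by linarith
  qed
  have anti: "G b \<le> G a" if ab: "a < b" "{a..b} \<subseteq> {-1..?m}" and G': "\<And>t. a < t \<Longrightarrow> t < b \<Longrightarrow> G' t \<le> 0" for a b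
  proof -
    obtain t where t: "a < t" "t < b" "G b - G a = (b - a) * G' t" using mvt ab by blast
    have "(b - a) * G' t \<le> 0" using ab(1) G'[OF t(1,2)] by (intro mult_nonneg_nonpos) auto
    then show ?thesis using t(3) by linarith
  qed
  \<comment> \<open>Concavity of G' is used in star-shaped form, along segments from 0, where G'
    vanishes.\<close>
  have concave: "t * G' b \<le> G' (t * b)" if "0 \<le> t" "t \<le> 1" "b \<in> {-1..?m}" for t b
  proof -
    have "(1 + t * b) powr (p - 1) \<le> (1 - t) * 1 powr (p - 1) + t * (1 + b) powr (p - 1)"
      using powr_convex_combination[of "p - 1" 1 "1 + b" t] p that nonneg[OF that(3)] by (simp add: algebra_simps)
    moreover have "(p - 1) * (1 - (p - 1) * (t * b)) powr (p - 1)
        \<le> (p - 1) * ((1 - t) * 1 powr (p - 1) + t * (1 - (p - 1) * b) powr (p - 1))"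
      using powr_convex_combination[of "p - 1" 1 "1 - (p - 1) * b" t] p that nonneg[OF that(3)]
      by (intro mult_left_mono) (simp_all add: algebra_simps)
    ultimately have "t * (p - (1 + b) powr (p - 1) - (p - 1) * (1 - (p - 1) * b) powr (p - 1))
        \<le> p - (1 + t * b) powr (p - 1) - (p - 1) * (1 - (p - 1) * (t * b)) powr (p - 1)"
      by (simp add: algebra_simps)
    from mult_left_mono[OF this, of p] show ?thesis using p unfolding G'_def by (simp add: mult.left_commute)
  qed
  have "0 \<le> G z"
  proof (cases "z \<le> 0")
    case True
    have "G' t \<le> 0" if "-1 \<le> t" "t \<le> 0" for t
    proof -
      have "1 + (p - 1) * t \<le> (1 + t) powr (p - 1)"
        using powr_ge_tangent_at_1[of "p - 1" "1 + t"] that p by simp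
      moreover have "(p - 1) * (1 + (p - 1) * (- (p - 1) * t)) \<le> (p - 1) * (1 - (p - 1) * t) powr (p - 1)"
        using powr_ge_tangent_at_1[of "p - 1" "1 - (p - 1) * t"] that p mult_nonneg_nonpos[of "p - 1" t]
        by (intro mult_left_mono) (auto simp: algebra_simps)
      moreover have "p \<le> (1 + (p - 1) * t) + (p - 1) * (1 + (p - 1) * (- (p - 1) * t))"
      proof -
        have "1 * 1 \<le> (p - 1) * (p - 1)" using p by (intro mult_mono) auto
        then have "0 \<le> (p - 1) * ((p - 1) * (p - 1) - 1) * (- t)"
          using p that by (intro mult_nonneg_nonneg) auto
        then show ?thesis by (simp add: algebra_simps)
      qed
      ultimately have "p - (1 + t) powr (p - 1) - (p - 1) * (1 - (p - 1) * t) powr (p - 1) \<le> 0" by linarith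
      then show ?thesis using p unfolding G'_def by (intro mult_nonneg_nonpos) auto
    qed
    moreover have "{z..0} \<subseteq> {-1..?m}" using z p by (auto intro: order_trans[of _ 0])
    ultimately show ?thesis using True z anti[of z 0] by (cases "z = 0") (auto simp: G0)
  next
    case False
    then have zpos: "0 < z" by simp
    show ?thesis
    proof (cases "0 \<le> G' z")
      case True
      have "0 \<le> G' t" if "0 < t" "t < z" for t
      proof -
        have "0 \<le> t / z * G' z" using True that by simp
        also have "\<dots> \<le> G' (t / z * z)" using that z by (intro concave) auto
        finally show ?thesis using zpos by simp
      qed
      then have "G 0 \<le> G z" using zpos z by (intro mono) auto
      then show ?thesis by (simp add: G0)
    next
      case False
      have "G' t \<le> 0" if "z < t" "t < ?m" for t
      proof (rule ccontr)
        assume "\<not> G' t \<le> 0"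
        then have "0 \<le> z / t * G' t" using that zpos by simp
        also have "\<dots> \<le> G' (z / t * t)" using that z zpos by (intro concave) auto
        finally show False using False that zpos by simp
      qed
      then have "G ?m \<le> G z" using z zpos anti[of z ?m] by (cases "z = ?m") auto
      moreover have "0 \<le> G ?m"
      proof -
        have "(1 + ?m) = p / (p - 1)" using p by (simp add: field_simps)
        moreover have "(p / (p - 1)) powr p = p / (p - 1) * (p / (p - 1)) powr (p - 1)"
          using p powr_mult_base[of "p / (p - 1)" "p - 1"] by simp
        moreover have "\<dots> \<le> p / (p - 1) * p" using powr_quotient_le[OF p] p by (intro mult_left_mono) auto
        ultimately show ?thesis using p by (simp add: G_def power2_eq_square)
      qed
      ultimately show ?thesis by simp
    qed
  qed
  then show ?thesis by (simp add: G_def)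
qed

text \<open>The factor for which the two sides of the majorization touch to first order along the
  ray s = (p - 1) r, where both vanish.\<close>

definition burkholder_const :: "real \<Rightarrow> real" where
  "burkholder_const p = p * ((p - 1) / p) powr (p - 1)"

text \<open>On the segment r + s = w, the number k is the common value of s and (p - 1) r at the
  contact point, and z is the relative deviation of s from k. Dividing by k^p leaves the
  one-variable inequality; r \<ge> 0 and s \<ge> 0 become z \<le> 1/(p - 1) and z \<ge> -1.\<close>

lemma burkholder_majorizes:
  assumes p: "2 \<le> p" and rs: "0 \<le> r" "0 \<le> s"
  shows "s powr p - (p - 1) powr p * r powr p \<le> burkholder_const p * burkholder p r s"
proof (cases "r + s = 0")
  case True
  then have "r = 0" "s = 0" using rs by auto
  then show ?thesis using p by (simp add: burkholder_def)
next
  case False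
  define w where "w = r + s"
  define z where "z = p * s / ((p - 1) * w) - 1"
  have w: "0 < w" using False rs by (simp add: w_def)
  define k where "k = (p - 1) * w / p"
  have k: "0 < k" using w p by (simp add: k_def)
  have s: "s = k * (1 + z)" using w p by (simp add: k_def z_def)
  have r: "(p - 1) * r = k * (1 - (p - 1) * z)"
  proof -
    have "k * (1 - (p - 1) * z) = k - (p - 1) * (s - k)" unfolding s by (simp add: algebra_simps)
    also have "\<dots> = p * k - (p - 1) * s" by (simp add: algebra_simps)
    also have "p * k = (p - 1) * w" using p by (simp add: k_def)
    finally show ?thesis by (simp add: w_def algebra_simps)
  qed
  have "0 \<le> 1 + z" "0 \<le> 1 - (p - 1) * z"
    using s r k rs p zero_le_mult_iff[of k "1 + z"] zero_le_mult_iff[of k "1 - (p - 1) * z"]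
      mult_nonneg_nonneg[of "p - 1" r] by auto
  then have "(1 + z) powr p - (1 - (p - 1) * z) powr p \<le> p\<^sup>2 * z"
    using p by (intro burkholder_one_variable) (auto simp: field_simps)
  then have "k powr p * ((1 + z) powr p - (1 - (p - 1) * z) powr p) \<le> k powr p * (p\<^sup>2 * z)"
    by (intro mult_left_mono) auto
  moreover have "s powr p = k powr p * (1 + z) powr p" "((p - 1) * r) powr p = k powr p * (1 - (p - 1) * z) powr p"
    unfolding r by (simp_all only: s powr_mult)
  ultimately have "s powr p - ((p - 1) * r) powr p \<le> k powr p * (p\<^sup>2 * z)"
    by (simp only: right_diff_distrib)
  also have "\<dots> = burkholder_const p * burkholder p r s"
  proof -
    have e: "s - (p - 1) * r = p * k * z" unfolding r by (simp add: s algebra_simps)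
    have "k powr p = k * k powr (p - 1)" using k by (simp add: powr_mult_base)
    moreover have "k powr (p - 1) = ((p - 1) / p) powr (p - 1) * w powr (p - 1)"
      unfolding k_def by (simp add: powr_mult[symmetric])
    ultimately show ?thesis
      unfolding burkholder_def e w_def[symmetric] burkholder_const_def by (simp add: power2_eq_square mult_ac)
  qed
  finally show ?thesis by (simp add: powr_mult)
qed

text \<open>The Legendre transform of Burkholder's function in its second variable. Concavity of the latter
  along all directions \<open>(d, \<theta>d)\<close> with \<open>\<bar>\<theta>\<bar> = 1\<close> becomes concavity with the gain \<open>\<bar>d\<bar>\<bar>e\<bar>\<close> in the
  direction \<open>(d, e)\<close>, by choosing \<open>\<theta>\<close> with \<open>\<theta>de = \<bar>d\<bar>\<bar>e\<bar>\<close>.\<close>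

definition bellman :: "real \<Rightarrow> complex \<Rightarrow> complex \<Rightarrow> real" where
  "bellman p x y = (INF z. burkholder_const p * burkholder p (cmod x) (cmod z) / p - Re (z * y))"

text \<open>The majorization supplies |z|^p/p, and Young's inequality spends it on Re (z * y). This
  makes the infimum in \<open>bellman\<close> finite and bounds the starting value of the
  walk.\<close>

lemma bellman_term_ge:
  assumes p: "2 \<le> p"
  shows "- ((p - 1) powr p * cmod x powr p / p + cmod y powr (p / (p - 1)) / (p / (p - 1)))
    \<le> burkholder_const p * burkholder p (cmod x) (cmod z) / p - Re (z * y)"
proof -
  have "Re (z * y) \<le> cmod z * cmod y" using complex_Re_le_cmod[of "z * y"] by (simp add: norm_mult)
  also have "\<dots> \<le> cmod z powr p / p + cmod y powr (p / (p - 1)) / (p / (p - 1))"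
    using p by (intro Youngs_inequality) (auto simp: field_simps)
  finally have "Re (z * y) \<le> cmod z powr p / p + cmod y powr (p / (p - 1)) / (p / (p - 1))" .
  moreover have "(cmod z powr p - (p - 1) powr p * cmod x powr p) / p \<le> burkholder_const p * burkholder p (cmod x) (cmod z) / p"
    using p by (intro divide_right_mono burkholder_majorizes) auto
  ultimately show ?thesis by (simp add: diff_divide_distrib)
qed

lemma bdd_below_bellman:
  assumes "2 \<le> p"
  shows "bdd_below (range (\<lambda>z. burkholder_const p * burkholder p (cmod x) (cmod z) / p - Re (z * y)))"
  using bellman_term_ge[OF assms] by (intro bdd_belowI2)

lemma bellman_le:
  assumes "2 \<le> p"
  shows "bellman p x y \<le> burkholder_const p * burkholder p (cmod x) (cmod z) / p - Re (z * y)"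
  unfolding bellman_def by (intro cINF_lower bdd_below_bellman assms) simp

lemma bellman_ge:
  assumes "2 \<le> p"
  shows "- ((p - 1) powr p * cmod x powr p / p + cmod y powr (p / (p - 1)) / (p / (p - 1))) \<le> bellman p x y"
  unfolding bellman_def by (intro cINF_greatest bellman_term_ge assms) simp

lemma bellman_nonpos:
  assumes p: "2 \<le> p"
  shows "bellman p x y \<le> 0"
proof -
  have "bellman p x y \<le> burkholder_const p * burkholder p (cmod x) (cmod 0) / p - Re (0 * y)"
    by (rule bellman_le[OF p])
  also have "\<dots> \<le> 0"
    using p by (auto simp: burkholder_def burkholder_const_def mult_nonneg_nonpos divide_nonpos_pos intro!: divide_nonpos_pos mult_nonneg_nonpos mult_nonpos_nonneg)
  finally show ?thesis .
qed

lemma bellman_0 [simp]: "2 \<le> p \<Longrightarrow> bellman p 0 0 = 0"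
  using bellman_nonpos[of p 0 0] bellman_ge[of p 0 0] by simp

text \<open>For each competitor z at the centre, z + (1 - w)\<theta> and z - w\<theta> compete at
  the two outer points. Zigzag concavity in (x, z) handles the Burkholder terms. The products z * y
  average to their central value plus w(1 - w)\<theta>e, a covariance, which is the gain.\<close>

lemma bellman_split:
  fixes x d y e :: complex
  assumes p: "2 \<le> p" and w: "0 \<le> w" "w \<le> 1"
  shows "w * bellman p (x + of_real (1 - w) * d) (y + of_real (1 - w) * e)
      + (1 - w) * bellman p (x - of_real w * d) (y - of_real w * e)
      + w * (1 - w) * (cmod d * cmod e) \<le> bellman p x y"
  unfolding bellman_def[of p x y]
proof (rule cINF_greatest)
  fix z :: complex
  obtain \<theta> where \<theta>: "cmod \<theta> = cmod d" "\<theta> * e = of_real (cmod d * cmod e)"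
  proof (cases "e = 0")
    case True
    then show ?thesis using that[of d] by simp
  next
    case False
    show ?thesis
      by (rule that[of "of_real (cmod d) * cnj e / of_real (cmod e)"])
         (use False complex_norm_square[of e] in \<open>auto simp: norm_mult norm_divide field_simps power2_eq_square\<close>)
  qed
  define U where "U x z = burkholder_const p / p * burkholder p (cmod x) (cmod z)" for x z
  have U_eq: "burkholder_const p * burkholder p (cmod x) (cmod z) / p = U x z" for x z
    by (simp add: U_def)
  have c: "0 \<le> burkholder_const p / p" using p by (simp add: burkholder_const_def)
  have conc: "w * U (x + of_real (1 - w) * d) (z + of_real (1 - w) * \<theta>) + (1 - w) * U (x - of_real w * d) (z - of_real w * \<theta>) \<le> U x z"
    using mult_left_mono[OF burkholder_zigzag_concave[OF p \<theta>(1)[symmetric] w, of x z] c]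
    unfolding U_def distrib_left by (simp only: mult.left_commute)
  have "w * Re ((z + of_real (1 - w) * \<theta>) * (y + of_real (1 - w) * e)) + (1 - w) * Re ((z - of_real w * \<theta>) * (y - of_real w * e))
      = Re (of_real w * ((z + of_real (1 - w) * \<theta>) * (y + of_real (1 - w) * e)) + of_real (1 - w) * ((z - of_real w * \<theta>) * (y - of_real w * e)))"
    by simp
  also have "of_real w * ((z + of_real (1 - w) * \<theta>) * (y + of_real (1 - w) * e)) + of_real (1 - w) * ((z - of_real w * \<theta>) * (y - of_real w * e))
      = z * y + of_real (w * (1 - w)) * (\<theta> * e)"
    by (simp add: algebra_simps)
  also have "Re \<dots> = Re (z * y) + w * (1 - w) * (cmod d * cmod e)"
    unfolding \<theta>(2) by simp
  finally have re: "w * Re ((z + of_real (1 - w) * \<theta>) * (y + of_real (1 - w) * e))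
      + (1 - w) * Re ((z - of_real w * \<theta>) * (y - of_real w * e)) = Re (z * y) + w * (1 - w) * (cmod d * cmod e)" .
  have "w * bellman p (x + of_real (1 - w) * d) (y + of_real (1 - w) * e)
      \<le> w * (U (x + of_real (1 - w) * d) (z + of_real (1 - w) * \<theta>) - Re ((z + of_real (1 - w) * \<theta>) * (y + of_real (1 - w) * e)))"
    unfolding U_eq[symmetric] using w by (intro mult_left_mono bellman_le p) auto
  moreover have "(1 - w) * bellman p (x - of_real w * d) (y - of_real w * e)
      \<le> (1 - w) * (U (x - of_real w * d) (z - of_real w * \<theta>) - Re ((z - of_real w * \<theta>) * (y - of_real w * e)))"
    unfolding U_eq[symmetric] using w by (intro mult_left_mono bellman_le p) auto
  ultimately show "w * bellman p (x + of_real (1 - w) * d) (y + of_real (1 - w) * e)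
      + (1 - w) * bellman p (x - of_real w * d) (y - of_real w * e)
      + w * (1 - w) * (cmod d * cmod e) \<le> burkholder_const p * burkholder p (cmod x) (cmod z) / p - Re (z * y)"
    using conc re unfolding U_eq right_diff_distrib by linarith
qed simp

section \<open>The lazy random walk\<close>

lemma finsupp_subset:
  assumes "finsupp f" "\<And>n. g n \<noteq> 0 \<Longrightarrow> f n \<noteq> 0" shows "finsupp g"
  using assms unfolding finsupp_def by (metis (mono_tags, lifting) Collect_mono finite_subset)

lemma finsupp_subset2:
  assumes "finsupp f" "finsupp g" "\<And>n. h n \<noteq> 0 \<Longrightarrow> f n \<noteq> 0 \<or> g n \<noteq> 0" shows "finsupp h"
  using assms(1,2) unfolding finsupp_def
  by (rule finite_subset[rotated, OF finite_UnI]) (use assms(3) in auto)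

lemma finsupp_cmult: "finsupp f \<Longrightarrow> finsupp (\<lambda>n. c * f n :: complex)"
  by (erule finsupp_subset) auto

lemma finsupp_add: "finsupp f \<Longrightarrow> finsupp g \<Longrightarrow> finsupp (\<lambda>n. f n + g n :: complex)"
  by (erule finsupp_subset2) auto

lemma finsupp_zero [simp]: "finsupp (\<lambda>_. 0)"
  by (simp add: finsupp_def)

lemma finsupp_sum:
  assumes "\<And>i. i \<in> I \<Longrightarrow> finsupp (f i)"
  shows "finsupp (\<lambda>n. \<Sum>i\<in>I. f i n :: complex)"
  using assms
  by (induction I rule: infinite_finite_induct) (auto intro!: finsupp_add)

lemma finsupp_summable:
  fixes h :: "'a \<Rightarrow> 'b::{comm_monoid_add,topological_space}"
  assumes "finsupp h" shows "h summable_on UNIV"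
  by (rule finite_nonzero_values_imp_summable_on) (use assms in \<open>simp add: finsupp_def\<close>)

lemma infsum_shift:
  fixes h :: "'a::ab_group_add \<Rightarrow> 'b::{comm_monoid_add,t2_space}"
  shows "(\<Sum>\<^sub>\<infinity>n. h (n + v)) = (\<Sum>\<^sub>\<infinity>n. h n)"
  by (rule infsum_reindex_bij_betw) (rule bij_betw_byWitness[of _ "\<lambda>n. n - v"], auto)

lemma summable_on_divide_const:
  fixes h :: "'a \<Rightarrow> real"
  assumes "h summable_on A" shows "(\<lambda>n. h n / c) summable_on A"
  using summable_on_cmult_left[OF assms, of "1 / c"] by simp

lemma infsum_divide_const:
  fixes h :: "'a \<Rightarrow> real"
  shows "(\<Sum>\<^sub>\<infinity>n\<in>A. h n / c) = infsum h A / c"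
  using infsum_cmult_left'[of h "1 / c" A] by simp

lemma summable_on_finite_sum:
  fixes h :: "'j \<Rightarrow> 'a \<Rightarrow> 'b::real_normed_vector"
  assumes "\<And>j. j \<in> J \<Longrightarrow> h j summable_on A"
  shows "(\<lambda>n. \<Sum>j\<in>J. h j n) summable_on A"
  using assms by (induction J rule: infinite_finite_induct) (auto intro: summable_on_add)

lemma infsum_finite_sum:
  fixes h :: "'j \<Rightarrow> 'a \<Rightarrow> 'b::real_normed_vector"
  assumes "\<And>j. j \<in> J \<Longrightarrow> h j summable_on A"
  shows "(\<Sum>\<^sub>\<infinity>n\<in>A. \<Sum>j\<in>J. h j n) = (\<Sum>j\<in>J. infsum (h j) A)"
  using assms
  by (induction J rule: infinite_finite_induct) (simp_all add: infsum_add summable_on_finite_sum)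

text \<open>Dropping the gain from \<open>bellman_split\<close> leaves joint concavity, enough for
  averaging over the neighbours.\<close>

lemma convex_on_bellman:
  assumes p: "2 \<le> p"
  shows "convex_on UNIV (\<lambda>(x, y). - bellman p x y)"
proof (rule convex_onI)
  fix t :: real and a b :: "complex \<times> complex"
  assume t: "0 < t" "t < 1"
  obtain x1 y1 x2 y2 where ab: "a = (x1, y1)" "b = (x2, y2)" by (cases a, cases b)
  let ?x = "of_real (1 - t) * x1 + of_real t * x2" and ?y = "of_real (1 - t) * y1 + of_real t * y2"
  have "t * bellman p (?x + of_real (1 - t) * (x2 - x1)) (?y + of_real (1 - t) * (y2 - y1))
      + (1 - t) * bellman p (?x - of_real t * (x2 - x1)) (?y - of_real t * (y2 - y1))
      + t * (1 - t) * (cmod (x2 - x1) * cmod (y2 - y1)) \<le> bellman p ?x ?y"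
    using t by (intro bellman_split p) auto
  moreover have "?x + of_real (1 - t) * (x2 - x1) = x2" "?y + of_real (1 - t) * (y2 - y1) = y2"
     "?x - of_real t * (x2 - x1) = x1" "?y - of_real t * (y2 - y1) = y1"
    by (simp_all add: algebra_simps)
  moreover have "0 \<le> t * (1 - t) * (cmod (x2 - x1) * cmod (y2 - y1))" using t by simp
  ultimately show "(\<lambda>(x, y). - bellman p x y) ((1 - t) *\<^sub>R a + t *\<^sub>R b)
      \<le> (1 - t) * (\<lambda>(x, y). - bellman p x y) a + t * (\<lambda>(x, y). - bellman p x y) b"
    by (simp add: ab scaleR_conv_of_real)
qed simp

text \<open>Kept as a mean of two-point averages, one for each neighbour, so that Jensen's
  inequality and the split with gain apply one after the other.\<close>

definition lazy_average :: "('j::finite \<Rightarrow> 'a::ab_group_add) \<Rightarrow> real \<Rightarrow> ('a \<Rightarrow> complex) \<Rightarrow> 'a \<Rightarrow> complex" where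
  "lazy_average v \<epsilon> f n = (\<Sum>j\<in>UNIV. of_real (1 - \<epsilon>) * f n + of_real \<epsilon> * f (n + v j)) / of_nat CARD('j)"

definition jump_energy :: "('j::finite \<Rightarrow> 'a::ab_group_add) \<Rightarrow> ('a \<Rightarrow> complex) \<Rightarrow> ('a \<Rightarrow> complex) \<Rightarrow> real" where
  "jump_energy v f g = (\<Sum>j\<in>UNIV. \<Sum>\<^sub>\<infinity>n. cmod (f (n + v j) - f n) * cmod (g (n + v j) - g n))"

lemma finsupp_lazy_average:
  fixes v :: "'j::finite \<Rightarrow> 'a::ab_group_add"
  assumes "finsupp f" shows "finsupp (lazy_average v \<epsilon> f)"
proof -
  have "finsupp (\<lambda>n. (1 / of_nat CARD('j)) * (\<Sum>j\<in>(UNIV::'j set). of_real (1 - \<epsilon>) * f n + of_real \<epsilon> * f (n + v j)))"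
    by (intro finsupp_cmult finsupp_sum finsupp_add finsupp_shift assms)
  then show ?thesis by (simp add: lazy_average_def[abs_def])
qed

lemma finsupp_jump:
  fixes f g :: "'a::ab_group_add \<Rightarrow> complex"
  assumes "finsupp f"
  shows "finsupp (\<lambda>n. cmod (f (n + v) - f n) * cmod (g (n + v) - g n))"
  by (rule finsupp_subset2[OF assms finsupp_shift[OF assms, of v]]) auto

lemma finsupp_bellman:
  assumes "2 \<le> p" "finsupp f" "finsupp g"
  shows "finsupp (\<lambda>n. bellman p (f n) (g n))"
  by (rule finsupp_subset2[OF assms(2,3)]) (use assms(1) in auto)

lemma bellman_lazy_average_pointwise:
  fixes v :: "'j::finite \<Rightarrow> 'a::ab_group_add"
  assumes p: "2 \<le> p" and e: "0 \<le> \<epsilon>" "\<epsilon> \<le> 1"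
  shows "(\<Sum>j\<in>UNIV. \<epsilon> * bellman p (f (n + v j)) (g (n + v j)) + (1 - \<epsilon>) * bellman p (f n) (g n)
      + \<epsilon> * (1 - \<epsilon>) * (cmod (f (n + v j) - f n) * cmod (g (n + v j) - g n))) / CARD('j)
    \<le> bellman p (lazy_average v \<epsilon> f n) (lazy_average v \<epsilon> g n)"
proof -
  define c where "c h j = of_real (1 - \<epsilon>) * h n + of_real \<epsilon> * h (n + v j)" for h :: "'a \<Rightarrow> complex" and j
  have split: "\<epsilon> * bellman p (f (n + v j)) (g (n + v j)) + (1 - \<epsilon>) * bellman p (f n) (g n)
      + \<epsilon> * (1 - \<epsilon>) * (cmod (f (n + v j) - f n) * cmod (g (n + v j) - g n)) \<le> bellman p (c f j) (c g j)" for j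
  proof -
    have "c h j + of_real (1 - \<epsilon>) * (h (n + v j) - h n) = h (n + v j)" "c h j - of_real \<epsilon> * (h (n + v j) - h n) = h n" for h
      by (simp_all add: c_def algebra_simps)
    then show ?thesis
      using bellman_split[OF p e, of "c f j" "f (n + v j) - f n" "c g j" "g (n + v j) - g n"] by simp
  qed
  let ?N = "real CARD('j)"
  have "(\<lambda>(x, y). - bellman p x y) (\<Sum>j\<in>UNIV. (1 / ?N) *\<^sub>R (c f j, c g j))
      \<le> (\<Sum>j\<in>UNIV. 1 / ?N * (\<lambda>(x, y). - bellman p x y) (c f j, c g j))"
    by (rule convex_on_sum[OF _ _ convex_on_bellman[OF p]]) auto
  moreover have "(\<Sum>j\<in>UNIV. (1 / ?N) *\<^sub>R (c f j, c g j)) = (lazy_average v \<epsilon> f n, lazy_average v \<epsilon> g n)"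
    by (simp add: lazy_average_def c_def prod_eq_iff fst_sum snd_sum scaleR_conv_of_real sum_divide_distrib)
  ultimately have "(\<Sum>j\<in>UNIV. bellman p (c f j) (c g j)) / ?N \<le> bellman p (lazy_average v \<epsilon> f n) (lazy_average v \<epsilon> g n)"
    by (simp add: sum_negf sum_divide_distrib)
  moreover have "(\<Sum>j\<in>UNIV. \<epsilon> * bellman p (f (n + v j)) (g (n + v j)) + (1 - \<epsilon>) * bellman p (f n) (g n)
      + \<epsilon> * (1 - \<epsilon>) * (cmod (f (n + v j) - f n) * cmod (g (n + v j) - g n))) / ?N
      \<le> (\<Sum>j\<in>UNIV. bellman p (c f j) (c g j)) / ?N"
    by (intro divide_right_mono sum_mono split) auto
  ultimately show ?thesis by linarith
qed

text \<open>Summation over the group is invariant under translation, so the shifted and unshifted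
  terms, with weights \<epsilon> and 1 - \<epsilon>, recombine to the initial sum and only the gain
  is left over.\<close>

lemma bellman_lazy_average:
  fixes v :: "'j::finite \<Rightarrow> 'a::ab_group_add"
  assumes p: "2 \<le> p" and e: "0 \<le> \<epsilon>" "\<epsilon> \<le> 1" and fg: "finsupp f" "finsupp g"
  shows "(\<Sum>\<^sub>\<infinity>n. bellman p (f n) (g n)) + \<epsilon> * (1 - \<epsilon>) / CARD('j) * jump_energy v f g
    \<le> (\<Sum>\<^sub>\<infinity>n. bellman p (lazy_average v \<epsilon> f n) (lazy_average v \<epsilon> g n))"
proof -
  let ?b = "\<lambda>n. bellman p (f n) (g n)" and ?N = "real CARD('j)"
  let ?J = "\<lambda>j n. cmod (f (n + v j) - f n) * cmod (g (n + v j) - g n)"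
  have sb: "?b summable_on UNIV" "(\<lambda>n. ?b (n + u)) summable_on UNIV" for u
    using finsupp_summable[OF finsupp_bellman[OF p fg]]
      finsupp_summable[OF finsupp_bellman[OF p finsupp_shift[OF fg(1)] finsupp_shift[OF fg(2)]]] by blast+
  have sJ: "?J j summable_on UNIV" for j
    by (rule finsupp_summable[OF finsupp_jump[OF fg(1)]])
  have s1: "(\<lambda>n. \<epsilon> * ?b (n + v j) + (1 - \<epsilon>) * ?b n + \<epsilon> * (1 - \<epsilon>) * ?J j n) summable_on UNIV" for j
    by (intro summable_on_add summable_on_cmult_right sb sJ)
  have "(\<Sum>\<^sub>\<infinity>n. (\<Sum>j\<in>UNIV. \<epsilon> * ?b (n + v j) + (1 - \<epsilon>) * ?b n + \<epsilon> * (1 - \<epsilon>) * ?J j n) / ?N)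
      \<le> (\<Sum>\<^sub>\<infinity>n. bellman p (lazy_average v \<epsilon> f n) (lazy_average v \<epsilon> g n))"
    by (intro infsum_mono summable_on_divide_const summable_on_finite_sum s1 bellman_lazy_average_pointwise[OF p e]
        finsupp_summable finsupp_bellman[OF p] finsupp_lazy_average fg)
  also have "(\<Sum>\<^sub>\<infinity>n. (\<Sum>j\<in>UNIV. \<epsilon> * ?b (n + v j) + (1 - \<epsilon>) * ?b n + \<epsilon> * (1 - \<epsilon>) * ?J j n) / ?N)
      = (\<Sum>j\<in>UNIV. (\<Sum>\<^sub>\<infinity>n. \<epsilon> * ?b (n + v j) + (1 - \<epsilon>) * ?b n + \<epsilon> * (1 - \<epsilon>) * ?J j n)) / ?N"
    by (simp add: infsum_divide_const infsum_finite_sum s1)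
  also have "\<dots> = (\<Sum>j\<in>UNIV. infsum ?b UNIV + \<epsilon> * (1 - \<epsilon>) * infsum (?J j) UNIV) / ?N"
  proof -
    have "(\<Sum>\<^sub>\<infinity>n. \<epsilon> * ?b (n + v j) + (1 - \<epsilon>) * ?b n + \<epsilon> * (1 - \<epsilon>) * ?J j n)
        = \<epsilon> * (\<Sum>\<^sub>\<infinity>n. ?b (n + v j)) + (1 - \<epsilon>) * infsum ?b UNIV + \<epsilon> * (1 - \<epsilon>) * infsum (?J j) UNIV" for j
      by (subst infsum_add infsum_cmult_right', (intro summable_on_add summable_on_cmult_right sb sJ)+)+ 
         (simp add: infsum_cmult_right')
    moreover have "\<epsilon> * (\<Sum>\<^sub>\<infinity>n. ?b (n + v j)) + (1 - \<epsilon>) * infsum ?b UNIV = infsum ?b UNIV" for j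
      unfolding infsum_shift[of ?b] by (simp add: algebra_simps)
    ultimately show ?thesis by (simp only:)
  qed
  also have "\<dots> = infsum ?b UNIV + \<epsilon> * (1 - \<epsilon>) / CARD('j) * jump_energy v f g"
    by (simp add: jump_energy_def sum.distrib sum_distrib_left add_divide_distrib sum_divide_distrib)
  finally show ?thesis .
qed

lemma finsupp_lazy_average_iterate:
  "finsupp f \<Longrightarrow> finsupp ((lazy_average v \<epsilon> ^^ k) f)"
  by (induction k) (auto intro: finsupp_lazy_average)

lemma sum_jump_energy_le_powr:
  fixes v :: "'j::finite \<Rightarrow> 'a::ab_group_add"
  assumes p: "2 \<le> p" and e: "0 \<le> \<epsilon>" "\<epsilon> \<le> 1" and fg: "finsupp f" "finsupp g"
  defines "q \<equiv> p / (p - 1)"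
  shows "\<epsilon> * (1 - \<epsilon>) / CARD('j) * (\<Sum>k<K. jump_energy v ((lazy_average v \<epsilon> ^^ k) f) ((lazy_average v \<epsilon> ^^ k) g))
    \<le> ((p - 1) * lp_norm p f) powr p / p + lp_norm q g powr q / q"
proof -
  have q: "0 < q" using p by (simp add: q_def)
  let ?S = "lazy_average v \<epsilon>"
  define B where "B k = (\<Sum>\<^sub>\<infinity>n. bellman p ((?S ^^ k) f n) ((?S ^^ k) g n))" for k
  have step: "B k + \<epsilon> * (1 - \<epsilon>) / CARD('j) * jump_energy v ((?S ^^ k) f) ((?S ^^ k) g) \<le> B (Suc k)" for k
    using bellman_lazy_average[OF p e finsupp_lazy_average_iterate[OF fg(1)] finsupp_lazy_average_iterate[OF fg(2)]]
    by (simp add: B_def)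
  have "B 0 + \<epsilon> * (1 - \<epsilon>) / CARD('j) * (\<Sum>k<K. jump_energy v ((?S ^^ k) f) ((?S ^^ k) g)) \<le> B K"
  proof (induction K)
    case (Suc K)
    then show ?case using step[of K] unfolding sum.lessThan_Suc distrib_left by linarith
  qed simp
  moreover have "B K \<le> 0" unfolding B_def by (rule order_trans[OF infsum_mono[of _ UNIV "\<lambda>_. 0"]])
      (auto intro!: finsupp_summable finsupp_bellman p finsupp_lazy_average_iterate fg bellman_nonpos)
  moreover have "- (((p - 1) * lp_norm p f) powr p / p + lp_norm q g powr q / q) \<le> B 0"
  proof -
    have sf: "(\<lambda>n. cmod (f n) powr p) summable_on UNIV" "(\<lambda>n. cmod (g n) powr q) summable_on UNIV"
      using finsupp_lp[OF fg(1)] finsupp_lp[OF fg(2)] by (simp_all add: lp_space_iff)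
    have "((p - 1) * lp_norm p f) powr p / p + lp_norm q g powr q / q
        = (\<Sum>\<^sub>\<infinity>n. (p - 1) powr p * cmod (f n) powr p / p) + (\<Sum>\<^sub>\<infinity>n. cmod (g n) powr q / q)"
      using p q by (simp add: powr_mult lp_norm_powr finsupp_lp fg infsum_cmult_right' infsum_divide_const)
    also have "\<dots> = (\<Sum>\<^sub>\<infinity>n. (p - 1) powr p * cmod (f n) powr p / p + cmod (g n) powr q / q)"
      by (intro infsum_add[symmetric] summable_on_divide_const summable_on_cmult_right sf)
    finally have eq: "((p - 1) * lp_norm p f) powr p / p + lp_norm q g powr q / q
        = (\<Sum>\<^sub>\<infinity>n. (p - 1) powr p * cmod (f n) powr p / p + cmod (g n) powr q / q)" .
    have s: "(\<lambda>n. (p - 1) powr p * cmod (f n) powr p / p + cmod (g n) powr q / q) summable_on UNIV"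
      by (intro summable_on_add summable_on_divide_const summable_on_cmult_right sf)
    have "- (((p - 1) * lp_norm p f) powr p / p + lp_norm q g powr q / q) = (\<Sum>\<^sub>\<infinity>n. - ((p - 1) powr p * cmod (f n) powr p / p + cmod (g n) powr q / q))"
      unfolding eq by (rule infsum_uminus[symmetric])
    also have "\<dots> \<le> B 0"
      unfolding B_def funpow_0
      by (rule infsum_mono[OF summable_on_uminus[THEN iffD2, OF s] finsupp_summable[OF finsupp_bellman[OF p fg]]])
         (unfold q_def, rule bellman_ge[OF p])
    finally show ?thesis .
  qed
  ultimately show ?thesis by linarith
qed

lemma lazy_average_scale: "lazy_average v \<epsilon> (\<lambda>n. c * f n) = (\<lambda>n. c * lazy_average v \<epsilon> f n)"
  by (simp add: lazy_average_def fun_eq_iff sum_distrib_left sum_divide_distrib algebra_simps)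

lemma lazy_average_iterate_scale: "(lazy_average v \<epsilon> ^^ k) (\<lambda>n. c * f n) = (\<lambda>n. c * (lazy_average v \<epsilon> ^^ k) f n)"
  by (induction k) (simp_all add: lazy_average_scale)

lemma jump_energy_scale:
  "jump_energy v (\<lambda>n. a * f n) (\<lambda>n. b * g n) = cmod a * cmod b * jump_energy v f g"
proof -
  have "cmod (a * f (n + v j) - a * f n) * cmod (b * g (n + v j) - b * g n)
      = (cmod a * cmod b) * (cmod (f (n + v j) - f n) * cmod (g (n + v j) - g n))" for n j
    by (simp add: right_diff_distrib[symmetric] norm_mult)
  then show ?thesis by (simp add: jump_energy_def infsum_cmult_right' sum_distrib_left)
qed

lemma jump_energy_commute: "jump_energy v f g = jump_energy v g f"
  by (simp add: jump_energy_def mult.commute)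

text \<open>The energy is homogeneous of degree 1 in f and in g separately. After scaling to (p -
  1)|f|_p = |g|_q = 1 the additive bound becomes 1/p + 1/q = 1, which turns it into the product
  bound.\<close>

lemma sum_jump_energy_le_ge2:
  fixes v :: "'j::finite \<Rightarrow> 'a::ab_group_add"
  assumes p: "2 \<le> p" and e: "0 \<le> \<epsilon>" "\<epsilon> \<le> 1" and fg: "finsupp f" "finsupp g"
  defines "q \<equiv> p / (p - 1)"
  shows "\<epsilon> * (1 - \<epsilon>) / CARD('j) * (\<Sum>k<K. jump_energy v ((lazy_average v \<epsilon> ^^ k) f) ((lazy_average v \<epsilon> ^^ k) g))
    \<le> (p - 1) * lp_norm p f * lp_norm q g" (is "?E f g \<le> _")
proof (cases "lp_norm p f = 0 \<or> lp_norm q g = 0")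
  case True
  have q: "0 < q" using p by (simp add: q_def)
  have "?E f g = 0"
  proof (cases "lp_norm p f = 0")
    case True
    then have "f = (\<lambda>_. 0)" using lp_norm_eq_0[of p f] finsupp_lp[OF fg(1)] p by auto
    then have "(lazy_average v \<epsilon> ^^ k) f = (\<lambda>n. 0)" for k
      using lazy_average_iterate_scale[of k v \<epsilon> 0 f] by simp
    then show ?thesis by (simp add: jump_energy_def)
  next
    case False
    then have "g = (\<lambda>_. 0)" using lp_norm_eq_0[of q g] finsupp_lp[OF fg(2)] q True by auto
    then have "(lazy_average v \<epsilon> ^^ k) g = (\<lambda>n. 0)" for k
      using lazy_average_iterate_scale[of k v \<epsilon> 0 g] by simp
    then show ?thesis by (simp add: jump_energy_def)
  qed
  then show ?thesis using True by auto
next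
  case False
  have q: "0 < q" using p by (simp add: q_def)
  define F where "F = (p - 1) * lp_norm p f"
  define G where "G = lp_norm q g"
  have pos: "0 < F" "0 < G" using False p by (auto simp: F_def G_def less_le)
  let ?f = "\<lambda>n. of_real (1 / F) * f n" and ?g = "\<lambda>n. of_real (1 / G) * g n"
  have "?E f g / (F * G) = ?E ?f ?g"
    using pos by (simp only: lazy_average_iterate_scale jump_energy_scale sum_distrib_left[symmetric])
       (simp add: norm_divide)
  also have "\<dots> \<le> ((p - 1) * lp_norm p ?f) powr p / p + lp_norm q ?g powr q / q"
    unfolding q_def by (intro sum_jump_energy_le_powr[OF p e] finsupp_cmult fg)
  also have "lp_norm p ?f = 1 / F * lp_norm p f"
    using lp_norm_scale(2)[OF _ finsupp_lp[OF fg(1)], of p "of_real (1 / F)"] p pos by (simp add: norm_divide)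
  also have "(p - 1) * (1 / F * lp_norm p f) = 1" using pos p by (auto simp: F_def)
  also have "lp_norm q ?g = 1 / G * lp_norm q g"
    using lp_norm_scale(2)[OF _ finsupp_lp[OF fg(2)], of q "of_real (1 / G)"] q pos by (simp add: norm_divide)
  also have "1 / G * lp_norm q g = 1" using pos by (simp add: G_def)
  also have "1 powr p / p + 1 powr q / q = 1" using p by (simp add: q_def field_simps)
  finally have "?E f g \<le> F * G" using pos by (simp add: divide_le_eq mult.commute)
  then show ?thesis by (simp add: F_def G_def)
qed

text \<open>For p < 2 the conjugate exponent is at least 2 and equals \<open>conj_max p\<close>; the
  energy is symmetric, so the previous bound is used with f and g exchanged.\<close>

lemma sum_jump_energy_le:
  fixes v :: "'j::finite \<Rightarrow> 'a::ab_group_add"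
  assumes p: "1 < p" and e: "0 \<le> \<epsilon>" "\<epsilon> \<le> 1" and fg: "finsupp f" "finsupp g"
  shows "\<epsilon> * (1 - \<epsilon>) / CARD('j) * (\<Sum>k<K. jump_energy v ((lazy_average v \<epsilon> ^^ k) f) ((lazy_average v \<epsilon> ^^ k) g))
    \<le> (conj_max p - 1) * lp_norm p f * lp_norm (p / (p - 1)) g"
proof (cases "2 \<le> p")
  case True
  then have "p / (p - 1) \<le> p" by (simp add: field_simps)
  then show ?thesis using sum_jump_energy_le_ge2[OF True e fg] by (simp add: conj_max_def max_def)
next
  case False
  define q where "q = p / (p - 1)"
  have q: "2 \<le> q" "p \<le> q" "q / (q - 1) = p" using False p by (simp_all add: q_def field_simps)
  show ?thesis using sum_jump_energy_le_ge2[OF q(1) e fg(2,1)] q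
    by (simp add: conj_max_def max_def q_def[symmetric] jump_energy_commute[of v "(_ ^^ _) f"] mult_ac)
qed

section \<open>The walk along the coordinate axes and its pairings\<close>

definition unit_shift :: "'n::finite \<times> bool \<Rightarrow> ('g::comm_ring_1)^'n" where
  "unit_shift = (\<lambda>(i, s). if s then axis i 1 else - axis i 1)"

lemma sum_bool: "(\<Sum>s\<in>UNIV. h s) = h True + h False"
  by (simp add: UNIV_bool add.commute)

lemma sum_prod_bool: "(\<Sum>j\<in>UNIV. h j) = (\<Sum>i\<in>UNIV. h (i, True) + h (i, False))"
  for h :: "'n::finite \<times> bool \<Rightarrow> 'b::comm_monoid_add"
proof -
  have "(\<Sum>j\<in>UNIV. h j) = (\<Sum>j\<in>UNIV \<times> UNIV. h j)" by simp
  also have "\<dots> = (\<Sum>i\<in>UNIV. \<Sum>s\<in>UNIV. h (i, s))" by (simp only: sum.cartesian_product case_prod_eta)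
  finally show ?thesis by (simp add: sum_bool)
qed

abbreviation second_difference :: "'n::finite \<Rightarrow> (('g::comm_ring_1)^'n \<Rightarrow> complex) \<Rightarrow> 'g^'n \<Rightarrow> complex" where
  "second_difference i f \<equiv> deriv_plus i (deriv_minus i f)"

lemma second_difference_eq: "second_difference i f n = f (n + axis i 1) + f (n - axis i 1) - 2 * f n"
  by (simp add: deriv_plus_def deriv_minus_def)

lemma finsupp_second_difference: "finsupp f \<Longrightarrow> finsupp (second_difference i f)"
  by (intro finsupp_deriv)

lemma lazy_average_unit_shift:
  fixes f :: "('g::comm_ring_1)^'n::finite \<Rightarrow> complex"
  shows "lazy_average unit_shift \<epsilon> f n = f n + of_real (\<epsilon> / (2 * CARD('n))) * laplacian f n"
proof -
  have "(\<Sum>j\<in>UNIV. of_real (1 - \<epsilon>) * f n + of_real \<epsilon> * f (n + unit_shift j))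
      = (\<Sum>i\<in>UNIV. 2 * f n + of_real \<epsilon> * second_difference i f n)"
    unfolding sum_prod_bool by (intro sum.cong refl) (simp add: unit_shift_def second_difference_eq algebra_simps)
  also have "\<dots> = of_nat (2 * CARD('n)) * f n + of_real \<epsilon> * laplacian f n"
    by (simp add: sum.distrib laplacian_def sum_distrib_left)
  finally show ?thesis
    by (simp add: lazy_average_def add_divide_distrib)
qed

definition pairing :: "('a \<Rightarrow> complex) \<Rightarrow> ('a \<Rightarrow> complex) \<Rightarrow> complex" where
  "pairing f g = (\<Sum>\<^sub>\<infinity>n. f n * g n)"

lemma finsupp_mult: "finsupp f \<Longrightarrow> finsupp (\<lambda>n. f n * g n :: complex)"
  by (erule finsupp_subset) auto

lemma pairing_commute: "pairing f g = pairing g f"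
  by (simp add: pairing_def mult.commute)

lemma pairing_scale: "pairing (\<lambda>n. c * f n) g = c * pairing f g"
  by (simp add: pairing_def mult.assoc infsum_cmult_right')

lemma pairing_add:
  assumes "finsupp f" "finsupp g"
  shows "pairing (\<lambda>n. f n + g n) h = pairing f h + pairing g h"
  unfolding pairing_def distrib_right
  by (intro infsum_add finsupp_summable finsupp_mult assms)

lemma pairing_sum:
  assumes "\<And>i. i \<in> I \<Longrightarrow> finsupp (f i)"
  shows "pairing (\<lambda>n. \<Sum>i\<in>I. f i n) h = (\<Sum>i\<in>I. pairing (f i) h)"
  unfolding pairing_def sum_distrib_right
  by (intro infsum_finite_sum finsupp_summable finsupp_mult assms)

lemma pairing_superset:
  assumes "finite S" "{n. f n \<noteq> 0} \<subseteq> S"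
  shows "pairing f g = (\<Sum>n\<in>S. f n * g n)"
  unfolding pairing_def infsum_finite[OF assms(1), symmetric]
  by (rule infsum_cong_neutral) (use assms in auto)

text \<open>Summation by parts. Either sign of v gives the same value; using both signs matches the
  energy, which counts every edge in both directions.\<close>

lemma pairing_second_difference:
  fixes f g :: "('g::comm_ring_1)^'n::finite \<Rightarrow> complex"
  assumes fg: "finsupp f" "finsupp g" and v: "v = axis i 1 \<or> v = - axis i 1"
  shows "pairing (second_difference i f) g = - (\<Sum>\<^sub>\<infinity>n. (f (n + v) - f n) * (g (n + v) - g n))"
proof -
  have sh: "pairing (\<lambda>n. f (n - u)) g = pairing f (\<lambda>n. g (n + u))" for u
    using infsum_shift[of "\<lambda>n. f (n - u) * g n" u] by (simp add: pairing_def)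
  have fin: "finsupp (\<lambda>n. f (n + u))" "finsupp (\<lambda>n. f (n - u))" for u
    using finsupp_shift[OF fg(1), of u] finsupp_shift[OF fg(1), of "- u"] by simp_all
  let ?e = "axis i 1 :: 'g^'n"
  have "pairing (second_difference i f) g = pairing (\<lambda>n. f (n + ?e) + f (n - ?e) + (-2) * f n) g"
    by (simp add: second_difference_eq fun_eq_iff pairing_def)
  also have "\<dots> = pairing (\<lambda>n. f (n + ?e)) g + pairing (\<lambda>n. f (n - ?e)) g - 2 * pairing f g"
    by (subst pairing_add | intro finsupp_add finsupp_cmult fin fg)+ (simp only: pairing_scale, simp)
  also have "\<dots> = pairing (\<lambda>n. f (n + v)) g + pairing f (\<lambda>n. g (n + v)) - 2 * pairing f g"
    using v sh[of ?e] sh[of "- ?e"] by (auto simp: add.commute)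
  also have "\<dots> = - (pairing (\<lambda>n. f (n + v)) (\<lambda>n. g (n + v)) - pairing f (\<lambda>n. g (n + v)) - pairing (\<lambda>n. f (n + v)) g + pairing f g)"
    using infsum_shift[of "\<lambda>n. f n * g n" v] by (simp add: pairing_def)
  also have "pairing (\<lambda>n. f (n + v)) (\<lambda>n. g (n + v)) - pairing f (\<lambda>n. g (n + v)) - pairing (\<lambda>n. f (n + v)) g + pairing f g
      = (\<Sum>\<^sub>\<infinity>n. (f (n + v) - f n) * (g (n + v) - g n))"
  proof -
    have 1: "pairing (\<lambda>n. f (n + v) + (-1) * f n) h = pairing (\<lambda>n. f (n + v)) h - pairing f h" for h
      by (subst pairing_add | intro finsupp_cmult fin fg)+ (simp only: pairing_scale, simp)
    have "(\<Sum>\<^sub>\<infinity>n. (f (n + v) - f n) * (g (n + v) - g n)) = pairing (\<lambda>n. g (n + v) + (-1) * g n) (\<lambda>n. f (n + v) + (-1) * f n)"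
      by (simp add: pairing_def mult.commute)
    also have "\<dots> = pairing (\<lambda>n. g (n + v)) (\<lambda>n. f (n + v) + (-1) * f n) - pairing g (\<lambda>n. f (n + v) + (-1) * f n)"
      by (subst pairing_add | intro finsupp_cmult finsupp_shift fg)+ (simp only: pairing_scale, simp)
    also have "\<dots> = pairing (\<lambda>n. f (n + v)) (\<lambda>n. g (n + v)) - pairing f (\<lambda>n. g (n + v)) - pairing (\<lambda>n. f (n + v)) g + pairing f g"
      unfolding pairing_commute[of _ "\<lambda>n. f (n + v) + (-1) * f n"] 1 by simp
    finally show ?thesis by simp
  qed
  finally show ?thesis .
qed

lemma pairing_second_difference_symmetric:
  assumes "finsupp f" "finsupp g"
  shows "pairing (second_difference i f) g = pairing f (second_difference i g)"
  using pairing_second_difference[OF assms, of "axis i 1" i] pairing_second_difference[OF assms(2,1), of "axis i 1" i]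
  by (simp add: pairing_commute[of f] mult.commute)

lemma finsupp_laplacian: "finsupp f \<Longrightarrow> finsupp (laplacian f)"
  unfolding laplacian_def[abs_def] by (intro finsupp_sum finsupp_second_difference)

lemma pairing_lazy_average:
  assumes "finsupp f" "finsupp g"
  shows "pairing (lazy_average unit_shift \<epsilon> f) g = pairing f (lazy_average unit_shift \<epsilon> g)"
proof -
  have "pairing (laplacian f) g = pairing f (laplacian g)"
  proof -
    have "pairing (laplacian f) g = (\<Sum>i\<in>UNIV. pairing (second_difference i f) g)"
      unfolding laplacian_def[abs_def] by (intro pairing_sum finsupp_second_difference assms)
    also have "\<dots> = (\<Sum>i\<in>UNIV. pairing (second_difference i g) f)"
      by (simp only: pairing_second_difference_symmetric[OF assms] pairing_commute[of f])
    also have "\<dots> = pairing (laplacian g) f"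
      unfolding laplacian_def[abs_def] by (intro pairing_sum[symmetric] finsupp_second_difference assms)
    finally show ?thesis by (simp only: pairing_commute[of f])
  qed
  moreover have "pairing (\<lambda>n. f n + c * laplacian f n) g = pairing f g + c * pairing (laplacian f) g"
    "pairing (\<lambda>n. g n + c * laplacian g n) f = pairing g f + c * pairing (laplacian g) f" for c
    using assms by (simp_all add: pairing_add finsupp_cmult finsupp_laplacian pairing_scale)
  ultimately show ?thesis
    unfolding lazy_average_unit_shift[abs_def] pairing_commute[of f] by (simp only:)
qed

lemma pairing_lazy_average_iterate:
  assumes "finsupp f" "finsupp g"
  shows "pairing ((lazy_average unit_shift \<epsilon> ^^ k) f) g = pairing f ((lazy_average unit_shift \<epsilon> ^^ k) g)"
  using assms
proof (induction k arbitrary: f)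
  case (Suc k)
  have "pairing ((lazy_average unit_shift \<epsilon> ^^ Suc k) f) g = pairing ((lazy_average unit_shift \<epsilon> ^^ k) (lazy_average unit_shift \<epsilon> f)) g"
    by (simp only: funpow_Suc_right o_apply)
  also have "\<dots> = pairing (lazy_average unit_shift \<epsilon> f) ((lazy_average unit_shift \<epsilon> ^^ k) g)"
    using Suc by (intro Suc.IH finsupp_lazy_average) auto
  also have "\<dots> = pairing f ((lazy_average unit_shift \<epsilon> ^^ Suc k) g)"
    using Suc.prems by (simp add: pairing_lazy_average finsupp_lazy_average_iterate)
  finally show ?case .
qed simp

definition weighted_laplacian :: "complex^'n::finite \<Rightarrow> (('g::comm_ring_1)^'n \<Rightarrow> complex) \<Rightarrow> 'g^'n \<Rightarrow> complex" where
  "weighted_laplacian \<alpha> f n = (\<Sum>i\<in>UNIV. \<alpha> $ i * second_difference i f n)"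

lemma finsupp_weighted_laplacian: "finsupp f \<Longrightarrow> finsupp (weighted_laplacian \<alpha> f)"
  unfolding weighted_laplacian_def[abs_def] by (intro finsupp_sum finsupp_cmult finsupp_second_difference)

text \<open>The factor 2 comes from writing each pairing twice, once for each orientation of the
  edges, as in \<open>jump_energy\<close>.\<close>

lemma pairing_weighted_laplacian_le:
  fixes f g :: "('g::comm_ring_1)^'n::finite \<Rightarrow> complex"
  assumes fg: "finsupp f" "finsupp g" and \<alpha>: "\<And>i. cmod (\<alpha> $ i) \<le> 1"
  shows "2 * cmod (pairing (weighted_laplacian \<alpha> f) g) \<le> jump_energy unit_shift f g"
proof -
  let ?I = "\<lambda>j. \<Sum>\<^sub>\<infinity>n. (f (n + unit_shift j) - f n) * (g (n + unit_shift j) - g n)"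
  have "2 * pairing (weighted_laplacian \<alpha> f) g = (\<Sum>i\<in>UNIV. \<alpha> $ i * (2 * pairing (second_difference i f) g))"
    unfolding weighted_laplacian_def[abs_def]
    by (simp add: pairing_sum finsupp_cmult finsupp_second_difference fg pairing_scale sum_distrib_left mult.left_commute)
  also have "\<dots> = (\<Sum>i\<in>UNIV. \<alpha> $ i * (- ?I (i, True) - ?I (i, False)))"
  proof (intro sum.cong refl)
    fix i
    show "\<alpha> $ i * (2 * pairing (second_difference i f) g) = \<alpha> $ i * (- ?I (i, True) - ?I (i, False))"
      using pairing_second_difference[OF fg, of "axis i 1" i] pairing_second_difference[OF fg, of "- axis i 1" i]
      by (simp add: unit_shift_def)
  qed
  finally have "2 * cmod (pairing (weighted_laplacian \<alpha> f) g)
      = cmod (\<Sum>i\<in>UNIV. \<alpha> $ i * (- ?I (i, True) - ?I (i, False)))"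
    by (metis norm_mult norm_numeral)
  also have "\<dots> \<le> (\<Sum>i\<in>UNIV. cmod (?I (i, True)) + cmod (?I (i, False)))"
  proof (rule sum_norm_le)
    fix i
    have "cmod (\<alpha> $ i * (- ?I (i, True) - ?I (i, False))) \<le> 1 * cmod (- ?I (i, True) - ?I (i, False))"
      unfolding norm_mult by (intro mult_right_mono \<alpha>) auto
    also have "\<dots> \<le> cmod (?I (i, True)) + cmod (?I (i, False))"
      using norm_triangle_ineq4[of "- ?I (i, True)" "?I (i, False)"] by simp
    finally show "cmod (\<alpha> $ i * (- ?I (i, True) - ?I (i, False))) \<le> cmod (?I (i, True)) + cmod (?I (i, False))" .
  qed
  also have "\<dots> = (\<Sum>j\<in>UNIV. cmod (?I j))"
    by (rule sum_prod_bool[of "\<lambda>j. cmod (?I j)", symmetric])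
  also have "\<dots> \<le> jump_energy unit_shift f g"
    unfolding jump_energy_def
  proof (rule sum_mono)
    fix j :: "'n \<times> bool"
    have "(\<lambda>n. cmod ((f (n + unit_shift j) - f n) * (g (n + unit_shift j) - g n))) summable_on UNIV"
      using finsupp_summable[OF finsupp_jump[OF fg(1), of "unit_shift j" g]] by (simp add: norm_mult)
    from norm_infsum_bound[OF this]
    show "cmod (?I j) \<le> (\<Sum>\<^sub>\<infinity>n. cmod (f (n + unit_shift j) - f n) * cmod (g (n + unit_shift j) - g n))"
      by (simp add: norm_mult)
  qed
  finally show ?thesis .
qed

text \<open>Half of the 2k walk steps stands on either side of the weighted Laplacian: symmetry
  moves the outer half onto g, so the k-th term is controlled by the energy of the two walks after k
  steps. The minus sign makes the operator approximate the negative of the Riesz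
  combination.\<close>

definition heat_operator ::
  "complex^'n::finite \<Rightarrow> real \<Rightarrow> nat \<Rightarrow> (('g::comm_ring_1)^'n \<Rightarrow> complex) \<Rightarrow> 'g^'n \<Rightarrow> complex" where
  "heat_operator \<alpha> \<epsilon> K f n = - of_real (\<epsilon> * (1 - \<epsilon>) / CARD('n)) *
     (\<Sum>k<K. (lazy_average unit_shift \<epsilon> ^^ k) (weighted_laplacian \<alpha> ((lazy_average unit_shift \<epsilon> ^^ k) f)) n)"

lemma finsupp_heat_operator: "finsupp f \<Longrightarrow> finsupp (heat_operator \<alpha> \<epsilon> K f)"
  unfolding heat_operator_def[abs_def]
  by (intro finsupp_cmult finsupp_sum finsupp_lazy_average_iterate finsupp_weighted_laplacian)

lemma pairing_heat_operator_le:
  fixes f g :: "('g::comm_ring_1)^'n::finite \<Rightarrow> complex"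
  assumes p: "1 < p" and e: "0 \<le> \<epsilon>" "\<epsilon> \<le> 1" and fg: "finsupp f" "finsupp g" and \<alpha>: "\<And>i. cmod (\<alpha> $ i) \<le> 1"
  shows "cmod (pairing (heat_operator \<alpha> \<epsilon> K f) g) \<le> (conj_max p - 1) * lp_norm p f * lp_norm (p / (p - 1)) g"
proof -
  let ?S = "lazy_average unit_shift \<epsilon> :: ('g^'n \<Rightarrow> complex) \<Rightarrow> _"
  let ?c = "\<epsilon> * (1 - \<epsilon>) / CARD('n)"
  have c: "0 \<le> ?c" using e by simp
  have "pairing (heat_operator \<alpha> \<epsilon> K f) g = - of_real ?c * (\<Sum>k<K. pairing ((?S ^^ k) (weighted_laplacian \<alpha> ((?S ^^ k) f))) g)"
    unfolding heat_operator_def[abs_def]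
    by (simp only: pairing_scale) (subst pairing_sum, auto intro!: finsupp_lazy_average_iterate finsupp_weighted_laplacian fg)
  also have "\<dots> = - of_real ?c * (\<Sum>k<K. pairing (weighted_laplacian \<alpha> ((?S ^^ k) f)) ((?S ^^ k) g))"
    by (simp add: pairing_lazy_average_iterate finsupp_lazy_average_iterate finsupp_weighted_laplacian fg)
  finally have "cmod (pairing (heat_operator \<alpha> \<epsilon> K f) g) = cmod (- of_real ?c * (\<Sum>k<K. pairing (weighted_laplacian \<alpha> ((?S ^^ k) f)) ((?S ^^ k) g)))"
    by (rule arg_cong)
  also have "\<dots> = ?c * cmod (\<Sum>k<K. pairing (weighted_laplacian \<alpha> ((?S ^^ k) f)) ((?S ^^ k) g))"
    using c by (simp only: norm_mult norm_minus_cancel norm_of_real abs_of_nonneg)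
  also have "\<dots> \<le> ?c * (\<Sum>k<K. jump_energy unit_shift ((?S ^^ k) f) ((?S ^^ k) g) / 2)"
    using pairing_weighted_laplacian_le[OF finsupp_lazy_average_iterate[OF fg(1)] finsupp_lazy_average_iterate[OF fg(2)] \<alpha>]
    by (intro mult_left_mono c sum_norm_le) (simp add: mult.commute)
  also have "\<dots> = \<epsilon> * (1 - \<epsilon>) / CARD('n \<times> bool) * (\<Sum>k<K. jump_energy unit_shift ((?S ^^ k) f) ((?S ^^ k) g))"
    by (simp add: sum_divide_distrib[symmetric])
  also have "\<dots> \<le> (conj_max p - 1) * lp_norm p f * lp_norm (p / (p - 1)) g"
    by (rule sum_jump_energy_le[OF p e fg])
  finally show ?thesis .
qed

text \<open>The test function is the extremal one in Hoelder's inequality, \<open>cnj (h n)\<close>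
  times |h n|^(p - 2), cut off to S; it vanishes at zeros of h because of the first factor. As S is
  finite, so is s, and s^(1/q) can be cancelled.\<close>

lemma sum_powr_le_by_duality:
  fixes h :: "'a \<Rightarrow> complex"
  assumes p: "1 < p" and M: "0 \<le> M" and S: "finite S"
    and bound: "\<And>g. finsupp g \<Longrightarrow> {n. g n \<noteq> 0} \<subseteq> S \<Longrightarrow> cmod (\<Sum>n\<in>S. h n * g n) \<le> M * lp_norm (p / (p - 1)) g"
  shows "(\<Sum>n\<in>S. cmod (h n) powr p) \<le> M powr p"
proof -
  define q where "q = p / (p - 1)"
  have q: "0 < q" "(p - 1) * q = p" using p by (simp_all add: q_def)
  define s where "s = (\<Sum>n\<in>S. cmod (h n) powr p)"
  define g where "g n = (if n \<in> S then cnj (h n) * of_real (cmod (h n) powr (p - 2)) else 0)" for n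
  have supp: "{n. g n \<noteq> 0} \<subseteq> S" by (auto simp: g_def split: if_splits)
  then have fin: "finsupp g" using S by (simp add: finsupp_def finite_subset)
  have hg: "h n * g n = of_real (cmod (h n) powr p)" if "n \<in> S" for n
  proof (cases "h n = 0")
    case False
    have "cmod (h n) powr p = (cmod (h n))\<^sup>2 * cmod (h n) powr (p - 2)"
      using False by (simp add: powr_diff)
    then show ?thesis using that complex_norm_square[of "h n"]
      by (simp add: g_def mult.assoc[symmetric])
  qed (use that p in \<open>simp add: g_def\<close>)
  have gq: "cmod (g n) powr q = cmod (h n) powr p" if "n \<in> S" for n
  proof (cases "h n = 0")
    case False
    have "cmod (g n) = cmod (h n) powr (p - 1)"
      using that False powr_mult_base[of "cmod (h n)" "p - 2"] by (simp add: g_def norm_mult)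
    then show ?thesis using q by (simp add: powr_powr)
  qed (use that p q in \<open>simp add: g_def\<close>)
  have "lp_norm q g powr q = s"
    unfolding finsupp_lp_norm_powr[OF q(1) S supp] s_def by (intro sum.cong refl gq)
  then have "(lp_norm q g powr q) powr (1 / q) = s powr (1 / q)" by simp
  then have "lp_norm q g = s powr (1 / q)" using q by (simp add: powr_powr)
  moreover have "cmod (\<Sum>n\<in>S. h n * g n) = s"
    by (simp add: hg s_def sum_nonneg flip: of_real_sum)
  ultimately have le: "s \<le> M * s powr (1 / q)"
    using bound[OF fin supp] by (simp add: q_def)
  show ?thesis
  proof (cases "s = 0")
    case True
    then show ?thesis by (simp add: s_def[symmetric])
  next
    case False
    then have s: "0 < s" using sum_nonneg[of S "\<lambda>n. cmod (h n) powr p"] by (simp add: s_def less_le)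
    have "s = s powr (1 / p) * s powr (1 / q)"
      using s p by (simp add: powr_add[symmetric] q_def diff_divide_distrib add_divide_distrib[symmetric])
    then have "s powr (1 / p) * s powr (1 / q) \<le> M * s powr (1 / q)" using le by simp
    then have "s powr (1 / p) \<le> M" using s by simp
    then have "(s powr (1 / p)) powr p \<le> M powr p" using p by (intro powr_mono2) auto
    then show ?thesis using s p by (simp add: powr_powr s_def[symmetric])
  qed
qed

lemma conj_max_ge_2:
  assumes "1 < p" shows "2 \<le> conj_max p"
proof (cases "2 \<le> p")
  case False
  then have "2 \<le> p / (p - 1)" using assms by (simp add: field_simps)
  then show ?thesis by (simp add: conj_max_def)
qed (simp add: conj_max_def)

lemma heat_operator_bound:
  fixes f :: "('g::comm_ring_1)^'n::finite \<Rightarrow> complex"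
  assumes p: "1 < p" and e: "0 \<le> \<epsilon>" "\<epsilon> \<le> 1" and f: "finsupp f" and \<alpha>: "\<And>i. cmod (\<alpha> $ i) \<le> 1" and S: "finite S"
  shows "(\<Sum>n\<in>S. cmod (heat_operator \<alpha> \<epsilon> K f n) powr p) \<le> ((conj_max p - 1) * lp_norm p f) powr p"
proof (rule sum_powr_le_by_duality[OF p _ S])
  show "0 \<le> (conj_max p - 1) * lp_norm p f" using conj_max_ge_2[OF p] by simp
  fix g :: "'g^'n \<Rightarrow> complex" assume g: "finsupp g" "{n. g n \<noteq> 0} \<subseteq> S"
  have "(\<Sum>n\<in>S. heat_operator \<alpha> \<epsilon> K f n * g n) = pairing (heat_operator \<alpha> \<epsilon> K f) g"
    using pairing_superset[OF S g(2)] by (simp add: pairing_commute[of _ g] mult.commute)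
  then show "cmod (\<Sum>n\<in>S. heat_operator \<alpha> \<epsilon> K f n * g n) \<le> (conj_max p - 1) * lp_norm p f * lp_norm (p / (p - 1)) g"
    using pairing_heat_operator_le[OF p e f g(1) \<alpha>] by simp
qed

section \<open>Fourier multipliers of the heat operators\<close>

definition sin_sum :: "real^'n::finite \<Rightarrow> real" where
  "sin_sum x = (\<Sum>i\<in>UNIV. (sin (pi * x $ i))\<^sup>2)"

definition weighted_sin_sum :: "complex^'n::finite \<Rightarrow> real^'n \<Rightarrow> complex" where
  "weighted_sin_sum \<alpha> x = (\<Sum>i\<in>UNIV. \<alpha> $ i * of_real ((sin (pi * x $ i))\<^sup>2))"

definition heat_symbol :: "complex^'n::finite \<Rightarrow> real \<Rightarrow> nat \<Rightarrow> real^'n \<Rightarrow> complex" where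
  "heat_symbol \<alpha> \<epsilon> K x = of_real (\<epsilon> * (1 - \<epsilon>) / CARD('n)) *
     (\<Sum>k<K. of_real ((1 - 2 * \<epsilon> * sin_sum x / CARD('n)) ^ (2 * k)) * (4 * weighted_sin_sum \<alpha> x))"

text \<open>\<Phi> stands for the Fourier transform at one fixed frequency, on the integer lattice
  or on a cyclic group. Each walk step becomes multiplication by the number m.\<close>

lemma transform_heat_operator:
  fixes \<Phi> :: "(('g::comm_ring_1)^'n::finite \<Rightarrow> complex) \<Rightarrow> complex"
  assumes add: "\<And>f g. finsupp f \<Longrightarrow> finsupp g \<Longrightarrow> \<Phi> (\<lambda>n. f n + g n) = \<Phi> f + \<Phi> g"
    and scale: "\<And>c f. finsupp f \<Longrightarrow> \<Phi> (\<lambda>n. c * f n) = c * \<Phi> f"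
    and diff2: "\<And>i f. finsupp f \<Longrightarrow> \<Phi> (second_difference i f) = of_real (- 4 * (sin (pi * x $ i))\<^sup>2) * \<Phi> f"
    and f: "finsupp f"
  shows "\<Phi> (heat_operator \<alpha> \<epsilon> K f) = heat_symbol \<alpha> \<epsilon> K x * \<Phi> f"
proof -
  have sum: "\<Phi> (\<lambda>n. \<Sum>i\<in>I. h i n) = (\<Sum>i\<in>I. \<Phi> (h i))" if "finite I" "\<And>i. i \<in> I \<Longrightarrow> finsupp (h i)" for I :: "'i set" and h
    using that
  proof (induction I)
    case empty
    show ?case using scale[of "\<lambda>_. 0" 0] by simp
  next
    case (insert i I)
    then show ?case using add[of "h i" "\<lambda>n. \<Sum>i\<in>I. h i n"] by (simp add: finsupp_sum)
  qed
  define m where "m = 1 - 2 * \<epsilon> * sin_sum x / CARD('n)"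
  have wl: "\<Phi> (weighted_laplacian \<alpha> h) = - 4 * weighted_sin_sum \<alpha> x * \<Phi> h" if "finsupp h" for h
  proof -
    have "\<Phi> (weighted_laplacian \<alpha> h) = (\<Sum>i\<in>UNIV. \<alpha> $ i * (of_real (- 4 * (sin (pi * x $ i))\<^sup>2) * \<Phi> h))"
      unfolding weighted_laplacian_def[abs_def]
      by (simp only: sum[OF finite finsupp_cmult[OF finsupp_second_difference[OF that]]]
          scale[OF finsupp_second_difference[OF that]] diff2[OF that])
    also have "\<dots> = - 4 * weighted_sin_sum \<alpha> x * \<Phi> h"
      by (simp add: weighted_sin_sum_def sum_distrib_left sum_distrib_right sum_negf mult_ac)
    finally show ?thesis .
  qed
  have S: "\<Phi> (lazy_average unit_shift \<epsilon> h) = of_real m * \<Phi> h" if "finsupp h" for h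
  proof -
    have "\<Phi> (laplacian h) = (\<Sum>i\<in>UNIV. of_real (- 4 * (sin (pi * x $ i))\<^sup>2) * \<Phi> h)"
      unfolding laplacian_def[abs_def]
      by (simp only: sum[OF finite finsupp_second_difference[OF that]] diff2[OF that])
    then have "\<Phi> (laplacian h) = of_real (- 4 * sin_sum x) * \<Phi> h"
      by (simp add: sin_sum_def sum_distrib_left sum_distrib_right sum_negf)
    then have "\<Phi> (lazy_average unit_shift \<epsilon> h) = \<Phi> h + of_real (\<epsilon> / (2 * CARD('n))) * (of_real (- 4 * sin_sum x) * \<Phi> h)"
      unfolding lazy_average_unit_shift[abs_def]
      by (simp only: add[OF that finsupp_cmult[OF finsupp_laplacian[OF that]]] scale[OF finsupp_laplacian[OF that]])
    also have "\<dots> = of_real (1 + \<epsilon> / (2 * CARD('n)) * (- 4 * sin_sum x)) * \<Phi> h"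
      by (simp add: algebra_simps)
    finally show ?thesis by (simp add: m_def mult.commute mult.left_commute)
  qed
  have Sk: "\<Phi> ((lazy_average unit_shift \<epsilon> ^^ k) h) = of_real (m ^ k) * \<Phi> h" if "finsupp h" for h k
    by (induction k) (simp_all add: S finsupp_lazy_average_iterate that)
  let ?S = "lazy_average unit_shift \<epsilon> :: ('g^'n \<Rightarrow> complex) \<Rightarrow> _"
  have "\<Phi> (heat_operator \<alpha> \<epsilon> K f)
      = - of_real (\<epsilon> * (1 - \<epsilon>) / CARD('n)) * (\<Sum>k<K. \<Phi> ((?S ^^ k) (weighted_laplacian \<alpha> ((?S ^^ k) f))))"
    unfolding heat_operator_def[abs_def]
    by (subst scale, intro finsupp_sum finsupp_lazy_average_iterate finsupp_weighted_laplacian f)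
       (subst sum, auto intro!: finsupp_lazy_average_iterate finsupp_weighted_laplacian f)
  also have "\<dots> = - of_real (\<epsilon> * (1 - \<epsilon>) / CARD('n)) * (\<Sum>k<K. of_real (m ^ k) * (- 4 * weighted_sin_sum \<alpha> x * (of_real (m ^ k) * \<Phi> f)))"
    by (simp only: Sk wl finsupp_lazy_average_iterate finsupp_weighted_laplacian f)
  also have "(\<Sum>k<K. of_real (m ^ k) * (- 4 * weighted_sin_sum \<alpha> x * (of_real (m ^ k) * \<Phi> f)))
      = - (\<Sum>k<K. of_real (m ^ (2 * k)) * (4 * weighted_sin_sum \<alpha> x)) * \<Phi> f"
    unfolding sum_negf[symmetric] sum_distrib_right
    by (intro sum.cong refl) (simp add: power_add mult_2)
  finally show ?thesis by (simp add: heat_symbol_def m_def)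
qed

lemma sin_sum_bounds: "0 \<le> sin_sum x" "sin_sum (x :: real^'n::finite) \<le> CARD('n)"
proof -
  show "0 \<le> sin_sum x" unfolding sin_sum_def by (intro sum_nonneg) simp
  have "sin_sum x \<le> (\<Sum>i\<in>(UNIV::'n set). 1)"
    unfolding sin_sum_def by (intro sum_mono) (simp add: abs_square_le_1)
  then show "sin_sum x \<le> CARD('n)" by simp
qed

lemma norm_weighted_sin_sum_le:
  assumes "\<And>i. cmod (\<alpha> $ i) \<le> 1"
  shows "cmod (weighted_sin_sum \<alpha> x) \<le> sin_sum x"
  unfolding weighted_sin_sum_def sin_sum_def
proof (rule sum_norm_le)
  fix i
  show "cmod (\<alpha> $ i * of_real ((sin (pi * x $ i))\<^sup>2)) \<le> (sin (pi * x $ i))\<^sup>2"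
    using mult_right_mono[OF assms[of i], of "(sin (pi * x $ i))\<^sup>2"] by (simp add: norm_mult norm_power)
qed

text \<open>The symbol of \<open>- R\<^sub>\<alpha>\<^sup>2\<close>, with value \<open>0\<close> where the denominator vanishes.\<close>

definition limit_symbol :: "complex^'n::finite \<Rightarrow> real^'n \<Rightarrow> complex" where
  "limit_symbol \<alpha> x = weighted_sin_sum \<alpha> x / of_real (sin_sum x)"

lemma limit_symbol_eq: "limit_symbol \<alpha> x = - (\<Sum>i\<in>UNIV. \<alpha> $ i * riesz2_symbol i x)"
  unfolding limit_symbol_def weighted_sin_sum_def riesz2_symbol_def sin_sum_def
  by (simp add: sum_divide_distrib sum_negf[symmetric])

lemma norm_limit_symbol_le:
  assumes "\<And>i. cmod (\<alpha> $ i) \<le> 1"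
  shows "cmod (limit_symbol \<alpha> x) \<le> 1"
  using norm_weighted_sin_sum_le[OF assms, of x] sin_sum_bounds(1)[of x]
  by (auto simp: limit_symbol_def norm_divide divide_le_eq_1)

text \<open>What remains of the summed geometric series once the Riesz symbol is split off; it lies
  in [0, 1] for 0 < \<epsilon> < 1 and tends to 1 as \<epsilon> tends to 0.\<close>

definition damping :: "real \<Rightarrow> real^'n::finite \<Rightarrow> real" where
  "damping \<epsilon> x = 2 * (1 - \<epsilon>) / (2 - 2 * \<epsilon> * sin_sum x / CARD('n))"

text \<open>A geometric series with ratio (1 - \<kappa>)^2 has denominator \<kappa>(2 - \<kappa>).
  The factor \<kappa>, proportional to \<open>sin_sum x\<close>, produces the denominator of the
  Riesz symbol, and 2 - \<kappa> goes into \<open>damping\<close>. Where \<open>sin_sum x\<close> is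
  0, the weighted sum vanishes as well and both sides are 0.\<close>

lemma heat_symbol_eq:
  fixes x :: "real^'n::finite"
  assumes e: "0 < \<epsilon>" "\<epsilon> < 1" and \<alpha>: "\<And>i. cmod (\<alpha> $ i) \<le> 1"
  shows "heat_symbol \<alpha> \<epsilon> K x = limit_symbol \<alpha> x * of_real (damping \<epsilon> x * (1 - (1 - 2 * \<epsilon> * sin_sum x / CARD('n)) ^ (2 * K)))"
proof (cases "sin_sum x = 0")
  case True
  then have "weighted_sin_sum \<alpha> x = 0" using norm_weighted_sin_sum_le[OF \<alpha>, of x] by simp
  then show ?thesis by (simp add: heat_symbol_def limit_symbol_def)
next
  case False
  define \<kappa> where "\<kappa> = 2 * \<epsilon> * sin_sum x / CARD('n)"
  have s: "0 < sin_sum x" using False sin_sum_bounds(1)[of x] by simp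
  have \<kappa>: "0 < \<kappa>" "\<kappa> < 2"
  proof -
    show "0 < \<kappa>" using e s by (simp add: \<kappa>_def)
    have "\<kappa> \<le> 2 * \<epsilon> * CARD('n) / CARD('n)"
      unfolding \<kappa>_def using e sin_sum_bounds(2)[of x] by (intro divide_right_mono mult_left_mono) auto
    then show "\<kappa> < 2" using e by simp
  qed
  have ne: "(1 - \<kappa>)\<^sup>2 \<noteq> 1"
  proof
    assume "(1 - \<kappa>)\<^sup>2 = 1"
    then have "\<kappa> * (2 - \<kappa>) = 0" by (simp add: power2_eq_square algebra_simps)
    then show False using \<kappa> by simp
  qed
  have "(\<Sum>k<K. (1 - \<kappa>) ^ (2 * k)) = (1 - (1 - \<kappa>) ^ (2 * K)) / (\<kappa> * (2 - \<kappa>))"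
  proof -
    have "(\<Sum>k<K. (1 - \<kappa>) ^ (2 * k)) = (((1 - \<kappa>)\<^sup>2) ^ K - 1) / ((1 - \<kappa>)\<^sup>2 - 1)"
      using geometric_sum[OF ne, of K] by (simp add: power_mult)
    also have "(1 - \<kappa>)\<^sup>2 - 1 = - (\<kappa> * (2 - \<kappa>))" by (simp add: power2_eq_square algebra_simps)
    also have "(((1 - \<kappa>)\<^sup>2) ^ K - 1) / - (\<kappa> * (2 - \<kappa>)) = (1 - ((1 - \<kappa>)\<^sup>2) ^ K) / (\<kappa> * (2 - \<kappa>))"
      by (metis minus_diff_eq minus_divide_divide)
    finally show ?thesis by (simp only: power_mult)
  qed
  moreover have "heat_symbol \<alpha> \<epsilon> K x = of_real (\<epsilon> * (1 - \<epsilon>) / CARD('n) * (\<Sum>k<K. (1 - \<kappa>) ^ (2 * k)) * 4) * weighted_sin_sum \<alpha> x"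
    unfolding heat_symbol_def \<kappa>_def[symmetric] sum_distrib_right[symmetric] of_real_sum[symmetric] by simp
  ultimately have "heat_symbol \<alpha> \<epsilon> K x = of_real (\<epsilon> * (1 - \<epsilon>) / CARD('n) * ((1 - (1 - \<kappa>) ^ (2 * K)) / (\<kappa> * (2 - \<kappa>))) * 4) * weighted_sin_sum \<alpha> x"
    by simp
  also have "\<epsilon> * (1 - \<epsilon>) / CARD('n) * ((1 - (1 - \<kappa>) ^ (2 * K)) / (\<kappa> * (2 - \<kappa>))) * 4
      = damping \<epsilon> x * (1 - (1 - \<kappa>) ^ (2 * K)) / sin_sum x"
  proof -
    have "\<epsilon> * (1 - \<epsilon>) / CARD('n) * (t / (\<kappa> * (2 - \<kappa>))) * 4 = 2 * (1 - \<epsilon>) / (2 - \<kappa>) * t / sin_sum x" for t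
    proof -
      have "\<epsilon> * (1 - \<epsilon>) / CARD('n) * (t / (\<kappa> * (2 - \<kappa>))) * 4 = (2 * \<epsilon> / CARD('n) / \<kappa>) * (2 * (1 - \<epsilon>) / (2 - \<kappa>) * t)"
      proof -
        have "e * a / n * (t / (k * b)) * 4 = (2 * e / n / k) * (2 * a / b * t)" for e a n t k b :: real
          by (simp add: mult_ac)
        then show ?thesis .
      qed
      also have "2 * \<epsilon> / CARD('n) / \<kappa> = 1 / sin_sum x" using s e by (simp add: \<kappa>_def)
      finally show ?thesis by simp
    qed
    then show ?thesis by (simp add: damping_def \<kappa>_def)
  qed
  finally show ?thesis by (simp add: limit_symbol_def \<kappa>_def mult.commute)
qed

lemma damping_bounds:
  fixes x :: "real^'n::finite"
  assumes e: "0 < \<epsilon>" "\<epsilon> < 1"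
  shows "0 \<le> damping \<epsilon> x" "damping \<epsilon> x \<le> 1"
proof -
  have "2 * \<epsilon> * sin_sum x / CARD('n) \<le> 2 * \<epsilon> * CARD('n) / CARD('n)"
    using e sin_sum_bounds(2)[of x] by (intro divide_right_mono mult_left_mono) auto
  then have "2 * \<epsilon> * sin_sum x / CARD('n) \<le> 2 * \<epsilon>" by simp
  then show "0 \<le> damping \<epsilon> x" "damping \<epsilon> x \<le> 1"
    using e by (auto simp: damping_def divide_le_eq_1)
qed

lemma geometric_factor_bounds:
  fixes x :: "real^'n::finite"
  assumes e: "0 < \<epsilon>" "\<epsilon> \<le> 1 / 2"
  defines "m \<equiv> 1 - 2 * \<epsilon> * sin_sum x / CARD('n)"
  shows "0 \<le> m" "m \<le> 1" "sin_sum x \<noteq> 0 \<Longrightarrow> m < 1"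
proof -
  have "2 * \<epsilon> * sin_sum x / CARD('n) \<le> 2 * \<epsilon> * CARD('n) / CARD('n)"
    using e sin_sum_bounds(2)[of x] by (intro divide_right_mono mult_left_mono) auto
  also have "\<dots> \<le> 1" using e by simp
  finally show "0 \<le> m" by (simp add: m_def)
  show "m \<le> 1" using e sin_sum_bounds(1)[of x] by (simp add: m_def)
  show "m < 1" if "sin_sum x \<noteq> 0" using e that sin_sum_bounds(1)[of x] by (simp add: m_def less_le)
qed

lemma measurable_symbols [measurable]:
  "sin_sum \<in> borel_measurable borel" "weighted_sin_sum \<alpha> \<in> borel_measurable borel"
  "limit_symbol \<alpha> \<in> borel_measurable borel" "damping \<epsilon> \<in> borel_measurable borel"
proof -
  have [measurable]: "(\<lambda>x::real^'n. sin (pi * x $ i)) \<in> borel_measurable borel" for i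
    by (intro borel_measurable_continuous_onI continuous_intros)
  show [measurable]: "sin_sum \<in> borel_measurable (borel :: (real^'n) measure)"
    unfolding sin_sum_def[abs_def] by measurable
  show [measurable]: "weighted_sin_sum \<alpha> \<in> borel_measurable borel"
    unfolding weighted_sin_sum_def[abs_def] by measurable
  show "limit_symbol \<alpha> \<in> borel_measurable borel"
    unfolding limit_symbol_def[abs_def] by measurable
  show "damping \<epsilon> \<in> borel_measurable (borel :: (real^'n) measure)"
    unfolding damping_def[abs_def] by measurable
qed

text \<open>For the multipliers on \<open>\<int>\<close> and on \<open>\<int>/m\<int>\<close> alike: the heat operators approximate \<open>- R\<^sub>\<alpha>\<^sup>2\<close>
  pointwise when first \<open>K \<rightarrow> \<infinity>\<close> and then \<open>\<epsilon> \<rightarrow> 0\<close>.\<close>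

lemma limit_multiplier_bound:
  fixes M :: "(real^'n::finite \<Rightarrow> complex) \<Rightarrow> (('g::comm_ring_1)^'n \<Rightarrow> complex) \<Rightarrow> 'g^'n \<Rightarrow> complex"
  assumes p: "1 < p" and \<alpha>: "\<And>i. cmod (\<alpha> $ i) \<le> 1"
    and heat: "\<And>\<epsilon> K f. finsupp f \<Longrightarrow> M (heat_symbol \<alpha> \<epsilon> K) f = heat_operator \<alpha> \<epsilon> K f"
    and lim: "\<And>\<sigma> \<tau> f n. finsupp f \<Longrightarrow> (\<And>k. \<sigma> k \<in> borel_measurable borel) \<Longrightarrow> (\<And>k x. cmod (\<sigma> k x) \<le> 1) \<Longrightarrow>
       (\<And>x. (\<lambda>k::nat. \<sigma> k x) \<longlonglongrightarrow> \<tau> x) \<Longrightarrow> (\<lambda>k. M (\<sigma> k) f n) \<longlonglongrightarrow> M \<tau> f n"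
    and f: "finsupp f" and S: "finite S"
  shows "(\<Sum>n\<in>S. cmod (M (limit_symbol \<alpha>) f n) powr p) \<le> ((conj_max p - 1) * lp_norm p f) powr p"
proof -
  let ?C = "((conj_max p - 1) * lp_norm p f) powr p"
  \<comment> \<open>A bound on a finite sum is closed under pointwise convergence of uniformly
    bounded symbols; this serves both limits.\<close>
  have close: "(\<Sum>n\<in>S. cmod (M \<tau> f n) powr p) \<le> ?C"
    if "\<And>k. \<sigma> k \<in> borel_measurable borel" "\<And>k x. cmod (\<sigma> k x) \<le> 1" "\<And>x. (\<lambda>k::nat. \<sigma> k x) \<longlonglongrightarrow> \<tau> x"
      "\<And>k. (\<Sum>n\<in>S. cmod (M (\<sigma> k) f n) powr p) \<le> ?C" for \<sigma> \<tau>
  proof (rule LIMSEQ_le_const2)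
    show "(\<lambda>k. \<Sum>n\<in>S. cmod (M (\<sigma> k) f n) powr p) \<longlonglongrightarrow> (\<Sum>n\<in>S. cmod (M \<tau> f n) powr p)"
      using p by (intro tendsto_sum tendsto_powr' tendsto_norm lim f that tendsto_const) auto
  qed (use that in blast)
  define \<sigma> where "\<sigma> \<epsilon> x = limit_symbol \<alpha> x * of_real (damping \<epsilon> x)" for \<epsilon> x
  have meas: "\<sigma> \<epsilon> \<in> borel_measurable borel" for \<epsilon>
    unfolding \<sigma>_def[abs_def] by measurable
  have bound: "cmod (\<sigma> \<epsilon> x) \<le> 1" if "0 < \<epsilon>" "\<epsilon> < 1" for \<epsilon> x
    using mult_mono[OF norm_limit_symbol_le[OF \<alpha>, of x] damping_bounds(2)[OF that, of x]] damping_bounds(1)[OF that, of x]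
    by (simp add: \<sigma>_def norm_mult)
  have step: "(\<Sum>n\<in>S. cmod (M (\<sigma> \<epsilon>) f n) powr p) \<le> ?C" if e: "0 < \<epsilon>" "\<epsilon> \<le> 1 / 2" for \<epsilon>
  proof (rule close)
    have e1: "\<epsilon> < 1" using e by simp
    let ?m = "\<lambda>x::real^'n. 1 - 2 * \<epsilon> * sin_sum x / CARD('n)"
    note m = geometric_factor_bounds[OF e]
    have eq: "heat_symbol \<alpha> \<epsilon> K = (\<lambda>x. \<sigma> \<epsilon> x * of_real (1 - ?m x ^ (2 * K)))" for K
      using heat_symbol_eq[OF e(1) e1 \<alpha>] by (simp add: \<sigma>_def fun_eq_iff mult.assoc)
    show "heat_symbol \<alpha> \<epsilon> K \<in> borel_measurable borel" for K
      unfolding eq using meas[measurable] by measurable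
    show "cmod (heat_symbol \<alpha> \<epsilon> K x) \<le> 1" for K x
    proof -
      have "0 \<le> ?m x ^ (2 * K)" "?m x ^ (2 * K) \<le> 1" using m(1)[of x] m(2)[of x] by (auto intro: power_le_one)
      then have "cmod (of_real (1 - ?m x ^ (2 * K))) \<le> 1" unfolding norm_of_real by linarith
      then show ?thesis
        using mult_mono[OF bound[OF e(1) e1, of x]] unfolding eq norm_mult by fastforce
    qed
    show "(\<lambda>K. heat_symbol \<alpha> \<epsilon> K x) \<longlonglongrightarrow> \<sigma> \<epsilon> x" for x
    proof (cases "sin_sum x = 0")
      case True
      then have "\<sigma> \<epsilon> x = 0" by (simp add: \<sigma>_def limit_symbol_def)
      then show ?thesis by (simp add: eq)
    next
      case False
      then have "(?m x)\<^sup>2 < 1" using m(1)[of x] m(3)[of x] by (simp add: abs_square_less_1)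
      then have "(\<lambda>K. ((?m x)\<^sup>2) ^ K) \<longlonglongrightarrow> 0" by (intro LIMSEQ_power_zero) simp
      then have "(\<lambda>K. ?m x ^ (2 * K)) \<longlonglongrightarrow> 0" by (simp add: power_mult)
      then have "(\<lambda>K. \<sigma> \<epsilon> x * of_real (1 - ?m x ^ (2 * K))) \<longlonglongrightarrow> \<sigma> \<epsilon> x * of_real (1 - 0)"
        by (intro tendsto_intros)
      then show ?thesis by (simp add: eq)
    qed
    show "(\<Sum>n\<in>S. cmod (M (heat_symbol \<alpha> \<epsilon> K) f n) powr p) \<le> ?C" for K
      unfolding heat[OF f] using e by (intro heat_operator_bound p f \<alpha> S) auto
  qed
  \<comment> \<open>The shift by 2 keeps every \<open>e k\<close> within the range \<epsilon> \<le>
    1/2 of \<open>step\<close>.\<close>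
  define e where "e k = 1 / real (k + 2)" for k
  have e: "0 < e k" "e k \<le> 1 / 2" "e k < 1" for k by (simp_all add: e_def divide_simps)
  have e0: "e \<longlonglongrightarrow> 0" unfolding e_def by (rule LIMSEQ_ignore_initial_segment[OF lim_1_over_n])
  show ?thesis
  proof (rule close[of "\<lambda>k. \<sigma> (e k)"])
    show "(\<lambda>k. \<sigma> (e k) x) \<longlonglongrightarrow> limit_symbol \<alpha> x" for x
    proof -
      have "(\<lambda>k. limit_symbol \<alpha> x * of_real (2 * (1 - e k) / (2 - 2 * e k * sin_sum x / CARD('n))))
          \<longlonglongrightarrow> limit_symbol \<alpha> x * of_real (2 * (1 - 0) / (2 - 2 * 0 * sin_sum x / CARD('n)))"
        by (intro tendsto_intros e0) auto
      then show ?thesis by (simp add: \<sigma>_def damping_def)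
    qed
  qed (use meas bound step e in auto)
qed

lemma limit_multiplier_lp_bound:
  fixes M :: "(real^'n::finite \<Rightarrow> complex) \<Rightarrow> (('g::comm_ring_1)^'n \<Rightarrow> complex) \<Rightarrow> 'g^'n \<Rightarrow> complex"
  assumes p: "1 < p" and \<alpha>: "\<And>i. cmod (\<alpha> $ i) \<le> 1"
    and heat: "\<And>\<epsilon> K f. finsupp f \<Longrightarrow> M (heat_symbol \<alpha> \<epsilon> K) f = heat_operator \<alpha> \<epsilon> K f"
    and lim: "\<And>\<sigma> \<tau> f n. finsupp f \<Longrightarrow> (\<And>k. \<sigma> k \<in> borel_measurable borel) \<Longrightarrow> (\<And>k x. cmod (\<sigma> k x) \<le> 1) \<Longrightarrow>
       (\<And>x. (\<lambda>k::nat. \<sigma> k x) \<longlonglongrightarrow> \<tau> x) \<Longrightarrow> (\<lambda>k. M (\<sigma> k) f n) \<longlonglongrightarrow> M \<tau> f n"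
    and combination: "\<And>f n. finsupp f \<Longrightarrow>
       M (limit_symbol \<alpha>) f n = - (\<Sum>i\<in>UNIV. \<alpha> $ i * M (riesz2_symbol i) f n)"
    and f: "finsupp f"
  shows "(\<lambda>n. \<Sum>i\<in>UNIV. \<alpha> $ i * M (riesz2_symbol i) f n) \<in> lp_space p"
    and "lp_norm p (\<lambda>n. \<Sum>i\<in>UNIV. \<alpha> $ i * M (riesz2_symbol i) f n) \<le> (conj_max p - 1) * lp_norm p f"
proof -
  have "(\<Sum>n\<in>S. cmod (\<Sum>i\<in>UNIV. \<alpha> $ i * M (riesz2_symbol i) f n) powr p)
      \<le> ((conj_max p - 1) * lp_norm p f) powr p" if "finite S" for S
  proof -
    have "(\<Sum>n\<in>S. cmod (M (limit_symbol \<alpha>) f n) powr p) \<le> ((conj_max p - 1) * lp_norm p f) powr p"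
      by (rule limit_multiplier_bound[where M = M, OF p \<alpha> heat lim f that])
    then show ?thesis by (simp only: combination[OF f] norm_minus_cancel)
  qed
  moreover have "0 \<le> (conj_max p - 1) * lp_norm p f" using conj_max_ge_2[OF p] by simp
  ultimately show "(\<lambda>n. \<Sum>i\<in>UNIV. \<alpha> $ i * M (riesz2_symbol i) f n) \<in> lp_space p"
    "lp_norm p (\<lambda>n. \<Sum>i\<in>UNIV. \<alpha> $ i * M (riesz2_symbol i) f n) \<le> (conj_max p - 1) * lp_norm p f"
    using p by (auto intro!: lp_memI[of p "(conj_max p - 1) * lp_norm p f"])
qed

section \<open>The upper bound on the integer lattice\<close>

lemma norm_riesz2_symbol_le: "cmod (riesz2_symbol i x) \<le> 1"
proof -
  have "(sin (pi * x $ i))\<^sup>2 \<le> sin_sum x"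
    unfolding sin_sum_def by (intro member_le_sum) auto
  then show ?thesis
    using sin_sum_bounds(1)[of x]
    by (auto simp: riesz2_symbol_def sin_sum_def[symmetric] norm_divide norm_mult norm_power divide_le_eq_1)
qed

lemma measurable_riesz2_symbol [measurable]: "riesz2_symbol i \<in> borel_measurable borel"
proof -
  have [measurable]: "(\<lambda>x::real^'n. sin (pi * x $ i)) \<in> borel_measurable borel" for i
    by (intro borel_measurable_continuous_onI continuous_intros)
  show ?thesis unfolding riesz2_symbol_def[abs_def] by measurable
qed

lemma fourier_int_scale:
  assumes "finsupp f"
  shows "fourier_int (\<lambda>n. c * f n) \<xi> = c * fourier_int f \<xi>"
  using fourier_int_superset[of "{n. f n \<noteq> 0}" "\<lambda>n. c * f n"] assms
  by (auto simp: finsupp_def fourier_int_def sum_distrib_left mult.assoc)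

lemma fourier_int_add:
  assumes "finsupp f" "finsupp g"
  shows "fourier_int (\<lambda>n. f n + g n) \<xi> = fourier_int f \<xi> + fourier_int g \<xi>"
  using fourier_int_diff[OF assms(1) finsupp_cmult[OF assms(2), of "-1"]] fourier_int_scale[OF assms(2), of "-1"]
  by simp

lemma measurable_fourier_int [measurable]:
  "fourier_int f \<in> borel_measurable borel" "character n \<in> borel_measurable borel"
proof -
  have *: "character n \<in> borel_measurable borel" for n :: "int^'n"
    unfolding character_def[abs_def] by (intro borel_measurable_continuous_onI continuous_intros)
  have "continuous_on UNIV (\<lambda>\<xi>. cnj (character n \<xi>))" for n :: "int^'n"
    unfolding character_def[abs_def] by (intro continuous_intros)
  then have "(\<lambda>\<xi>. cnj (character n \<xi>)) \<in> borel_measurable borel" for n :: "int^'n"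
    by (rule borel_measurable_continuous_onI)
  then show "fourier_int f \<in> borel_measurable borel"
    unfolding fourier_int_def[abs_def] by (intro borel_measurable_sum borel_measurable_times) auto
  show "character n \<in> borel_measurable borel" by (rule *)
qed

lemma norm_fourier_int_le: "cmod (fourier_int f \<xi>) \<le> (\<Sum>n | f n \<noteq> 0. cmod (f n))"
  unfolding fourier_int_def by (rule order_trans[OF norm_sum]) (simp add: norm_mult)

lemma integrable_indicator_unit_cube: "integrable lborel (\<lambda>\<xi>. B * indicator unit_cube \<xi> :: real)"
  by (intro integrable_mult_right) (auto simp: unit_cube_def emeasure_lborel_cbox_eq intro!: integrable_real_indicator)

lemma integrable_multiplier_int:
  assumes [measurable]: "\<sigma> \<in> borel_measurable borel" and "\<And>x. cmod (\<sigma> x) \<le> 1"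
  shows "set_integrable lborel unit_cube (\<lambda>\<xi>. \<sigma> \<xi> * fourier_int f \<xi> * character n \<xi>)"
  unfolding set_integrable_def
proof (rule Bochner_Integration.integrable_bound[OF integrable_indicator_unit_cube[of "\<Sum>n | f n \<noteq> 0. cmod (f n)"]])
  have [measurable]: "unit_cube \<in> sets (borel :: (real^'n) measure)" by (simp add: unit_cube_def)
  show "(\<lambda>\<xi>. indicator unit_cube \<xi> *\<^sub>R (\<sigma> \<xi> * fourier_int f \<xi> * character n \<xi>)) \<in> borel_measurable lborel"
    by measurable
  show "AE \<xi> in lborel. norm (indicator unit_cube \<xi> *\<^sub>R (\<sigma> \<xi> * fourier_int f \<xi> * character n \<xi>))
      \<le> norm ((\<Sum>n | f n \<noteq> 0. cmod (f n)) * indicator unit_cube \<xi>)"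
    using mult_mono[OF assms(2) norm_fourier_int_le[of f]]
    by (auto simp: indicator_def norm_mult sum_nonneg)
qed

lemma multiplier_int_tendsto:
  assumes [measurable]: "\<And>k. \<sigma> k \<in> borel_measurable borel" and bound: "\<And>k x. cmod (\<sigma> k x) \<le> 1"
    and lim: "\<And>x. (\<lambda>k::nat. \<sigma> k x) \<longlonglongrightarrow> \<tau> x"
  shows "(\<lambda>k. multiplier_int (\<sigma> k) f n) \<longlonglongrightarrow> multiplier_int \<tau> f n"
  unfolding multiplier_int_def set_lebesgue_integral_def
proof (rule integral_dominated_convergence[OF _ _ integrable_indicator_unit_cube[of "\<Sum>n | f n \<noteq> 0. cmod (f n)"]])
  have [measurable]: "unit_cube \<in> sets (borel :: (real^'n) measure)" by (simp add: unit_cube_def)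
  have [measurable]: "\<tau> \<in> borel_measurable borel"
    by (rule borel_measurable_LIMSEQ_metric[OF assms(1) lim])
  show "(\<lambda>\<xi>. indicator unit_cube \<xi> *\<^sub>R (\<tau> \<xi> * fourier_int f \<xi> * character n \<xi>)) \<in> borel_measurable lborel"
    by measurable
  show "(\<lambda>\<xi>. indicator unit_cube \<xi> *\<^sub>R (\<sigma> k \<xi> * fourier_int f \<xi> * character n \<xi>)) \<in> borel_measurable lborel" for k
    by measurable
  show "AE \<xi> in lborel. (\<lambda>k. indicator unit_cube \<xi> *\<^sub>R (\<sigma> k \<xi> * fourier_int f \<xi> * character n \<xi>))
      \<longlonglongrightarrow> indicator unit_cube \<xi> *\<^sub>R (\<tau> \<xi> * fourier_int f \<xi> * character n \<xi>)"
    by (intro AE_I2 tendsto_intros lim)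
  show "AE \<xi> in lborel. norm (indicator unit_cube \<xi> *\<^sub>R (\<sigma> k \<xi> * fourier_int f \<xi> * character n \<xi>))
      \<le> (\<Sum>n | f n \<noteq> 0. cmod (f n)) * indicator unit_cube \<xi>" for k
    using mult_mono[OF bound[of k] norm_fourier_int_le[of f]]
    by (auto simp: indicator_def norm_mult sum_nonneg)
qed

lemma multiplier_int_add:
  assumes "\<sigma> \<in> borel_measurable borel" "\<And>x. cmod (\<sigma> x) \<le> 1" "finsupp f" "finsupp g"
  shows "multiplier_int \<sigma> (\<lambda>n. f n + g n) = (\<lambda>n. multiplier_int \<sigma> f n + multiplier_int \<sigma> g n)"
proof
  fix n
  have "multiplier_int \<sigma> (\<lambda>n. f n + g n) n
      = (LINT \<xi>:unit_cube|lborel. \<sigma> \<xi> * fourier_int f \<xi> * character n \<xi> + \<sigma> \<xi> * fourier_int g \<xi> * character n \<xi>)"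
    by (simp add: multiplier_int_def fourier_int_add assms algebra_simps)
  then show "multiplier_int \<sigma> (\<lambda>n. f n + g n) n = multiplier_int \<sigma> f n + multiplier_int \<sigma> g n"
    using set_integral_add(2)[OF integrable_multiplier_int integrable_multiplier_int, OF assms(1,2) assms(1,2)]
    by (simp add: multiplier_int_def)
qed

lemma multiplier_int_scale:
  assumes "finsupp f"
  shows "multiplier_int \<sigma> (\<lambda>n. c * f n) = (\<lambda>n. c * multiplier_int \<sigma> f n)"
proof
  fix n
  have "multiplier_int \<sigma> (\<lambda>n. c * f n) n = (LINT \<xi>:unit_cube|lborel. c * (\<sigma> \<xi> * fourier_int f \<xi> * character n \<xi>))"
    by (simp add: multiplier_int_def fourier_int_scale assms mult_ac)
  then show "multiplier_int \<sigma> (\<lambda>n. c * f n) n = c * multiplier_int \<sigma> f n"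
    by (simp add: multiplier_int_def)
qed

lemma multiplier_int_limit_symbol:
  fixes \<alpha> :: "complex^'n::finite"
  shows "multiplier_int (limit_symbol \<alpha>) f n = - (\<Sum>i\<in>UNIV. \<alpha> $ i * multiplier_int (riesz2_symbol i) f n)"
proof -
  let ?g = "\<lambda>i \<xi>. indicator unit_cube \<xi> *\<^sub>R (riesz2_symbol i \<xi> * fourier_int f \<xi> * character n \<xi>)"
  have int: "integrable lborel (?g i)" for i
    using integrable_multiplier_int[OF measurable_riesz2_symbol norm_riesz2_symbol_le]
    by (simp add: set_integrable_def)
  have "multiplier_int (limit_symbol \<alpha>) f n = (LINT \<xi>|lborel. - (\<Sum>i\<in>UNIV. \<alpha> $ i * ?g i \<xi>))"
    unfolding multiplier_int_def set_lebesgue_integral_def limit_symbol_eq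
    by (intro Bochner_Integration.integral_cong refl) (simp add: sum_distrib_right scaleR_sum_right mult.assoc scaleR_conv_of_real sum_distrib_left mult.left_commute[of "of_real _"])
  also have "\<dots> = - (\<Sum>i\<in>UNIV. \<alpha> $ i * (LINT \<xi>|lborel. ?g i \<xi>))"
  proof -
    have "(LINT \<xi>|lborel. - (\<Sum>i\<in>UNIV. \<alpha> $ i * g i \<xi>)) = - (\<Sum>i\<in>UNIV. \<alpha> $ i * (LINT \<xi>|lborel. g i \<xi>))"
      if "\<And>i. integrable lborel (g i)" for g :: "'n \<Rightarrow> real^'n \<Rightarrow> complex"
      using that by (simp add: Bochner_Integration.integral_sum)
    from this[of ?g, OF int] show ?thesis .
  qed
  finally show ?thesis by (simp add: multiplier_int_def set_lebesgue_integral_def)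
qed

lemma multiplier_int_heat_symbol:
  assumes "finsupp f"
  shows "multiplier_int (heat_symbol \<alpha> \<epsilon> K) f = heat_operator \<alpha> \<epsilon> K f"
proof -
  have diff2: "fourier_int (second_difference i f) \<xi> = of_real (- 4 * (sin (pi * \<xi> $ i))\<^sup>2) * fourier_int f \<xi>"
    if "finsupp f" for i and f :: "int^'n \<Rightarrow> complex" and \<xi>
    by (simp add: fourier_int_deriv_plus fourier_int_deriv_minus finsupp_deriv that
        mult.assoc[symmetric] deriv_plus_minus_symbol)
  have "fourier_int (heat_operator \<alpha> \<epsilon> K f) \<xi> = heat_symbol \<alpha> \<epsilon> K \<xi> * fourier_int f \<xi>" for \<xi>
    by (rule transform_heat_operator[where \<Phi> = "\<lambda>f. fourier_int f \<xi>"])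
       (simp_all only: fourier_int_add fourier_int_scale diff2 assms)
  then have "multiplier_int (heat_symbol \<alpha> \<epsilon> K) f = multiplier_int (\<lambda>_. 1) (heat_operator \<alpha> \<epsilon> K f)"
    by (simp add: multiplier_int_def fun_eq_iff)
  then show ?thesis by (simp add: multiplier_int_one finsupp_heat_operator assms)
qed

lemma riesz2_combination_int_bound:
  fixes f :: "int^'n::finite \<Rightarrow> complex"
  assumes p: "1 < p" and \<alpha>: "\<And>i. cmod (\<alpha> $ i) \<le> 1" and f: "finsupp f"
  shows "(\<lambda>n. \<Sum>i\<in>UNIV. \<alpha> $ i * multiplier_int (riesz2_symbol i) f n) \<in> lp_space p"
    and "lp_norm p (\<lambda>n. \<Sum>i\<in>UNIV. \<alpha> $ i * multiplier_int (riesz2_symbol i) f n) \<le> (conj_max p - 1) * lp_norm p f"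
  using limit_multiplier_lp_bound[OF p \<alpha> multiplier_int_heat_symbol multiplier_int_tendsto multiplier_int_limit_symbol f]
  by blast+

text \<open>The special case \<alpha> = \<open>axis i 1\<close>. It is what allows each transform to
  be extended separately, as \<open>riesz2_alpha_int\<close> demands.\<close>

lemma riesz2_int_bound:
  fixes f :: "int^'n::finite \<Rightarrow> complex"
  assumes p: "1 < p" and f: "finsupp f"
  shows "multiplier_int (riesz2_symbol i) f \<in> lp_space p"
    and "lp_norm p (multiplier_int (riesz2_symbol i) f) \<le> (conj_max p - 1) * lp_norm p f"
proof -
  have "(\<Sum>k\<in>UNIV. (axis i 1 :: complex^'n) $ k * multiplier_int (riesz2_symbol k) f n) = multiplier_int (riesz2_symbol i) f n" for n
    by (simp add: axis_def if_distrib[of "\<lambda>a. a * _"] cong: if_cong)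
  then show "multiplier_int (riesz2_symbol i) f \<in> lp_space p"
    "lp_norm p (multiplier_int (riesz2_symbol i) f) \<le> (conj_max p - 1) * lp_norm p f"
    using riesz2_combination_int_bound[OF p, of "axis i 1" f] f by (auto simp: axis_def)
qed

lemma riesz2_alpha_int_bounded:
  fixes \<alpha> :: "complex^'n::finite"
  assumes p: "1 < p" and \<alpha>: "\<And>i. cmod (\<alpha> $ i) \<le> 1"
  shows "lp_bounded p (riesz2_alpha_int p \<alpha>)"
    and "f \<in> lp_space p \<Longrightarrow> lp_norm p (riesz2_alpha_int p \<alpha> f) \<le> (conj_max p - 1) * lp_norm p f"
proof -
  have eq: "riesz2_alpha_int p \<alpha> = (\<lambda>f n. \<Sum>i\<in>UNIV. \<alpha> $ i * lp_extend p (multiplier_int (riesz2_symbol i)) f n)"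
    by (simp add: riesz2_alpha_int_def[abs_def] riesz2_int_def)
  have C: "0 \<le> conj_max p - 1" using conj_max_ge_2[OF p] by simp
  note * = lp_extend_combination_bounded[of p "conj_max p - 1" "\<lambda>i. multiplier_int (riesz2_symbol i)" "\<lambda>i. \<alpha> $ i",
      OF less_imp_le[OF p] C multiplier_int_add[OF measurable_riesz2_symbol norm_riesz2_symbol_le] multiplier_int_scale
      riesz2_int_bound[OF p] riesz2_combination_int_bound(2)[OF p \<alpha>]]
  show "lp_bounded p (riesz2_alpha_int p \<alpha>)"
    unfolding eq by (rule *(1))
  show "f \<in> lp_space p \<Longrightarrow> lp_norm p (riesz2_alpha_int p \<alpha> f) \<le> (conj_max p - 1) * lp_norm p f"
    unfolding eq by (rule *(2))
qed

lemma riesz2_alpha_int_finsupp: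
  fixes f :: "int^'n::finite \<Rightarrow> complex"
  assumes p: "1 < p" and f: "finsupp f"
  shows "riesz2_alpha_int p \<alpha> f = (\<lambda>n. \<Sum>i\<in>UNIV. \<alpha> $ i * multiplier_int (riesz2_symbol i) f n)"
proof -
  have C: "0 \<le> conj_max p - 1" using conj_max_ge_2[OF p] by simp
  have diff: "multiplier_int (riesz2_symbol i) (\<lambda>n. f n - g n) = (\<lambda>n. multiplier_int (riesz2_symbol i) f n - multiplier_int (riesz2_symbol i) g n)"
    if "finsupp f" "finsupp g" for i :: 'n and f g
    using multiplier_int_add[OF measurable_riesz2_symbol norm_riesz2_symbol_le that(1) finsupp_cmult[OF that(2), of "-1"], of i]
      multiplier_int_scale[OF that(2), of "riesz2_symbol i" "-1"] by simp
  have "lp_extend p (multiplier_int (riesz2_symbol i)) f = multiplier_int (riesz2_symbol i) f" for i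
    by (rule lp_extend_finsupp[OF less_imp_le[OF p] C diff riesz2_int_bound[OF p] f])
  then show ?thesis by (simp add: riesz2_alpha_int_def[abs_def] riesz2_int_def)
qed

section \<open>The upper bound on cyclic groups\<close>

lemma finsupp_cyc: "finsupp (f :: ('m::nontriv mod_ring)^'n::finite \<Rightarrow> complex)"
  by (simp add: finsupp_def)

lemma fourier_cyc_add: "fourier_cyc (\<lambda>n. f n + g n) \<xi> = fourier_cyc f \<xi> + fourier_cyc g \<xi>"
  by (simp add: fourier_cyc_def distrib_right sum.distrib)

lemma fourier_cyc_scale: "fourier_cyc (\<lambda>n. c * f n) \<xi> = c * fourier_cyc f \<xi>"
  by (simp add: fourier_cyc_def sum_distrib_left mult.assoc)

lemma multiplier_cyc_heat_symbol:
  fixes f :: "('m::nontriv mod_ring)^'n::finite \<Rightarrow> complex"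
  shows "multiplier_cyc (heat_symbol \<alpha> \<epsilon> K) f = heat_operator \<alpha> \<epsilon> K f"
proof -
  have diff2: "fourier_cyc (second_difference i f) \<xi> = of_real (- 4 * (sin (pi * cyc_freq \<xi> $ i))\<^sup>2) * fourier_cyc f \<xi>"
    for i and f :: "('m mod_ring)^'n \<Rightarrow> complex" and \<xi>
    unfolding multiplier_cyc_deriv[symmetric] fourier_multiplier_cyc
    by (simp only: mult.assoc[symmetric] deriv_plus_minus_symbol)
  have "fourier_cyc (heat_operator \<alpha> \<epsilon> K f) \<xi> = heat_symbol \<alpha> \<epsilon> K (cyc_freq \<xi>) * fourier_cyc f \<xi>" for \<xi>
    by (rule transform_heat_operator[where \<Phi> = "\<lambda>f. fourier_cyc f \<xi>"])
       (simp_all only: fourier_cyc_add fourier_cyc_scale diff2 finsupp_cyc)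
  then have "multiplier_cyc (heat_symbol \<alpha> \<epsilon> K) f = multiplier_cyc (\<lambda>_. 1) (heat_operator \<alpha> \<epsilon> K f)"
    by (simp add: multiplier_cyc_def fun_eq_iff)
  then show ?thesis by (simp add: multiplier_cyc_one)
qed

lemma multiplier_cyc_tendsto:
  assumes "\<And>x. (\<lambda>k::nat. \<sigma> k x) \<longlonglongrightarrow> \<tau> x"
  shows "(\<lambda>k. multiplier_cyc (\<sigma> k) f n) \<longlonglongrightarrow> multiplier_cyc \<tau> f n"
  unfolding multiplier_cyc_def by (intro tendsto_intros assms) auto

lemma multiplier_cyc_limit_symbol:
  "multiplier_cyc (limit_symbol \<alpha>) f n = - (\<Sum>i\<in>UNIV. \<alpha> $ i * multiplier_cyc (riesz2_symbol i) f n)"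
proof -
  let ?h = "\<lambda>i \<xi>. riesz2_symbol i (cyc_freq \<xi>) * fourier_cyc f \<xi> * character (cyc_rep n) (cyc_freq \<xi>)"
  have "(\<Sum>\<xi>\<in>UNIV. limit_symbol \<alpha> (cyc_freq \<xi>) * fourier_cyc f \<xi> * character (cyc_rep n) (cyc_freq \<xi>))
      = - (\<Sum>\<xi>\<in>UNIV. \<Sum>i\<in>UNIV. \<alpha> $ i * ?h i \<xi>)"
    by (simp add: limit_symbol_eq sum_distrib_right sum_negf mult.assoc)
  also have "(\<Sum>\<xi>\<in>UNIV. \<Sum>i\<in>UNIV. \<alpha> $ i * ?h i \<xi>) = (\<Sum>i\<in>UNIV. \<alpha> $ i * (\<Sum>\<xi>\<in>UNIV. ?h i \<xi>))"
    by (subst sum.swap) (simp add: sum_distrib_left)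
  finally show ?thesis
    by (simp add: multiplier_cyc_def sum_divide_distrib[symmetric])
qed

lemma riesz2_alpha_cyc_bounded:
  fixes \<alpha> :: "complex^'n::finite"
  assumes p: "1 < p" and \<alpha>: "\<And>i. cmod (\<alpha> $ i) \<le> 1"
  defines "R \<equiv> riesz2_alpha_cyc \<alpha> :: (('m::nontriv mod_ring)^'n \<Rightarrow> complex) \<Rightarrow> (('m mod_ring)^'n \<Rightarrow> complex)"
  shows "lp_bounded p R" and "lp_norm p (R f) \<le> (conj_max p - 1) * lp_norm p f"
proof -
  have eq: "R f = (\<lambda>n. \<Sum>i\<in>UNIV. \<alpha> $ i * multiplier_cyc (riesz2_symbol i) f n)" for f
    by (simp add: R_def riesz2_alpha_cyc_def[abs_def] riesz2_cyc_def)
  show bound: "lp_norm p (R f) \<le> (conj_max p - 1) * lp_norm p f" for f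
    unfolding eq
    by (rule limit_multiplier_lp_bound(2)[OF p \<alpha> multiplier_cyc_heat_symbol multiplier_cyc_tendsto multiplier_cyc_limit_symbol finsupp_cyc])
  have "R (\<lambda>n. f n + g n) = (\<lambda>n. R f n + R g n)" for f g
    by (simp add: eq multiplier_cyc_def fourier_cyc_add distrib_left distrib_right sum.distrib add_divide_distrib fun_eq_iff)
  moreover have "R (\<lambda>n. c * f n) = (\<lambda>n. c * R f n)" for c f
    by (simp add: eq multiplier_cyc_def fourier_cyc_scale sum_distrib_left sum_divide_distrib fun_eq_iff mult_ac)
  ultimately show "lp_bounded p R"
    unfolding lp_bounded_def using bound finsupp_lp[OF finsupp_cyc] by blast
qed

section \<open>Sharpness\<close>

text \<open>Only midpoint concavity is available, so the starting point is pulled towards (0, S) by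
  repeated halving. Dyadic weights suffice, as only step lengths tending to 0 are needed.\<close>

lemma zigzag_dyadic:
  fixes W :: "real \<Rightarrow> real \<Rightarrow> real"
  assumes mid: "\<And>x y t. (W (x + t) (y - t) + W (x - t) (y + t)) / 2 \<le> W x y"
  shows "(1 - 1 / 2 ^ k) * W 0 S + 1 / 2 ^ k * W \<tau> (S - \<tau>) \<le> W (\<tau> / 2 ^ k) (S - \<tau> / 2 ^ k)"
proof (induction k)
  case (Suc k)
  let ?d = "\<tau> / 2 ^ Suc k"
  have "(W (?d + ?d) (S - ?d - ?d) + W (?d - ?d) (S - ?d + ?d)) / 2 \<le> W ?d (S - ?d)"
    by (rule mid)
  then have "(W (\<tau> / 2 ^ k) (S - \<tau> / 2 ^ k) + W 0 S) / 2 \<le> W ?d (S - ?d)"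
    by simp
  moreover have "(1 - 1 / 2 ^ Suc k) * W 0 S + 1 / 2 ^ Suc k * W \<tau> (S - \<tau>)
      = ((1 - 1 / 2 ^ k) * W 0 S + 1 / 2 ^ k * W \<tau> (S - \<tau>) + W 0 S) / 2"
    by (simp add: field_simps)
  ultimately show ?case using Suc by simp
qed simp

text \<open>At a point \<open>(0, 1)\<close> concavity in the direction \<open>(1, 1)\<close>, followed by the direction \<open>(1, -1)\<close>
  down to the ray through \<open>(1/p, 1 - 1/p)\<close>, gives an inequality whose first order term in the step
  length must be nonnegative; with this ray the unknown value \<open>W 0 1\<close> cancels.\<close>

lemma zigzag_concave_majorant:
  fixes W V :: "real \<Rightarrow> real \<Rightarrow> real"
  assumes p: "1 < p"
    and mid1: "\<And>x y t. (W (x + t) (y + t) + W (x - t) (y - t)) / 2 \<le> W x y"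
    and mid2: "\<And>x y t. (W (x + t) (y - t) + W (x - t) (y + t)) / 2 \<le> W x y"
    and hom: "\<And>s. 0 < s \<Longrightarrow> s powr p * W 0 1 \<le> W 0 s"
    and sym: "\<And>x y. W x y \<le> W (- x) y"
    and major: "\<And>x y. V x y \<le> W x y"
    and cont: "isCont (V (1 / p)) (1 - 1 / p)"
  shows "V (1 / p) (1 - 1 / p) \<le> 0"
proof -
  define \<tau> where "\<tau> = 1 / p"
  define \<kappa> where "\<kappa> = W 0 1"
  define d where "d k = \<tau> / 2 ^ k" for k :: nat
  have \<tau>: "0 < \<tau>" using p by (simp add: \<tau>_def)
  have d: "0 < d k" for k using \<tau> by (simp add: d_def)
  have d0: "d \<longlonglongrightarrow> 0"
    unfolding d_def[abs_def] using tendsto_mult[OF tendsto_const LIMSEQ_power_zero[of "1 / 2 :: real"], of \<tau>]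
    by (simp add: power_divide)
  have filt: "filterlim d (at 0) sequentially"
    using d0 d by (simp add: filterlim_at less_imp_neq[symmetric] always_eventually)
  have step: "\<kappa> * (((1 + 2 * d k) powr p - 1) / d k * (1 - d k / \<tau>) - 2 / \<tau>)
      + (V \<tau> (1 + 2 * d k - \<tau>) + V \<tau> (1 - \<tau>)) / \<tau> \<le> 0" for k
  proof -
    define w where "w = d k / \<tau>"
    have w: "w = 1 / 2 ^ k" "0 \<le> w" "w \<le> 1" using \<tau> by (simp_all add: w_def d_def)
    \<comment> \<open>For S = 1 + 2d this reaches (d, 1 + d) from (0, 1 + 2d), and for S = 1 it
      reaches (d, 1 - d) from (0, 1); \<open>sym\<close> then moves the second point to (- d, 1 -
      d), opposite to the first with respect to (0, 1).\<close>
    have line: "(1 - w) * W 0 S + w * W \<tau> (S - \<tau>) \<le> W (d k) (S - d k)" for S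
      using zigzag_dyadic[of W k S \<tau>, OF mid2] by (simp add: w d_def)
    have "(1 - w) * ((1 + 2 * d k) powr p * \<kappa>) + w * V \<tau> (1 + 2 * d k - \<tau>) \<le> W (d k) (1 + d k)"
    proof -
      have "(1 - w) * ((1 + 2 * d k) powr p * \<kappa>) + w * V \<tau> (1 + 2 * d k - \<tau>)
          \<le> (1 - w) * W 0 (1 + 2 * d k) + w * W \<tau> (1 + 2 * d k - \<tau>)"
        unfolding \<kappa>_def using w d[of k] by (intro add_mono mult_left_mono hom major) auto
      also have "\<dots> \<le> W (d k) (1 + 2 * d k - d k)" by (rule line)
      finally show ?thesis by (simp add: add.commute)
    qed
    moreover have "(1 - w) * \<kappa> + w * V \<tau> (1 - \<tau>) \<le> W (- d k) (1 - d k)"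
    proof -
      have "(1 - w) * \<kappa> + w * V \<tau> (1 - \<tau>) \<le> (1 - w) * W 0 1 + w * W \<tau> (1 - \<tau>)"
        unfolding \<kappa>_def using w by (intro add_mono mult_left_mono major) auto
      also have "\<dots> \<le> W (d k) (1 - d k)" by (rule line)
      also have "\<dots> \<le> W (- d k) (1 - d k)" by (rule sym)
      finally show ?thesis .
    qed
    moreover have "(W (d k) (1 + d k) + W (- d k) (1 - d k)) / 2 \<le> \<kappa>"
      using mid1[of 0 "d k" 1] by (simp add: \<kappa>_def)
    moreover have "X + Y - 2 * z \<le> 0" if "X \<le> u" "Y \<le> v" "(u + v) / 2 \<le> z" for X Y u v z :: real
      using that by simp
    ultimately have "(1 - w) * ((1 + 2 * d k) powr p * \<kappa>) + w * V \<tau> (1 + 2 * d k - \<tau>)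
        + ((1 - w) * \<kappa> + w * V \<tau> (1 - \<tau>)) - 2 * \<kappa> \<le> 0" by blast
    then have "((1 - w) * ((1 + 2 * d k) powr p * \<kappa>) + w * V \<tau> (1 + 2 * d k - \<tau>)
        + ((1 - w) * \<kappa> + w * V \<tau> (1 - \<tau>)) - 2 * \<kappa>) / d k \<le> 0"
      using d[of k] by (simp add: divide_le_0_iff)
    also have "((1 - w) * ((1 + 2 * d k) powr p * \<kappa>) + w * V \<tau> (1 + 2 * d k - \<tau>)
        + ((1 - w) * \<kappa> + w * V \<tau> (1 - \<tau>)) - 2 * \<kappa>) / d k
      = \<kappa> * (((1 + 2 * d k) powr p - 1) / d k * (1 - d k / \<tau>) - 2 / \<tau>)
        + (V \<tau> (1 + 2 * d k - \<tau>) + V \<tau> (1 - \<tau>)) / \<tau>"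
    proof -
      have "((1 - D / t) * (P * K) + D / t * v1 + ((1 - D / t) * K + D / t * v2) - 2 * K) / D
          = K * ((P - 1) / D * (1 - D / t) - 2 / t) + (v1 + v2) / t"
        if "D \<noteq> 0" "t \<noteq> 0" for D t P K v1 v2 :: real
        using that by (simp add: divide_simps) (simp add: algebra_simps)
      then show ?thesis unfolding w_def using d[of k] \<tau> by simp
    qed
    finally show ?thesis .
  qed
  have "((\<lambda>t. (1 + 2 * t) powr p) has_real_derivative p * (1 + 2 * 0) powr (p - of_nat 1) * 2) (at 0)"
    by (rule DERIV_fun_powr) (auto intro!: derivative_eq_intros)
  then have "(\<lambda>k. ((1 + 2 * (0 + d k)) powr p - (1 + 2 * 0) powr p) / d k) \<longlonglongrightarrow> p * (1 + 2 * 0) powr (p - of_nat 1) * 2"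
    unfolding DERIV_def by (rule filterlim_compose[OF _ filt])
  then have quot: "(\<lambda>k. ((1 + 2 * d k) powr p - 1) / d k) \<longlonglongrightarrow> 2 * p" by (simp add: mult.commute)
  have "(\<lambda>k. 1 + 2 * d k - \<tau>) \<longlonglongrightarrow> 1 + 2 * 0 - \<tau>" by (intro tendsto_intros d0)
  then have "(\<lambda>k. 1 + 2 * d k - \<tau>) \<longlonglongrightarrow> 1 - \<tau>" by simp
  from isCont_tendsto_compose[OF cont[folded \<tau>_def] this]
  have V: "(\<lambda>k. V \<tau> (1 + 2 * d k - \<tau>)) \<longlonglongrightarrow> V \<tau> (1 - \<tau>)" .
  \<comment> \<open>In the limit the coefficient of \<kappa> is 2p - 2/\<tau>, which is 0 for \<tau>
    = 1/p.\<close>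
  have "(\<lambda>k. \<kappa> * (((1 + 2 * d k) powr p - 1) / d k * (1 - d k / \<tau>) - 2 / \<tau>)
      + (V \<tau> (1 + 2 * d k - \<tau>) + V \<tau> (1 - \<tau>)) / \<tau>)
    \<longlonglongrightarrow> \<kappa> * (2 * p * (1 - 0 / \<tau>) - 2 / \<tau>) + (V \<tau> (1 - \<tau>) + V \<tau> (1 - \<tau>)) / \<tau>"
    using \<tau> by (intro tendsto_intros quot V d0) auto
  then have "\<kappa> * (2 * p * (1 - 0 / \<tau>) - 2 / \<tau>) + (V \<tau> (1 - \<tau>) + V \<tau> (1 - \<tau>)) / \<tau> \<le> 0"
    by (rule LIMSEQ_le_const2) (use step in blast)
  then have "(V \<tau> (1 - \<tau>) + V \<tau> (1 - \<tau>)) / \<tau> \<le> 0" by (simp add: \<tau>_def)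
  then show ?thesis using \<tau> by (simp add: divide_le_0_iff \<tau>_def[symmetric])
qed

section \<open>Means of periodic functions and their splicing\<close>

definition lattice_periodic :: "int \<Rightarrow> (int \<Rightarrow> int \<Rightarrow> real) \<Rightarrow> bool" where
  "lattice_periodic M Q \<longleftrightarrow> 0 < M \<and> (\<forall>i j. Q (i + M) j = Q i j \<and> Q i (j + M) = Q i j)"

abbreviation diff2_fst :: "(int \<Rightarrow> int \<Rightarrow> real) \<Rightarrow> int \<Rightarrow> int \<Rightarrow> real" where
  "diff2_fst Q i j \<equiv> Q (i + 1) j + Q (i - 1) j - 2 * Q i j"

abbreviation diff2_snd :: "(int \<Rightarrow> int \<Rightarrow> real) \<Rightarrow> int \<Rightarrow> int \<Rightarrow> real" where
  "diff2_snd Q i j \<equiv> Q i (j + 1) + Q i (j - 1) - 2 * Q i j"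

definition period_mean :: "int \<Rightarrow> (int \<Rightarrow> int \<Rightarrow> real) \<Rightarrow> real" where
  "period_mean M g = (\<Sum>i\<in>{0..<M}. \<Sum>j\<in>{0..<M}. g i j) / (real_of_int M)\<^sup>2"

lemma periodic_mult:
  fixes f :: "int \<Rightarrow> 'a"
  assumes "\<And>i. f (i + M) = f i" "0 \<le> L"
  shows "f (i + L * M) = f i"
  using assms(2)
proof (induction L rule: int_ge_induct)
  case (step L)
  have "f (i + (L + 1) * M) = f ((i + L * M) + M)" by (simp add: algebra_simps)
  then show ?case using step assms(1) by simp
qed simp

lemma lattice_periodic_mult:
  assumes "lattice_periodic M Q" "0 < L"
  shows "lattice_periodic (L * M) Q"
  using periodic_mult[of "\<lambda>i. Q i j" M L for j] periodic_mult[of "\<lambda>j. Q i j" M L for i] assms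
  by (simp add: lattice_periodic_def fun_eq_iff)

lemma sum_shift_int:
  fixes f :: "int \<Rightarrow> 'a::comm_monoid_add"
  shows "(\<Sum>i\<in>{a + c..<b + c}. f i) = (\<Sum>i\<in>{a..<b}. f (i + c))"
  by (rule sum.reindex_bij_witness[of _ "\<lambda>i. i + c" "\<lambda>i. i - c"]) auto

lemma sum_period_mult:
  fixes f :: "int \<Rightarrow> real"
  assumes per: "\<And>i. f (i + M) = f i" and "0 \<le> M" "0 \<le> L"
  shows "(\<Sum>i\<in>{0..<L * M}. f i) = L * (\<Sum>i\<in>{0..<M}. f i)"
  using assms(3)
proof (induction L rule: int_ge_induct)
  case (step L)
  have "0 \<le> L * M" using step assms by simp
  then have "{0..<(L + 1) * M} = {0..<L * M} \<union> {0 + L * M..<M + L * M}"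
    using assms(2) by (auto simp: algebra_simps)
  then have "(\<Sum>i\<in>{0..<(L + 1) * M}. f i) = (\<Sum>i\<in>{0..<L * M}. f i) + (\<Sum>i\<in>{0 + L * M..<M + L * M}. f i)"
    by (simp only:) (rule sum.union_disjoint, auto)
  also have "(\<Sum>i\<in>{0 + L * M..<M + L * M}. f i) = (\<Sum>i\<in>{0..<M}. f i)"
    unfolding sum_shift_int using periodic_mult[of f M L] per step by simp
  finally show ?case using step.IH by (simp add: algebra_simps)
qed simp

lemma period_mean_mult:
  assumes "\<And>i j. g (i + M) j = g i j" "\<And>i j. g i (j + M) = g i j" and "0 < M" "0 < L"
  shows "period_mean (L * M) g = period_mean M g"
proof -
  have "(\<Sum>i\<in>{0..<L * M}. \<Sum>j\<in>{0..<L * M}. g i j) = L * (L * (\<Sum>i\<in>{0..<M}. \<Sum>j\<in>{0..<M}. g i j))"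
    using assms by (simp add: sum_period_mult sum_distrib_left[symmetric])
  then show ?thesis using assms(3,4) by (simp add: period_mean_def power2_eq_square)
qed

lemma lattice_periodic_bounded:
  assumes "lattice_periodic M Q"
  obtains B where "0 \<le> B" "\<And>i j. \<bar>Q i j\<bar> \<le> B"
proof
  let ?S = "{0..<M} \<times> {0..<M}"
  let ?B = "\<Sum>(i, j)\<in>?S. \<bar>Q i j\<bar>"
  show "0 \<le> ?B" by (intro sum_nonneg) auto
  fix i j
  have M: "0 < M" using assms by (simp add: lattice_periodic_def)
  have mod: "f (i mod M) = f i" if per: "\<And>i. f (i + M) = f i" for f :: "int \<Rightarrow> real" and i
  proof (cases "0 \<le> i div M")
    case True
    then show ?thesis using periodic_mult[of f M "i div M" "i mod M", OF per] by simp
  next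
    case False
    then have "f (i + (- (i div M)) * M) = f i" by (intro periodic_mult per) simp
    then show ?thesis by (simp add: minus_div_mult_eq_mod)
  qed
  have "Q (i mod M) (j mod M) = Q i j"
    using mod[of "\<lambda>i. Q i (j mod M)" i] mod[of "\<lambda>j. Q i j" j] assms by (simp add: lattice_periodic_def)
  moreover have "(i mod M, j mod M) \<in> ?S" using M by simp
  then have "\<bar>Q (i mod M) (j mod M)\<bar> \<le> ?B"
    using member_le_sum[of "(i mod M, j mod M)" ?S "\<lambda>(i, j). \<bar>Q i j\<bar>"] by auto
  ultimately show "\<bar>Q i j\<bar> \<le> ?B" by simp
qed

text \<open>The pair (a, b) plays the part of the constant second differences of a quadratic
  polynomial, and Q is a periodic perturbation of it. Since only second differences enter, the
  polynomial itself does not appear.\<close>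

definition attained :: "(real \<Rightarrow> real \<Rightarrow> real) \<Rightarrow> real \<Rightarrow> real \<Rightarrow> real set" where
  "attained \<Phi> a b = {period_mean M (\<lambda>i j. \<Phi> (a + diff2_fst Q i j) (b + diff2_snd Q i j)) | M Q. lattice_periodic M Q}"

lemma attainedI:
  "lattice_periodic M Q \<Longrightarrow> v = period_mean M (\<lambda>i j. \<Phi> (a + diff2_fst Q i j) (b + diff2_snd Q i j))
    \<Longrightarrow> v \<in> attained \<Phi> a b"
  unfolding attained_def by blast

definition locally_bounded :: "(real \<Rightarrow> real \<Rightarrow> real) \<Rightarrow> bool" where
  "locally_bounded \<Phi> \<longleftrightarrow> (\<forall>R. \<exists>B. \<forall>x y. \<bar>x\<bar> \<le> R \<longrightarrow> \<bar>y\<bar> \<le> R \<longrightarrow> \<bar>\<Phi> x y\<bar> \<le> B)"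

text \<open>The profile whose second difference is \<open>d\<close> and \<open>- d\<close> on alternate strips of width \<open>K\<close>. Placing
  test functions for \<open>(a + d, b)\<close> and \<open>(a - d, b)\<close> on these strips gives one for \<open>(a, b)\<close>, up to
  an error from the edges of the strips.\<close>

definition sawtooth :: "int \<Rightarrow> real \<Rightarrow> int \<Rightarrow> real" where
  "sawtooth K d i = (let r = i mod (2 * K) in
     if r \<le> K then d * real_of_int (r * (r - K)) / 2 else - d * real_of_int ((r - K) * (r - 2 * K)) / 2)"

lemma sawtooth_values:
  assumes "0 < K"
  shows "0 \<le> i \<Longrightarrow> i \<le> K \<Longrightarrow> sawtooth K d i = d * real_of_int (i * (i - K)) / 2"
    and "K \<le> i \<Longrightarrow> i \<le> 2 * K \<Longrightarrow> sawtooth K d i = - d * real_of_int ((i - K) * (i - 2 * K)) / 2"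
    and "sawtooth K d (- 1) = d * real_of_int (K - 1) / 2"
    and "sawtooth K d (i + 2 * K) = sawtooth K d i"
proof -
  show "sawtooth K d i = d * real_of_int (i * (i - K)) / 2" if "0 \<le> i" "i \<le> K"
    using that assms by (simp add: sawtooth_def mod_pos_pos_trivial)
  show "sawtooth K d i = - d * real_of_int ((i - K) * (i - 2 * K)) / 2" if "K \<le> i" "i \<le> 2 * K"
  proof (cases "i = 2 * K")
    case True
    then show ?thesis using assms by (simp add: sawtooth_def)
  next
    case False
    then show ?thesis using that assms by (cases "i = K") (simp_all add: sawtooth_def mod_pos_pos_trivial)
  qed
  have "(- 1) mod (2 * K) = 2 * K - 1" using assms by (simp add: zmod_minus1)
  then have "sawtooth K d (- 1) = (if 2 * K - 1 \<le> K then d * real_of_int ((2 * K - 1) * (2 * K - 1 - K)) / 2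
      else - d * real_of_int ((2 * K - 1 - K) * (2 * K - 1 - 2 * K)) / 2)"
    unfolding sawtooth_def Let_def by (simp only:)
  then show "sawtooth K d (- 1) = d * real_of_int (K - 1) / 2"
    using assms by (cases "K = 1") (simp_all add: right_diff_distrib)
  show "sawtooth K d (i + 2 * K) = sawtooth K d i" by (simp add: sawtooth_def)
qed

text \<open>The two parabolas vanish at the multiples of K and continue each other oddly there, so
  the second difference at a joint is 0. Thus the joints create no large values, however wide the
  strips are.\<close>

lemma sawtooth_diff2:
  fixes d :: real
  assumes K: "0 < K"
  defines "D \<equiv> \<lambda>i. sawtooth K d (i + 1) + sawtooth K d (i - 1) - 2 * sawtooth K d i"
  shows "1 \<le> i \<Longrightarrow> i \<le> K - 1 \<Longrightarrow> D i = d" "K + 1 \<le> i \<Longrightarrow> i \<le> 2 * K - 1 \<Longrightarrow> D i = - d"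
    and "0 \<le> i \<Longrightarrow> i < 2 * K \<Longrightarrow> \<bar>D i\<bar> \<le> \<bar>d\<bar>"
proof -
  show 1: "D i = d" if "1 \<le> i" "i \<le> K - 1" for i
    using that K unfolding D_def by (simp add: sawtooth_values(1) field_simps)
  show 2: "D i = - d" if "K + 1 \<le> i" "i \<le> 2 * K - 1" for i
    using that K unfolding D_def by (simp add: sawtooth_values(2) field_simps)
  have 3: "D 0 = 0"
    using K unfolding D_def by (simp add: sawtooth_values(1,3) field_simps)
  have 4: "D K = 0"
  proof -
    have "sawtooth K d (K + 1) = - d * real_of_int (1 - K) / 2" "sawtooth K d (K - 1) = d * real_of_int (1 - K) / 2"
      "sawtooth K d K = 0"
      using sawtooth_values(2)[OF K, of "K + 1" d] sawtooth_values(1)[OF K, of "K - 1" d] sawtooth_values(1)[OF K, of K d] K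
      by simp_all
    then show ?thesis unfolding D_def by (simp add: field_simps)
  qed
  show "\<bar>D i\<bar> \<le> \<bar>d\<bar>" if "0 \<le> i" "i < 2 * K"
  proof -
    have "i = 0 \<or> i = K \<or> (1 \<le> i \<and> i \<le> K - 1) \<or> (K + 1 \<le> i \<and> i \<le> 2 * K - 1)"
      using that by presburger
    then show ?thesis using 1[of i] 2[of i] 3 4 by auto
  qed
qed

text \<open>K is a multiple of the common period M, so each strip carries whole periods. Apart from
  the two boundary columns of each strip, all second differences are the intended ones. Four columns
  with error at most 4KC each, among (2K)^2 lattice points, cost at most 4C/K in the mean.\<close>

lemma attained_splice:
  assumes \<Phi>: "locally_bounded \<Phi>" and v1: "v1 \<in> attained \<Phi> (a + d) b" and v2: "v2 \<in> attained \<Phi> (a - d) b"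
    and \<epsilon>: "0 < \<epsilon>"
  shows "\<exists>v\<in>attained \<Phi> a b. (v1 + v2) / 2 - \<epsilon> \<le> v"
proof -
  define g where "g a Q i j = \<Phi> (a + diff2_fst Q i j) (b + diff2_snd Q i j)" for a Q i j
  obtain M1 Q1 where Q1: "lattice_periodic M1 Q1" "v1 = period_mean M1 (g (a + d) Q1)"
    using v1 by (auto simp: attained_def g_def[abs_def])
  obtain M2 Q2 where Q2: "lattice_periodic M2 Q2" "v2 = period_mean M2 (g (a - d) Q2)"
    using v2 by (auto simp: attained_def g_def[abs_def])
  have shift: "(x + M) + 1 = (x + 1) + M" "(x + M) - 1 = (x - 1) + M" for x M :: int by simp_all
  have g_per: "g a Q (i + M) j = g a Q i j" "g a Q i (j + M) = g a Q i j" if "lattice_periodic M Q" for a M Q i j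
  proof -
    have "Q (x + M) y = Q x y" "Q x (y + M) = Q x y" for x y using that by (simp_all add: lattice_periodic_def)
    then show "g a Q (i + M) j = g a Q i j" "g a Q i (j + M) = g a Q i j"
      unfolding g_def shift by (simp_all only:)
  qed
  define M where "M = M1 * M2"
  have M12: "0 < M1" "0 < M2" using Q1 Q2 by (simp_all add: lattice_periodic_def)
  then have M: "0 < M" by (simp add: M_def)
  have per: "lattice_periodic M Q1" "lattice_periodic M Q2"
    using lattice_periodic_mult[OF Q1(1) M12(2)] lattice_periodic_mult[OF Q2(1) M12(1)] by (simp_all add: M_def mult.commute)
  have v: "v1 = period_mean M (g (a + d) Q1)" "v2 = period_mean M (g (a - d) Q2)"
    using period_mean_mult[of "g (a + d) Q1", OF g_per[OF Q1(1)] M12]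
      period_mean_mult[of "g (a - d) Q2", OF g_per[OF Q2(1)] M12(2,1)] Q1(2) Q2(2)
    by (simp_all add: M_def mult.commute)
  obtain B1 where B1: "0 \<le> B1" "\<And>i j. \<bar>Q1 i j\<bar> \<le> B1" using lattice_periodic_bounded[OF per(1)] by blast
  obtain B2 where B2: "0 \<le> B2" "\<And>i j. \<bar>Q2 i j\<bar> \<le> B2" using lattice_periodic_bounded[OF per(2)] by blast
  define B where "B = B1 + B2"
  have B: "\<bar>Q1 i j\<bar> \<le> B" "\<bar>Q2 i j\<bar> \<le> B" "0 \<le> B" for i j
    using B1 B2 by (auto simp: B_def intro: add_increasing add_increasing2)
  \<comment> \<open>R dominates every argument of \<Phi> below: the centres a, a + d, a - d and b,
    the sawtooth part of size at most |d|, and second differences of functions bounded by B.\<close>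
  define R where "R = \<bar>a\<bar> + \<bar>b\<bar> + 2 * \<bar>d\<bar> + 4 * B"
  obtain C0 where C0: "\<And>x y. \<bar>x\<bar> \<le> R \<Longrightarrow> \<bar>y\<bar> \<le> R \<Longrightarrow> \<bar>\<Phi> x y\<bar> \<le> C0"
    using \<Phi> unfolding locally_bounded_def by blast
  define C where "C = \<bar>C0\<bar>"
  have C: "0 \<le> C" "\<And>x y. \<bar>x\<bar> \<le> R \<Longrightarrow> \<bar>y\<bar> \<le> R \<Longrightarrow> \<bar>\<Phi> x y\<bar> \<le> C"
    using order_trans[OF C0 abs_ge_self] by (simp_all add: C_def)
  define L where "L = max 1 \<lceil>4 * C / \<epsilon>\<rceil>"
  have L: "1 \<le> L" "4 * C / \<epsilon> \<le> L"
    using le_of_int_ceiling[of "4 * C / \<epsilon>"] by (simp_all add: L_def of_int_max le_max_iff_disj)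
  define K where "K = L * M"
  have K: "0 < K" using L M by (simp add: K_def)
  have small: "4 * C / K \<le> \<epsilon>"
  proof -
    have "4 * C \<le> \<epsilon> * L" using L \<epsilon> by (simp add: divide_le_eq mult.commute)
    also have "\<dots> \<le> \<epsilon> * K" using L M \<epsilon> by (intro mult_left_mono) (simp_all add: K_def flip: of_int_mult)
    finally show ?thesis using K by (simp add: divide_le_eq)
  qed
  define P where "P i j = (if i mod (2 * K) < K then Q1 i j else Q2 i j)" for i j
  define Q where "Q i j = sawtooth K d i + P i j" for i j
  have perK: "lattice_periodic (2 * K) Q1" "lattice_periodic (2 * K) Q2"
    using lattice_periodic_mult[OF per(1), of "2 * L"] lattice_periodic_mult[OF per(2), of "2 * L"] L
    by (simp_all add: K_def mult.assoc)
  have perQ: "lattice_periodic (2 * K) Q"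
    using perK K by (simp add: lattice_periodic_def Q_def P_def sawtooth_values(4))
  have PB: "\<bar>P i j\<bar> \<le> B" for i j using B by (simp add: P_def)
  have diffB: "\<bar>diff2_fst X i j\<bar> \<le> 4 * B" "\<bar>diff2_snd X i j\<bar> \<le> 4 * B" if "\<And>i j. \<bar>X i j\<bar> \<le> B" for X i j
    using that[of "i + 1" j] that[of "i - 1" j] that[of i j] that[of i "j + 1"] that[of i "j - 1"] by linarith+
  have D1: "diff2_fst Q i j = (sawtooth K d (i + 1) + sawtooth K d (i - 1) - 2 * sawtooth K d i) + diff2_fst P i j" for i j
    by (simp add: Q_def)
  have D2: "diff2_snd Q i j = diff2_snd P i j" for i j by (simp add: Q_def)
  have gB: "\<bar>g a Q i j\<bar> \<le> C" if "0 \<le> i" "i < 2 * K" for i j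
    unfolding g_def D1 D2
    using diffB[of P i j, OF PB] sawtooth_diff2(3)[OF K that, of d] by (intro C) (auto simp: R_def)
  have gB1: "\<bar>g (a + d) Q1 i j\<bar> \<le> C" for i j
    unfolding g_def using diffB[of Q1 i j, OF B(1)] by (intro C) (auto simp: R_def)
  have gB2: "\<bar>g (a - d) Q2 i j\<bar> \<le> C" for i j
    unfolding g_def using diffB[of Q2 i j, OF B(2)] by (intro C) (auto simp: R_def)
  \<comment> \<open>The column K - 1 is excluded because its right neighbour lies in the second
    strip, and the column 0 because, by periodicity, its left neighbour does.\<close>
  have eq1: "g a Q i j = g (a + d) Q1 i j" if "1 \<le> i" "i \<le> K - 2" for i j
    unfolding g_def D1 D2 using that K sawtooth_diff2(1)[OF K, of i d] by (simp add: P_def mod_pos_pos_trivial add.assoc)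
  have eq2: "g a Q i j = g (a - d) Q2 i j" if "K + 1 \<le> i" "i \<le> 2 * K - 2" for i j
  proof -
    have P: "diff2_fst P i j = diff2_fst Q2 i j" "diff2_snd P i j = diff2_snd Q2 i j"
      using that K by (simp_all add: P_def mod_pos_pos_trivial)
    have "a + (- d + x) = a - d + x" for x by simp
    moreover have "sawtooth K d (i + 1) + sawtooth K d (i - 1) - 2 * sawtooth K d i = - d"
      using that by (intro sawtooth_diff2(2) K) auto
    ultimately show ?thesis unfolding g_def D1 D2 P by (simp only:)
  qed
  define T where "T h i = (\<Sum>j\<in>{0..<2 * K}. h i j)" for h :: "int \<Rightarrow> int \<Rightarrow> real" and i
  have TB: "\<bar>T h i\<bar> \<le> 2 * K * C" if "\<And>j. \<bar>h i j\<bar> \<le> C" for h i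
  proof -
    have "\<bar>T h i\<bar> \<le> (\<Sum>j\<in>{0..<2 * K}. C)"
      unfolding T_def using that by (intro order_trans[OF sum_abs] sum_mono)
    then show ?thesis using K by simp
  qed
  have half: "(\<Sum>i\<in>{c..<c + K}. T h i) - 8 * K * C \<le> (\<Sum>i\<in>{c..<c + K}. T (g a Q) i)"
    if c: "0 \<le> c" "c + K \<le> 2 * K" and hB: "\<And>i j. \<bar>h i j\<bar> \<le> C"
      and h: "\<And>i j. c + 1 \<le> i \<Longrightarrow> i \<le> c + K - 2 \<Longrightarrow> g a Q i j = h i j" for c h
  proof -
    have "(\<Sum>i\<in>{c..<c + K}. T h i) - (\<Sum>i\<in>{c..<c + K}. T (g a Q) i) = (\<Sum>i\<in>{c..<c + K}. T h i - T (g a Q) i)"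
      by (simp add: sum_subtractf)
    also have "\<dots> = (\<Sum>i\<in>{c, c + K - 1}. T h i - T (g a Q) i)"
    proof (rule sum.mono_neutral_right)
      show "{c, c + K - 1} \<subseteq> {c..<c + K}" using K by auto
      show "\<forall>i\<in>{c..<c + K} - {c, c + K - 1}. T h i - T (g a Q) i = 0"
        using h by (auto simp: T_def intro!: sum.cong)
    qed simp
    also have "\<dots> \<le> (\<Sum>i\<in>{c, c + K - 1}. 4 * K * C)"
    proof (rule sum_mono)
      fix i assume "i \<in> {c, c + K - 1}"
      then have "0 \<le> i" "i < 2 * K" using c K by auto
      then show "T h i - T (g a Q) i \<le> 4 * K * C"
        using TB[of h i, OF hB] TB[of "g a Q" i, OF gB] by linarith
    qed
    \<comment> \<open>For K = 1 the two boundary columns coincide.\<close>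
    also have "\<dots> \<le> 8 * K * C" using K C(1) by (cases "K = 1") auto
    finally show ?thesis by linarith
  qed
  have full: "(\<Sum>i\<in>{c * M..<c * M + K}. T (g x X) i) = 2 * (K\<^sup>2 * period_mean M (g x X))"
    if "lattice_periodic M X" "0 \<le> c" for x X c
  proof -
    have row: "T (g x X) i = 2 * L * (\<Sum>j\<in>{0..<M}. g x X i j)" for i
      using sum_period_mult[of "g x X i" M "2 * L", OF g_per(2)[OF that(1)]] M L by (simp add: T_def K_def mult.assoc)
    have perT: "T (g x X) (i + M) = T (g x X) i" for i
      using g_per(1)[OF that(1)] by (simp add: T_def)
    have "(\<Sum>i\<in>{c * M..<c * M + K}. T (g x X) i) = (\<Sum>i\<in>{0..<K}. T (g x X) (i + c * M))"
      using sum_shift_int[of "T (g x X)" 0 "c * M" K] by (simp add: add.commute)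
    also have "\<dots> = (\<Sum>i\<in>{0..<K}. T (g x X) i)"
      using periodic_mult[of "T (g x X)", OF perT that(2)] by simp
    also have "\<dots> = L * (\<Sum>i\<in>{0..<M}. T (g x X) i)"
      unfolding K_def using M L by (intro sum_period_mult perT) auto
    also have "\<dots> = 2 * (real_of_int L)\<^sup>2 * (\<Sum>i\<in>{0..<M}. \<Sum>j\<in>{0..<M}. g x X i j)"
      by (simp add: row sum_distrib_left[symmetric] power2_eq_square)
    also have "\<dots> = 2 * (K\<^sup>2 * period_mean M (g x X))"
      using M by (simp add: period_mean_def K_def power_mult_distrib)
    finally show ?thesis .
  qed
  have "2 * (K\<^sup>2 * v1) - 8 * K * C \<le> (\<Sum>i\<in>{0..<K}. T (g a Q) i)"
    using half[of 0 "g (a + d) Q1"] full[OF per(1), of 0 "a + d"] gB1 eq1 v K by simp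
  moreover have "2 * (K\<^sup>2 * v2) - 8 * K * C \<le> (\<Sum>i\<in>{K..<2 * K}. T (g a Q) i)"
    using half[of K "g (a - d) Q2"] full[OF per(2), of L "a - d"] gB2 eq2 v K L by (simp add: K_def[symmetric])
  moreover have "(\<Sum>i\<in>{0..<2 * K}. T (g a Q) i) = (\<Sum>i\<in>{0..<K}. T (g a Q) i) + (\<Sum>i\<in>{K..<2 * K}. T (g a Q) i)"
    using K by (subst sum.union_disjoint[symmetric]) (auto intro!: sum.cong)
  ultimately have tot: "2 * K\<^sup>2 * (v1 + v2) - 16 * K * C \<le> (\<Sum>i\<in>{0..<2 * K}. T (g a Q) i)"
    by (simp add: distrib_left)
  have "(v1 + v2) / 2 - 4 * C / K = (2 * K\<^sup>2 * (v1 + v2) - 16 * K * C) / (real_of_int (2 * K))\<^sup>2"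
    using K by (simp add: field_simps power2_eq_square)
  also have "\<dots> \<le> period_mean (2 * K) (g a Q)"
    unfolding period_mean_def using tot by (intro divide_right_mono) (simp_all add: T_def)
  finally have "(v1 + v2) / 2 - \<epsilon> \<le> period_mean (2 * K) (g a Q)" using small by linarith
  moreover have "period_mean (2 * K) (g a Q) \<in> attained \<Phi> a b"
    by (rule attainedI[OF perQ]) (simp add: g_def[abs_def])
  ultimately show ?thesis by blast
qed

lemma attained_swap:
  assumes "\<And>x y. \<Phi> y x = \<Phi> x y" "v \<in> attained \<Phi> a b"
  shows "v \<in> attained \<Phi> b a"
proof -
  obtain M Q where Q: "lattice_periodic M Q" "v = period_mean M (\<lambda>i j. \<Phi> (a + diff2_fst Q i j) (b + diff2_snd Q i j))"
    using assms(2) unfolding attained_def by blast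
  show ?thesis
  proof (rule attainedI)
    show "lattice_periodic M (\<lambda>i j. Q j i)" using Q(1) by (simp add: lattice_periodic_def)
    show "v = period_mean M (\<lambda>i j. \<Phi> (b + diff2_fst (\<lambda>i j. Q j i) i j) (a + diff2_snd (\<lambda>i j. Q j i) i j))"
      unfolding Q(2) period_mean_def by (subst sum.swap) (simp only: assms(1))
  qed
qed

lemma attained_uminus:
  assumes "\<And>x y. \<Phi> (- x) (- y) = \<Phi> x y" "v \<in> attained \<Phi> a b"
  shows "v \<in> attained \<Phi> (- a) (- b)"
proof -
  obtain M Q where Q: "lattice_periodic M Q" "v = period_mean M (\<lambda>i j. \<Phi> (a + diff2_fst Q i j) (b + diff2_snd Q i j))"
    using assms(2) unfolding attained_def by blast
  show ?thesis
  proof (rule attainedI)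
    show "lattice_periodic M (\<lambda>i j. - Q i j)" using Q(1) by (simp add: lattice_periodic_def)
    have "- a + diff2_fst (\<lambda>i j. - Q i j) i j = - (a + diff2_fst Q i j)" "- b + diff2_snd (\<lambda>i j. - Q i j) i j = - (b + diff2_snd Q i j)" for i j
      by simp_all
    then show "v = period_mean M (\<lambda>i j. \<Phi> (- a + diff2_fst (\<lambda>i j. - Q i j) i j) (- b + diff2_snd (\<lambda>i j. - Q i j) i j))"
      unfolding Q(2) by (simp only: assms(1))
  qed
qed

lemma attained_scale:
  assumes "\<And>x y. \<Phi> (s * x) (s * y) = c * \<Phi> x y" "v \<in> attained \<Phi> a b"
  shows "c * v \<in> attained \<Phi> (s * a) (s * b)"
proof -
  obtain M Q where Q: "lattice_periodic M Q" "v = period_mean M (\<lambda>i j. \<Phi> (a + diff2_fst Q i j) (b + diff2_snd Q i j))"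
    using assms(2) unfolding attained_def by blast
  show ?thesis
  proof (rule attainedI)
    show "lattice_periodic M (\<lambda>i j. s * Q i j)" using Q(1) by (simp add: lattice_periodic_def)
    have "s * a + diff2_fst (\<lambda>i j. s * Q i j) i j = s * (a + diff2_fst Q i j)" "s * b + diff2_snd (\<lambda>i j. s * Q i j) i j = s * (b + diff2_snd Q i j)" for i j
      by (simp_all add: algebra_simps)
    then show "c * v = period_mean M (\<lambda>i j. \<Phi> (s * a + diff2_fst (\<lambda>i j. s * Q i j) i j) (s * b + diff2_snd (\<lambda>i j. s * Q i j) i j))"
      unfolding Q(2) by (simp only: assms(1) period_mean_def sum_distrib_left[symmetric] times_divide_eq_right)
  qed
qed

lemma attained_const: "\<Phi> a b \<in> attained \<Phi> a b"
  by (rule attainedI[of 1 "\<lambda>_ _. 0"]) (simp_all add: lattice_periodic_def period_mean_def)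

text \<open>In the coordinates x = a + b and y = a - b, concavity of the supremum W in a and in b
  becomes concavity along (1, 1) and (1, -1), and invariance of \<Phi> under swap and negation
  becomes evenness in x and in y. The majorant lemma is applied to the rotated function and to its
  transpose, one for each bound.\<close>

lemma period_inequality_constant_ge:
  fixes C p :: real
  assumes p: "1 < p" and C: "0 \<le> C"
    and hyp: "\<And>M Q. lattice_periodic M Q \<Longrightarrow> period_mean M (\<lambda>i j. \<bar>diff2_fst Q i j - diff2_snd Q i j\<bar> powr p)
      \<le> C powr p * period_mean M (\<lambda>i j. \<bar>diff2_fst Q i j + diff2_snd Q i j\<bar> powr p)"
  shows "p - 1 \<le> C" "1 / (p - 1) \<le> C"
proof -
  define \<Phi> where "\<Phi> a b = \<bar>a - b\<bar> powr p - C powr p * \<bar>a + b\<bar> powr p" for a b :: real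
  have swap: "\<Phi> b a = \<Phi> a b" and neg: "\<Phi> (- a) (- b) = \<Phi> a b" for a b
    by (simp_all add: \<Phi>_def abs_minus_commute add.commute)
  have scale: "\<Phi> (s * a) (s * b) = s powr p * \<Phi> a b" if "0 < s" for s a b
    using that by (simp add: \<Phi>_def right_diff_distrib[symmetric] distrib_left[symmetric] abs_mult powr_mult)
      (simp add: right_diff_distrib)
  have bdd: "locally_bounded \<Phi>"
    unfolding locally_bounded_def
  proof (intro allI exI impI)
    fix R x y :: real assume xy: "\<bar>x\<bar> \<le> R" "\<bar>y\<bar> \<le> R"
    have 1: "\<bar>x - y\<bar> powr p \<le> (2 * R) powr p" "\<bar>x + y\<bar> powr p \<le> (2 * R) powr p"
      using p xy by (auto intro!: powr_mono2)
    have "\<bar>\<Phi> x y\<bar> \<le> \<bar>x - y\<bar> powr p + C powr p * \<bar>x + y\<bar> powr p"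
      unfolding \<Phi>_def by (intro order_trans[OF abs_triangle_ineq4]) (simp add: abs_mult)
    also have "\<dots> \<le> (2 * R) powr p + C powr p * (2 * R) powr p"
      using 1 by (intro add_mono mult_left_mono) auto
    finally show "\<bar>\<Phi> x y\<bar> \<le> (2 * R) powr p + C powr p * (2 * R) powr p" .
  qed
  let ?A = "attained \<Phi>"
  define W where "W a b = Sup (?A a b)" for a b
  have splice: "(v1 + v2) / 2 \<le> u" if "\<And>v. v \<in> ?A a b \<Longrightarrow> v \<le> u" "v1 \<in> ?A (a + d) b" "v2 \<in> ?A (a - d) b" for v1 v2 a b d u
  proof (rule field_le_epsilon)
    fix e :: real assume "0 < e"
    from attained_splice[OF bdd that(2,3) this] obtain v where "v \<in> ?A a b" "(v1 + v2) / 2 - e \<le> v"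
      by blast
    with that(1)[of v] show "(v1 + v2) / 2 \<le> u + e" by linarith
  qed
  have b00: "v \<le> 0" if v: "v \<in> ?A 0 0" for v
  proof -
    obtain M Q where Q: "lattice_periodic M Q" "v = period_mean M (\<lambda>i j. \<Phi> (0 + diff2_fst Q i j) (0 + diff2_snd Q i j))"
      using v unfolding attained_def by blast
    have "v = period_mean M (\<lambda>i j. \<bar>diff2_fst Q i j - diff2_snd Q i j\<bar> powr p)
        - C powr p * period_mean M (\<lambda>i j. \<bar>diff2_fst Q i j + diff2_snd Q i j\<bar> powr p)"
      unfolding Q(2) period_mean_def \<Phi>_def add_0_left
      by (simp only: sum_subtractf sum_distrib_left[symmetric] diff_divide_distrib times_divide_eq_right)
    then show ?thesis using hyp[OF Q(1)] by simp
  qed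
  \<comment> \<open>Splicing a value attained at (a, 0) with the constant at (- a, 0) gives, up to
    an arbitrarily small error, a value attained at (0, 0), which is nonpositive. \<open>bab\<close>
    repeats this in the other variable.\<close>
  have ba0: "v \<le> - \<Phi> (- a) 0" if "v \<in> ?A a 0" for v a
    using splice[of 0 0 0 v a "\<Phi> (- a) 0", OF b00] that attained_const[of \<Phi> "- a" 0] by simp
  have bab: "v \<le> - 2 * \<Phi> (- a) 0 - \<Phi> (- b) a" if "v \<in> ?A a b" for v a b
  proof -
    have "v \<in> ?A (0 + b) a" using attained_swap[of \<Phi>, OF swap that] by simp
    moreover have "\<Phi> (- b) a \<in> ?A (0 - b) a" using attained_const[of \<Phi> "- b" a] by simp
    moreover have "u \<le> - \<Phi> (- a) 0" if "u \<in> ?A 0 a" for u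
      using attained_swap[of \<Phi>, OF swap that] by (rule ba0)
    ultimately have "(v + \<Phi> (- b) a) / 2 \<le> - \<Phi> (- a) 0" by (intro splice[of 0 a])
    then show ?thesis by simp
  qed
  have bddA: "bdd_above (?A a b)" for a b using bab by (rule bdd_aboveI)
  have ne: "?A a b \<noteq> {}" for a b using attained_const[of \<Phi> a b] by auto
  have upper: "v \<le> W a b" if "v \<in> ?A a b" for v a b
    unfolding W_def by (rule cSup_upper[OF that bddA])
  have midA: "(W (a + d) b + W (a - d) b) / 2 \<le> W a b" for a b d
  proof -
    have "v1 \<le> 2 * W a b - v2" if "v1 \<in> ?A (a + d) b" "v2 \<in> ?A (a - d) b" for v1 v2
      using splice[of a b "W a b" v1 d v2, OF upper that] by simp
    then have "W (a + d) b \<le> 2 * W a b - v2" if "v2 \<in> ?A (a - d) b" for v2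
      unfolding W_def[of "a + d"] using that by (intro cSup_least ne) blast
    then have "v2 \<le> 2 * W a b - W (a + d) b" if "v2 \<in> ?A (a - d) b" for v2
      using that by (simp add: le_diff_eq add.commute)
    then have "W (a - d) b \<le> 2 * W a b - W (a + d) b"
      unfolding W_def[of "a - d"] by (intro cSup_least ne)
    then show ?thesis by simp
  qed
  have Wswap: "W a b = W b a" for a b
  proof -
    have "?A a b = ?A b a" using attained_swap[of \<Phi>, OF swap] by blast
    then show ?thesis by (simp add: W_def)
  qed
  have Wneg: "W (- a) (- b) = W a b" for a b
  proof -
    have "?A (- a) (- b) = ?A a b"
      using attained_uminus[of \<Phi>, OF neg] attained_uminus[of \<Phi> _ "- a" "- b", OF neg] by auto
    then show ?thesis by (simp add: W_def)
  qed
  have midB: "(W a (b + d) + W a (b - d)) / 2 \<le> W a b" for a b d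
    using midA[of b d a] by (simp add: Wswap[of a])
  have Whom: "s powr p * W a b \<le> W (s * a) (s * b)" if s: "0 < s" for s a b
  proof -
    have "v \<le> W (s * a) (s * b) / s powr p" if "v \<in> ?A a b" for v
      using upper[OF attained_scale[of \<Phi> s, OF scale[OF s] that]] s by (simp add: le_divide_eq mult.commute)
    then have "W a b \<le> W (s * a) (s * b) / s powr p"
      unfolding W_def[of a b] by (intro cSup_least ne)
    then show ?thesis using s by (simp add: le_divide_eq mult.commute)
  qed
  have major: "\<Phi> a b \<le> W a b" for a b by (rule upper[OF attained_const])
  have rot: "(x + y) / 2 - (x - y) / 2 = y" "(x + y) / 2 + (x - y) / 2 = x" for x y :: real
    by (simp_all add: field_simps)

  define W1 where "W1 x y = W ((x + y) / 2) ((x - y) / 2)" for x y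
  have h: "((x + t) + (y + t)) / 2 = (x + y) / 2 + t" "((x + t) - (y + t)) / 2 = (x - y) / 2"
    "((x - t) + (y - t)) / 2 = (x + y) / 2 - t" "((x - t) - (y - t)) / 2 = (x - y) / 2"
    "((x + t) + (y - t)) / 2 = (x + y) / 2" "((x + t) - (y - t)) / 2 = (x - y) / 2 + t"
    "((x - t) + (y + t)) / 2 = (x + y) / 2" "((x - t) - (y + t)) / 2 = (x - y) / 2 - t" for x y t :: real
    by (simp_all add: field_simps)
  have mid1: "(W1 (x + t) (y + t) + W1 (x - t) (y - t)) / 2 \<le> W1 x y" for x y t
    unfolding W1_def h by (rule midA)
  have mid2: "(W1 (x + t) (y - t) + W1 (x - t) (y + t)) / 2 \<le> W1 x y" for x y t
    unfolding W1_def h by (rule midB)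
  have hom: "s powr p * W1 x y \<le> W1 (s * x) (s * y)" if "0 < s" for s x y
    using Whom[OF that, of "(x + y) / 2" "(x - y) / 2"] by (simp add: W1_def right_diff_distrib distrib_left)
  have symx: "W1 (- x) y = W1 x y" for x y
  proof -
    have "W1 (- x) y = W (- ((x - y) / 2)) (- ((x + y) / 2))" by (simp add: W1_def minus_divide_left)
    then show ?thesis unfolding Wneg by (simp add: W1_def Wswap)
  qed
  have symy: "W1 x (- y) = W1 x y" for x y
    by (simp add: W1_def) (rule Wswap)
  have maj: "\<bar>y\<bar> powr p - C powr p * \<bar>x\<bar> powr p \<le> W1 x y" for x y
    using major[of "(x + y) / 2" "(x - y) / 2"] by (simp add: \<Phi>_def W1_def rot)

  have q: "0 < 1 - 1 / p" using p by simp
  \<comment> \<open>At this point the function equals (1 - 1/p)^p - (C/p)^p, so its nonpositivity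
    amounts to C \<ge> p - 1; with the variables exchanged it amounts to C \<ge> 1/(p - 1).\<close>
  have "(\<lambda>x y. \<bar>y\<bar> powr p - C powr p * \<bar>x\<bar> powr p) (1 / p) (1 - 1 / p) \<le> 0"
  proof (rule zigzag_concave_majorant[OF p mid1 mid2])
    show "isCont ((\<lambda>x y. \<bar>y\<bar> powr p - C powr p * \<bar>x\<bar> powr p) (1 / p)) (1 - 1 / p)"
      using q by (intro continuous_intros) auto
  qed (use hom[of _ 0 1] symx maj in auto)
  then have "(1 - 1 / p) powr p \<le> (C / p) powr p"
    using q p C by (simp add: powr_divide powr_one_eq_one)
  then have "1 - 1 / p \<le> C / p"
    using p C q powr_less_mono2[of p "C / p" "1 - 1 / p"] by (meson divide_nonneg_nonneg less_eq_real_def less_le_trans linorder_not_less order_less_trans zero_less_one)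
  then have "p * (1 - 1 / p) \<le> p * (C / p)" using p by (intro mult_left_mono) auto
  then show "p - 1 \<le> C" using p by (simp add: right_diff_distrib)

  have "(\<lambda>x y. \<bar>x\<bar> powr p - C powr p * \<bar>y\<bar> powr p) (1 / p) (1 - 1 / p) \<le> 0"
  proof (rule zigzag_concave_majorant[OF p, where W = "\<lambda>x y. W1 y x"])
    show "isCont ((\<lambda>x y. \<bar>x\<bar> powr p - C powr p * \<bar>y\<bar> powr p) (1 / p)) (1 - 1 / p)"
      using q by (intro continuous_intros) auto
    show "(W1 (y + t) (x + t) + W1 (y - t) (x - t)) / 2 \<le> W1 y x" for x y t by (rule mid1)
    show "(W1 (y - t) (x + t) + W1 (y + t) (x - t)) / 2 \<le> W1 y x" for x y t
      using mid2[of y t x] by (simp add: add.commute)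
  qed (use hom[of _ 1 0] symy maj in auto)
  then have "(1 / p) powr p \<le> (C * (1 - 1 / p)) powr p"
    using q p by (simp add: powr_mult)
  then have "1 / p \<le> C * (1 - 1 / p)"
    using p C q powr_less_mono2[of p "C * (1 - 1 / p)" "1 / p"] by (meson mult_nonneg_nonneg less_eq_real_def less_le_trans linorder_not_less order_less_trans zero_less_one)
  then have "p * (1 / p) \<le> p * (C * (1 - 1 / p))" using p by (intro mult_left_mono) auto
  also have "\<dots> = C * (p - 1)" using p by (simp add: right_diff_distrib)
  finally show "1 / (p - 1) \<le> C" using p by (simp add: divide_le_eq)
qed

section \<open>From the operator bound to periodic functions\<close>

definition int_box :: "int \<Rightarrow> int \<Rightarrow> (int^'n::finite) set" where
  "int_box lo hi = {n. \<forall>i. lo \<le> n $ i \<and> n $ i < hi}"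

lemma int_box_eq_image: "int_box lo hi = vec_lambda ` (PiE UNIV (\<lambda>_. {lo..<hi}))"
proof (intro equalityI subsetI)
  fix n :: "int^'n" assume "n \<in> int_box lo hi"
  then have "(\<lambda>i. n $ i) \<in> PiE UNIV (\<lambda>_. {lo..<hi})" by (auto simp: int_box_def)
  then have "vec_lambda (\<lambda>i. n $ i) \<in> vec_lambda ` (PiE UNIV (\<lambda>_. {lo..<hi}))" by (rule imageI)
  then show "n \<in> vec_lambda ` (PiE UNIV (\<lambda>_. {lo..<hi}))" by (simp only: vec_nth_inverse)
next
  fix n :: "int^'n" assume "n \<in> vec_lambda ` (PiE UNIV (\<lambda>_. {lo..<hi}))"
  then show "n \<in> int_box lo hi" by (auto simp: int_box_def PiE_iff)
qed

lemma finite_int_box: "finite (int_box lo hi)"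
  unfolding int_box_eq_image by (intro finite_imageI finite_PiE) auto

lemma card_int_box: "card (int_box lo hi :: (int^'n::finite) set) = nat (hi - lo) ^ CARD('n)"
proof -
  have "inj_on (vec_lambda :: ('n \<Rightarrow> int) \<Rightarrow> _) A" for A
    by (intro inj_onI) (metis vec_lambda_inverse UNIV_I)
  then show ?thesis by (simp add: int_box_eq_image card_image card_PiE)
qed

lemma int_box_mono: "lo' \<le> lo \<Longrightarrow> hi \<le> hi' \<Longrightarrow> int_box lo hi \<subseteq> int_box lo' hi'"
  unfolding int_box_def by (auto intro: order_trans) (meson less_le_trans)

text \<open>All fibres of the projection to the two coordinates have the same size F, since the two
  entries can be overwritten freely. Testing with the constant 1 eliminates F.\<close>

lemma sum_int_box_two_coordinates:
  fixes g :: "int \<Rightarrow> int \<Rightarrow> real" and i1 i2 :: "'n::finite"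
  assumes ne: "i1 \<noteq> i2" and K: "0 < K"
  shows "(\<Sum>n\<in>int_box 0 K. g (n $ i1) (n $ i2)) = card (int_box 0 K :: (int^'n) set) * period_mean K g"
proof -
  let ?B = "int_box 0 K :: (int^'n) set" and ?T = "{0..<K} \<times> {0..<K}"
  let ?\<pi> = "\<lambda>n::int^'n. (n $ i1, n $ i2)"
  define F where "F = card {n \<in> ?B. ?\<pi> n = (0, 0)}"
  have fiber: "card {n \<in> ?B. ?\<pi> n = y} = F" if y: "y \<in> ?T" for y
  proof -
    define put where "put a b n = (\<chi> k. if k = i1 then a else if k = i2 then b else n $ k)" for a b and n :: "int^'n"
    have "bij_betw (put (fst y) (snd y)) {n \<in> ?B. ?\<pi> n = (0, 0)} {n \<in> ?B. ?\<pi> n = y}"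
      by (rule bij_betw_byWitness[of _ "put 0 0"])
         (use y K ne in \<open>auto simp: put_def int_box_def vec_eq_iff\<close>)
    then show ?thesis unfolding F_def by (rule bij_betw_same_card[symmetric])
  qed
  have img: "?\<pi> ` ?B \<subseteq> ?T" by (auto simp: int_box_def)
  have sum: "(\<Sum>n\<in>?B. h (n $ i1) (n $ i2)) = F * ((real_of_int K)\<^sup>2 * period_mean K h)" for h
  proof -
    have "(\<Sum>n\<in>?B. h (n $ i1) (n $ i2)) = (\<Sum>y\<in>?T. \<Sum>n\<in>{n \<in> ?B. ?\<pi> n = y}. h (n $ i1) (n $ i2))"
      by (rule sum.group[symmetric]) (use finite_int_box img in auto)
    also have "\<dots> = (\<Sum>y\<in>?T. F * h (fst y) (snd y))"
    proof (rule sum.cong[OF refl])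
      fix y assume y: "y \<in> ?T"
      have "(\<Sum>n\<in>{n \<in> ?B. ?\<pi> n = y}. h (n $ i1) (n $ i2)) = (\<Sum>n\<in>{n \<in> ?B. ?\<pi> n = y}. h (fst y) (snd y))"
        by (rule sum.cong) auto
      then show "(\<Sum>n\<in>{n \<in> ?B. ?\<pi> n = y}. h (n $ i1) (n $ i2)) = F * h (fst y) (snd y)"
        by (simp only: sum_constant fiber[OF y])
    qed
    also have "\<dots> = F * (\<Sum>i\<in>{0..<K}. \<Sum>j\<in>{0..<K}. h i j)"
      by (simp only: sum_distrib_left[symmetric] sum.cartesian_product split_def)
    finally show ?thesis using K by (simp add: period_mean_def)
  qed
  have "real (card ?B) = F * (real_of_int K)\<^sup>2"
    using sum[of "\<lambda>_ _. 1"] K by (simp add: period_mean_def power2_eq_square)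
  then show ?thesis using sum[of g] by simp
qed

text \<open>The test function depends on two coordinates through Q, is constant in the others, and
  is cut off outside a box of side J. On \<open>inner\<close> its second differences are those of Q,
  and beyond \<open>outer\<close> its Laplacian is 0. The layer in between is a vanishing fraction
  of the box as J grows.\<close>

lemma period_inequality_of_operator_bound:
  fixes i1 i2 :: "'n::finite"
  assumes p: "1 < p" and C: "0 \<le> C" and ne: "i1 \<noteq> i2"
    and hyp: "\<And>\<psi> :: int^'n \<Rightarrow> complex. finsupp \<psi> \<Longrightarrow>
      lp_norm p (\<lambda>n. second_difference i1 \<psi> n - second_difference i2 \<psi> n) \<le> C * lp_norm p (laplacian \<psi>)"
    and Q: "lattice_periodic M Q"
  shows "period_mean M (\<lambda>i j. \<bar>diff2_fst Q i j - diff2_snd Q i j\<bar> powr p)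
      \<le> C powr p * period_mean M (\<lambda>i j. \<bar>diff2_fst Q i j + diff2_snd Q i j\<bar> powr p)"
proof -
  define dm where "dm i j = \<bar>diff2_fst Q i j - diff2_snd Q i j\<bar> powr p" for i j
  define ds where "ds i j = \<bar>diff2_fst Q i j + diff2_snd Q i j\<bar> powr p" for i j
  have M: "0 < M" using Q by (simp add: lattice_periodic_def)
  have p0: "0 < p" using p by simp
  obtain B where B: "0 \<le> B" "\<And>i j. \<bar>Q i j\<bar> \<le> B" using lattice_periodic_bounded[OF Q] by blast
  \<comment> \<open>E bounds the contribution of a single point to the Laplacian side after the
    cut-off, where all directions may be nonzero; G bounds that of the uncut Q to the difference
    side.\<close>
  define E where "E = (4 * CARD('n) * B) powr p"
  define G where "G = (8 * B) powr p"
  have shift: "(x + M) + 1 = (x + 1) + M" "(x + M) - 1 = (x - 1) + M" for x :: int by simp_all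
  have perQ: "Q (x + M) y = Q x y" "Q x (y + M) = Q x y" for x y using Q by (simp_all add: lattice_periodic_def)
  have per: "dm (i + M) j = dm i j" "dm i (j + M) = dm i j" "ds (i + M) j = ds i j" "ds i (j + M) = ds i j" for i j
    unfolding dm_def ds_def shift perQ by simp_all
  have dm_le: "dm i j \<le> G" for i j
    unfolding dm_def G_def
    using B(2)[of "i + 1" j] B(2)[of "i - 1" j] B(2)[of i j] B(2)[of i "j + 1"] B(2)[of i "j - 1"] p0
    by (intro powr_mono2) auto
  \<comment> \<open>The bracket of powers is the size of \<open>outer - inner\<close> relative to
    the box of side K.\<close>
  have estimate: "period_mean M dm \<le> C powr p * period_mean M ds
      + ((1 + 2 / K) ^ CARD('n) - (1 - 2 / K) ^ CARD('n)) * (C powr p * E + G)"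
    if L: "1 \<le> L" "2 \<le> L * M" and K_eq: "K = real_of_int (L * M)" for L K
  proof -
    define J where "J = L * M"
    have J: "2 \<le> J" "0 < J" using L by (simp_all add: J_def)
    define box where "box = (int_box 0 J :: (int^'n) set)"
    define inner where "inner = (int_box 1 (J - 1) :: (int^'n) set)"
    define outer where "outer = (int_box (- 1) (J + 1) :: (int^'n) set)"
    have fin: "finite box" "finite inner" "finite outer"
      unfolding box_def inner_def outer_def by (rule finite_int_box)+
    have sub: "inner \<subseteq> box" "box \<subseteq> outer" unfolding box_def inner_def outer_def by (intro int_box_mono; simp)+
    define \<psi> where "\<psi> n = (if n \<in> box then complex_of_real (Q (n $ i1) (n $ i2)) else 0)" for n
    have "{n. \<psi> n \<noteq> 0} \<subseteq> box" by (auto simp: \<psi>_def)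
    then have fs: "finsupp \<psi>" unfolding finsupp_def using fin(1) finite_subset by blast
    have near: "n + axis i 1 \<in> box" "n - axis i 1 \<in> box" "n \<in> box" if "n \<in> inner" for n i
    proof -
      have n: "1 \<le> n $ k" "n $ k < J - 1" for k using that by (auto simp: inner_def int_box_def)
      have "0 \<le> (n + axis i 1) $ k \<and> (n + axis i 1) $ k < J" "0 \<le> (n - axis i 1) $ k \<and> (n - axis i 1) $ k < J"
        "0 \<le> n $ k \<and> n $ k < J" for k
        using n[of k] by (auto simp: axis_def)
      then show "n + axis i 1 \<in> box" "n - axis i 1 \<in> box" "n \<in> box" by (simp_all add: box_def int_box_def)
    qed
    have inner1: "second_difference i1 \<psi> n = of_real (diff2_fst Q (n $ i1) (n $ i2))"
      and inner2: "second_difference i2 \<psi> n = of_real (diff2_snd Q (n $ i1) (n $ i2))"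
      and inner3: "\<And>i. i \<noteq> i1 \<Longrightarrow> i \<noteq> i2 \<Longrightarrow> second_difference i \<psi> n = 0" if "n \<in> inner" for n
      unfolding second_difference_eq \<psi>_def using near[OF that] ne by (auto simp: axis_def)
    have lap: "laplacian \<psi> n = of_real (diff2_fst Q (n $ i1) (n $ i2) + diff2_snd Q (n $ i1) (n $ i2))" if "n \<in> inner" for n
    proof -
      have "laplacian \<psi> n = (\<Sum>i\<in>{i1, i2}. second_difference i \<psi> n)"
        unfolding laplacian_def by (rule sum.mono_neutral_right) (use inner3[OF that] in auto)
      then show ?thesis using ne inner1[OF that] inner2[OF that] by simp
    qed
    have out: "laplacian \<psi> n = 0" if n: "n \<notin> outer" for n
    proof -
      obtain k where k: "n $ k < - 1 \<or> J + 1 \<le> n $ k"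
      proof -
        obtain k where "\<not> (- 1 \<le> n $ k \<and> n $ k < J + 1)" using n by (auto simp: outer_def int_box_def)
        then show ?thesis by (intro that[of k]) linarith
      qed
      have "(n + axis i 1) $ k < 0 \<or> J \<le> (n + axis i 1) $ k" "(n - axis i 1) $ k < 0 \<or> J \<le> (n - axis i 1) $ k"
        "n $ k < 0 \<or> J \<le> n $ k" for i
        using k by (auto simp: axis_def)
      then have "n + axis i 1 \<notin> box" "n - axis i 1 \<notin> box" "n \<notin> box" for i
        unfolding box_def int_box_def by (auto simp: not_le not_less)
      then show ?thesis by (simp add: laplacian_def second_difference_eq \<psi>_def)
    qed
    have \<psi>B: "cmod (\<psi> n) \<le> B" for n using B by (simp add: \<psi>_def)
    have lapB: "cmod (laplacian \<psi> n) powr p \<le> E" for n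
    proof -
      have "cmod (second_difference i \<psi> n) \<le> 4 * B" for i
      proof -
        have "cmod (second_difference i \<psi> n) \<le> cmod (\<psi> (n + axis i 1)) + cmod (\<psi> (n - axis i 1)) + cmod (2 * \<psi> n)"
          unfolding second_difference_eq
          by (rule order_trans[OF norm_triangle_ineq4]) (intro add_right_mono norm_triangle_ineq)
        then show ?thesis using \<psi>B[of "n + axis i 1"] \<psi>B[of "n - axis i 1"] \<psi>B[of n] by (simp add: norm_mult)
      qed
      then have "cmod (laplacian \<psi> n) \<le> (\<Sum>i\<in>(UNIV :: 'n set). 4 * B)"
        unfolding laplacian_def by (intro sum_norm_le) auto
      then show ?thesis unfolding E_def using p0 by (intro powr_mono2) auto
    qed
    have "finsupp (\<lambda>n. second_difference i1 \<psi> n - second_difference i2 \<psi> n)"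
      by (intro finsupp_diff finsupp_second_difference fs)
    from lp_sum_le[OF p0 finsupp_lp[OF this] fin(2)]
    have "(\<Sum>n\<in>inner. cmod (second_difference i1 \<psi> n - second_difference i2 \<psi> n) powr p)
        \<le> lp_norm p (\<lambda>n. second_difference i1 \<psi> n - second_difference i2 \<psi> n) powr p" .
    also have "\<dots> \<le> (C * lp_norm p (laplacian \<psi>)) powr p"
      using p0 by (intro powr_mono2 hyp fs) auto
    also have "\<dots> = C powr p * (\<Sum>n\<in>outer. cmod (laplacian \<psi> n) powr p)"
      unfolding powr_mult using out by (subst finsupp_lp_norm_powr[OF p0 fin(3)]) auto
    also have "(\<Sum>n\<in>outer. cmod (laplacian \<psi> n) powr p)
        = (\<Sum>n\<in>outer - inner. cmod (laplacian \<psi> n) powr p) + (\<Sum>n\<in>inner. cmod (laplacian \<psi> n) powr p)"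
      using sub by (intro sum.subset_diff fin) auto
    finally have main: "(\<Sum>n\<in>inner. cmod (second_difference i1 \<psi> n - second_difference i2 \<psi> n) powr p)
      \<le> C powr p * ((\<Sum>n\<in>outer - inner. cmod (laplacian \<psi> n) powr p) + (\<Sum>n\<in>inner. cmod (laplacian \<psi> n) powr p))" .
    have e1: "(\<Sum>n\<in>inner. cmod (second_difference i1 \<psi> n - second_difference i2 \<psi> n) powr p) = (\<Sum>n\<in>inner. dm (n $ i1) (n $ i2))"
      by (intro sum.cong refl) (simp only: inner1 inner2 dm_def norm_of_real of_real_diff[symmetric])
    have e2: "(\<Sum>n\<in>inner. cmod (laplacian \<psi> n) powr p) = (\<Sum>n\<in>inner. ds (n $ i1) (n $ i2))"
      by (intro sum.cong refl) (simp only: lap ds_def norm_of_real)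
    have e3: "(\<Sum>n\<in>inner. ds (n $ i1) (n $ i2)) \<le> (\<Sum>n\<in>box. ds (n $ i1) (n $ i2))"
      by (intro sum_mono2 fin sub) (simp add: ds_def)
    have card_diff: "real (card (outer - inner)) = real (card outer) - real (card inner)"
      using sub fin by (simp add: card_Diff_subset of_nat_diff card_mono)
    have e4: "(\<Sum>n\<in>outer - inner. cmod (laplacian \<psi> n) powr p) \<le> (real (card outer) - real (card inner)) * E"
      unfolding card_diff[symmetric] using sum_bounded_above[of "outer - inner" "\<lambda>n. cmod (laplacian \<psi> n) powr p" E] lapB by simp
    have "(\<Sum>n\<in>box. dm (n $ i1) (n $ i2)) = (\<Sum>n\<in>box - inner. dm (n $ i1) (n $ i2)) + (\<Sum>n\<in>inner. dm (n $ i1) (n $ i2))"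
      by (intro sum.subset_diff sub fin)
    moreover have "(\<Sum>n\<in>box - inner. dm (n $ i1) (n $ i2)) \<le> (\<Sum>n\<in>outer - inner. G)"
    proof -
      have "(\<Sum>n\<in>box - inner. dm (n $ i1) (n $ i2)) \<le> (\<Sum>n\<in>box - inner. G)" by (intro sum_mono dm_le)
      also have "\<dots> \<le> (\<Sum>n\<in>outer - inner. G)" using sub fin by (intro sum_mono2) (auto simp: G_def)
      finally show ?thesis .
    qed
    ultimately have e5: "(\<Sum>n\<in>box. dm (n $ i1) (n $ i2)) \<le> (real (card outer) - real (card inner)) * G + (\<Sum>n\<in>inner. dm (n $ i1) (n $ i2))"
      by (simp add: card_diff)
    have "C powr p * ((\<Sum>n\<in>outer - inner. cmod (laplacian \<psi> n) powr p) + (\<Sum>n\<in>inner. cmod (laplacian \<psi> n) powr p))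
        \<le> C powr p * ((real (card outer) - real (card inner)) * E + (\<Sum>n\<in>box. ds (n $ i1) (n $ i2)))"
      using e2 e3 e4 by (intro mult_left_mono add_mono) auto
    then have tot: "(\<Sum>n\<in>box. dm (n $ i1) (n $ i2))
        \<le> C powr p * (\<Sum>n\<in>box. ds (n $ i1) (n $ i2)) + (real (card outer) - real (card inner)) * (C powr p * E + G)"
      using main e1 e5 by (simp add: algebra_simps)
    have mean: "period_mean J h = period_mean M h" if "\<And>i j. h (i + M) j = h i j" "\<And>i j. h i (j + M) = h i j" for h
      unfolding J_def using period_mean_mult[of h M L] that M L by simp
    have box_sum: "(\<Sum>n\<in>box. dm (n $ i1) (n $ i2)) = real (card box) * period_mean M dm"
      "(\<Sum>n\<in>box. ds (n $ i1) (n $ i2)) = real (card box) * period_mean M ds"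
      unfolding box_def using sum_int_box_two_coordinates[OF ne J(2)] mean[of dm] mean[of ds] per by simp_all
    have cards: "real (card box) = K ^ CARD('n)" "real (card outer) = (K + 2) ^ CARD('n)" "real (card inner) = (K - 2) ^ CARD('n)"
      unfolding box_def outer_def inner_def card_int_box using J by (simp_all add: K_eq J_def[symmetric] of_nat_diff add.commute)
    have K: "0 < K" using J unfolding K_eq J_def[symmetric] by simp
    have "K ^ CARD('n) * period_mean M dm
        \<le> C powr p * (K ^ CARD('n) * period_mean M ds) + ((K + 2) ^ CARD('n) - (K - 2) ^ CARD('n)) * (C powr p * E + G)"
      using tot unfolding box_sum cards .
    also have "(K + 2) ^ CARD('n) = K ^ CARD('n) * (1 + 2 / K) ^ CARD('n)"
      using K by (simp add: power_mult_distrib[symmetric] distrib_left)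
    also have "(K - 2) ^ CARD('n) = K ^ CARD('n) * (1 - 2 / K) ^ CARD('n)"
      using K by (simp add: power_mult_distrib[symmetric] right_diff_distrib)
    finally have "K ^ CARD('n) * period_mean M dm \<le> K ^ CARD('n) *
        (C powr p * period_mean M ds + ((1 + 2 / K) ^ CARD('n) - (1 - 2 / K) ^ CARD('n)) * (C powr p * E + G))"
      by (simp add: algebra_simps)
    then show ?thesis using K by (subst (asm) mult_le_cancel_left_pos) auto
  qed
  define Kseq where "Kseq k = real_of_int ((int k + 2) * M)" for k
  have "period_mean M dm \<le> C powr p * period_mean M ds
      + ((1 + 2 / Kseq k) ^ CARD('n) - (1 - 2 / Kseq k) ^ CARD('n)) * (C powr p * E + G)" for k
  proof (rule estimate[of "int k + 2"])
    have "2 * 1 \<le> (int k + 2) * M" using M by (intro mult_mono) auto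
    then show "2 \<le> (int k + 2) * M" by simp
  qed (simp_all add: Kseq_def)
  moreover have "(\<lambda>k. C powr p * period_mean M ds
      + ((1 + 2 / Kseq k) ^ CARD('n) - (1 - 2 / Kseq k) ^ CARD('n)) * (C powr p * E + G))
    \<longlonglongrightarrow> C powr p * period_mean M ds + ((1 + 0) ^ CARD('n) - (1 - 0) ^ CARD('n)) * (C powr p * E + G)"
  proof (intro tendsto_intros)
    have "(\<lambda>k. (2 / real_of_int M) * (1 / real (k + 2))) \<longlonglongrightarrow> (2 / real_of_int M) * 0"
      by (intro tendsto_intros LIMSEQ_ignore_initial_segment[OF lim_1_over_n])
    moreover have "(2 / real_of_int M) * (1 / real (k + 2)) = 2 / Kseq k" for k by (simp add: Kseq_def)
    ultimately show "(\<lambda>k. 2 / Kseq k) \<longlonglongrightarrow> 0" "(\<lambda>k. 2 / Kseq k) \<longlonglongrightarrow> 0" by simp_all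
  qed
  ultimately have "period_mean M dm \<le> C powr p * period_mean M ds + ((1 + 0) ^ CARD('n) - (1 - 0) ^ CARD('n)) * (C powr p * E + G)"
    by (intro LIMSEQ_le_const) auto
  then show ?thesis by (simp add: dm_def[abs_def] ds_def[abs_def])
qed

text \<open>Each second order transform maps the Laplacian of \<psi> to the negative of the
  corresponding second difference; the sign disappears in the norm. This turns the operator norm
  into a constant for the hypothesis on periodic functions.\<close>

lemma conj_max_le_onorm:
  fixes i1 i2 :: "'n::finite"
  assumes p: "1 < p" and ne: "i1 \<noteq> i2"
  defines "\<alpha> \<equiv> axis i1 1 - axis i2 1 :: complex^'n"
  shows "conj_max p - 1 \<le> lp_onorm p (riesz2_alpha_int p \<alpha>)"
proof -
  have \<alpha>: "cmod (\<alpha> $ i) \<le> 1" for i using ne by (auto simp: \<alpha>_def axis_def)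
  define C where "C = max 0 (lp_onorm p (riesz2_alpha_int p \<alpha>))"
  have hyp: "lp_norm p (\<lambda>n. second_difference i1 \<psi> n - second_difference i2 \<psi> n) \<le> C * lp_norm p (laplacian \<psi>)"
    if \<psi>: "finsupp \<psi>" for \<psi> :: "int^'n \<Rightarrow> complex"
  proof -
    have lap: "finsupp (laplacian \<psi>)" by (rule finsupp_laplacian[OF \<psi>])
    have "(\<Sum>i\<in>UNIV. \<alpha> $ i * h i) = h i1 - h i2" for h :: "'n \<Rightarrow> complex"
    proof -
      have "(\<Sum>i\<in>UNIV. \<alpha> $ i * h i) = (\<Sum>i\<in>UNIV. if i = i1 then h i else 0) - (\<Sum>i\<in>UNIV. if i = i2 then h i else 0)"
        unfolding sum_subtractf[symmetric] by (intro sum.cong refl) (simp add: \<alpha>_def axis_def)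
      then show ?thesis by simp
    qed
    then have "riesz2_alpha_int p \<alpha> (laplacian \<psi>) = (\<lambda>n. second_difference i2 \<psi> n - second_difference i1 \<psi> n)"
      unfolding riesz2_alpha_int_finsupp[OF p lap] multiplier_riesz2_int_laplacian[OF \<psi>] by (simp add: sum_negf)
    then have "lp_norm p (\<lambda>n. second_difference i1 \<psi> n - second_difference i2 \<psi> n) = lp_norm p (riesz2_alpha_int p \<alpha> (laplacian \<psi>))"
      using lp_norm_minus_commute[of p "second_difference i1 \<psi>" "second_difference i2 \<psi>"] by (simp only:)
    also have "\<dots> \<le> lp_onorm p (riesz2_alpha_int p \<alpha>) * lp_norm p (laplacian \<psi>)"
      using p by (intro lp_norm_le_onorm riesz2_alpha_int_bounded \<alpha> finsupp_lp lap) auto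
    also have "\<dots> \<le> C * lp_norm p (laplacian \<psi>)" by (intro mult_right_mono) (simp_all add: C_def)
    finally show ?thesis .
  qed
  have C0: "0 \<le> C" by (simp add: C_def)
  note bounds = period_inequality_constant_ge[OF p C0 period_inequality_of_operator_bound[OF p C0 ne hyp]]
  have "p / (p - 1) - 1 = 1 / (p - 1)" using p by (simp add: field_simps)
  then have "conj_max p - 1 \<le> C" using bounds by (simp add: conj_max_def)
  \<comment> \<open>C was clipped at 0 to be nonnegative; as \<open>conj_max p - 1\<close> is at
    least 1, C must be the operator norm itself.\<close>
  then show ?thesis using conj_max_ge_2[OF p] by (simp add: C_def split: if_splits)
qed

theorem theorem1:
  fixes p :: real
  assumes "1 < p"
  shows "(\<forall>\<alpha>::complex^'n::finite. (\<forall>i. cmod (\<alpha> $ i) \<le> 1) \<longrightarrow>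
            lp_bounded p (riesz2_alpha_int p \<alpha>) \<and>
            lp_onorm p (riesz2_alpha_int p \<alpha>) \<le> conj_max p - 1)
       \<and> (\<forall>\<alpha>::complex^'n. (\<forall>i. cmod (\<alpha> $ i) \<le> 1) \<longrightarrow>
            lp_bounded p (riesz2_alpha_cyc \<alpha> ::
              (('m::nontriv mod_ring)^'n \<Rightarrow> complex) \<Rightarrow> (('m mod_ring)^'n \<Rightarrow> complex)) \<and>
            lp_onorm p (riesz2_alpha_cyc \<alpha> ::
              (('m mod_ring)^'n \<Rightarrow> complex) \<Rightarrow> (('m mod_ring)^'n \<Rightarrow> complex)) \<le> conj_max p - 1)
       \<and> (CARD('n) \<ge> 2 \<longrightarrow>
            (SUP \<alpha>\<in>{\<alpha>::complex^'n. \<forall>i. cmod (\<alpha> $ i) \<le> 1}. lp_onorm p (riesz2_alpha_int p \<alpha>))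
              = conj_max p - 1)"
proof (intro conjI allI impI)
  have C: "0 \<le> conj_max p - 1" using conj_max_ge_2[OF assms] by simp
  fix \<alpha> :: "complex^'n" assume \<alpha>: "\<forall>i. cmod (\<alpha> $ i) \<le> 1"
  show "lp_bounded p (riesz2_alpha_int p \<alpha>)"
    by (rule riesz2_alpha_int_bounded(1)[OF assms]) (use \<alpha> in blast)
  show "lp_onorm p (riesz2_alpha_int p \<alpha>) \<le> conj_max p - 1"
    by (rule lp_onorm_le[OF C], rule riesz2_alpha_int_bounded(2)[OF assms]) (use \<alpha> in blast)
  show "lp_bounded p (riesz2_alpha_cyc \<alpha> :: (('m mod_ring)^'n \<Rightarrow> complex) \<Rightarrow> (('m mod_ring)^'n \<Rightarrow> complex))"
    by (rule riesz2_alpha_cyc_bounded(1)[OF assms]) (use \<alpha> in blast)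
  show "lp_onorm p (riesz2_alpha_cyc \<alpha> :: (('m mod_ring)^'n \<Rightarrow> complex) \<Rightarrow> (('m mod_ring)^'n \<Rightarrow> complex)) \<le> conj_max p - 1"
    by (rule lp_onorm_le[OF C], rule riesz2_alpha_cyc_bounded(2)[OF assms]) (use \<alpha> in blast)
next
  assume "2 \<le> CARD('n)"
  then obtain i1 i2 :: 'n where ne: "i1 \<noteq> i2"
    by (metis One_nat_def Suc_1 UNIV_I card_le_Suc0_iff_eq finite not_less_eq_eq)
  have C: "0 \<le> conj_max p - 1" using conj_max_ge_2[OF assms] by simp
  let ?A = "{\<alpha>::complex^'n. \<forall>i. cmod (\<alpha> $ i) \<le> 1}"
  let ?\<alpha> = "axis i1 1 - axis i2 1 :: complex^'n"
  have mem: "?\<alpha> \<in> ?A" using ne by (auto simp: axis_def)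
  have le: "lp_onorm p (riesz2_alpha_int p \<alpha>) \<le> conj_max p - 1" if "\<alpha> \<in> ?A" for \<alpha>
    by (rule lp_onorm_le[OF C], rule riesz2_alpha_int_bounded(2)[OF assms]) (use that in blast)
  show "(SUP \<alpha>\<in>?A. lp_onorm p (riesz2_alpha_int p \<alpha>)) = conj_max p - 1"
  proof (rule antisym)
    show "(SUP \<alpha>\<in>?A. lp_onorm p (riesz2_alpha_int p \<alpha>)) \<le> conj_max p - 1"
    proof (rule cSUP_least)
      show "?A \<noteq> {}" using mem by blast
    qed (rule le)
    have "bdd_above ((\<lambda>\<alpha>. lp_onorm p (riesz2_alpha_int p \<alpha>)) ` ?A)"
      using le by (intro bdd_aboveI2)
    then have "lp_onorm p (riesz2_alpha_int p ?\<alpha>) \<le> (SUP \<alpha>\<in>?A. lp_onorm p (riesz2_alpha_int p \<alpha>))"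
      by (rule cSUP_upper[OF mem])
    then show "conj_max p - 1 \<le> (SUP \<alpha>\<in>?A. lp_onorm p (riesz2_alpha_int p \<alpha>))"
      using conj_max_le_onorm[OF assms ne] by linarith
  qed
qed

end
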